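(* Let $n\ge 2$, let $D$ be an open $SL(n,\mathbb{R})$-orbit in the manifold $Z$ of complete flags in $\mathbb{C}^n$, with base cycle $C_0\subset D$. Let $S_w$ be a Schubert variety with $\dim S_w+\dim C_0=\dim Z$ and $S_w\cap C_0\ne\emptyset$. Then $S_w$ intersects $C_0$ in $2^m$ points if $n=2m+1$ and in $2^{m-1}$ points if $n=2m$. Writing $w=k_1\dots k_m l_* l_m\dots l_1$ ($l_*$ omitted if $n=2m$), the points of intersection are given by the complete flags associated with the ordered bases $$\big((\pm i)e_{l_1}+e_{k_1},\ \dots,\ (\pm i)e_{l_m}+e_{k_m},\ e_{l_*},\ e_{l_m},\ \dots,\ e_{l_1}\big)$$ (with $e_{l_*}$ omitted if $n=2m$): if $n=2m+1$ all the $2^m$ choices of signs occur, and if $n=2m$ the points are those of these flags which lie in the given open orbit $D$.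
   Context: Let $G=SL(n,\mathbb{C})$, $G_0=SL(n,\mathbb{R})$, $K_0=SO(n,\mathbb{R})$, $B\subset G$ the upper triangular Borel subgroup, $m=\lfloor n/2\rfloor$, $Z=G/B$. $G_0$ has one open orbit in $Z$ if $n$ is odd and two open orbits (distinguished by orientation, and interchanged by an orientation-reversing map) if $n$ is even. The base cycle $C_0$ of an open $G_0$-orbit $D$ is the unique $K_0$-orbit in $D$ which is a complex submanifold; equivalently it is the set of flags in $D$ that are isotropic for $b(v,w)=v^tw$, i.e. $\dim (V_i\cap V_j^\perp)=\min\{i,n-j\}$ for all $i,j$. For $w\in\Sigma_n$ in one-line notation $w(1)\dots w(n)$, $V_w$ is the complete flag with $k$-th subspace $\langle e_{w(1)},\dots,e_{w(k)}\rangle$, and the Schubert variety $S_w$ is the closure of $B.V_w$. The flag associated with an ordered basis $(v_1,\dots,v_n)$ is $\langle v_1\rangle\subset\langle v_1,v_2\rangle\subset\dots\subset\mathbb{C}^n$. Here $(\pm i)$ denotes $\pm\sqrt{-1}$, signs chosen independently. *)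

theory Defs
  imports "HOL-Analysis.Analysis" "HOL-Combinatorics.Multiset_Permutations"
begin

text \<open>
  The space is \<open>complex ^ 'n\<close> with \<open>'n :: {finite, linorder}\<close>; the linear order on the index type
  stands for the order on \<open>{1, \<dots>, n}\<close>, where \<open>n = CARD('n)\<close>. Permutations are given in one-line
  notation, as elements of \<open>permutations_of_set UNIV\<close>.
\<close>

type_synonym 'n flag = "nat \<Rightarrow> (complex ^ 'n) set"

text \<open>Indices above \<open>n\<close> are pinned down so that equality of functions is equality of flags.\<close>

definition flags :: "'n::finite flag set" where
  "flags = {F. (\<forall>k. vec.subspace (F k) \<and> vec.dim (F k) = min k CARD('n)) \<and> mono F}"

definition flag_of :: "(complex ^ 'n::finite) list \<Rightarrow> 'n::finite flag" where
  "flag_of vs = (\<lambda>k. vec.span (set (take k vs)))"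

definition e :: "'n::finite \<Rightarrow> complex ^ 'n" where
  "e i = axis i 1"

definition coord_flag :: "'n list \<Rightarrow> 'n::finite flag" where
  "coord_flag w = flag_of (map e w)"

definition std_flag :: "'n::{finite,linorder} flag" where
  "std_flag = coord_flag (sorted_list_of_set UNIV)"

definition act :: "complex ^ 'n ^ 'n \<Rightarrow> 'n flag \<Rightarrow> 'n::finite flag" where
  "act A F = (\<lambda>k. (\<lambda>v. A *v v) ` F k)"

definition orbit :: "(complex ^ 'n ^ 'n) set \<Rightarrow> 'n flag \<Rightarrow> 'n::finite flag set" where
  "orbit H F = (\<lambda>A. act A F) ` H"

definition SL :: "(complex ^ 'n ^ 'n::finite) set" where
  "SL = {A. det A = 1}"

definition SL_real :: "(complex ^ 'n ^ 'n::finite) set" where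
  "SL_real = {A \<in> SL. \<forall>i j. A $ i $ j \<in> \<real>}"

definition SO_real :: "(complex ^ 'n ^ 'n::finite) set" where
  "SO_real = {A \<in> SL_real. transpose A ** A = mat 1}"

definition Borel :: "(complex ^ ('n::{finite,linorder}) ^ ('n::{finite,linorder})) set" where
  "Borel = {A \<in> SL. \<forall>i j. j < i \<longrightarrow> A $ i $ j = 0}"

text \<open>
  The topology of \<open>Z = G/B\<close>: the quotient topology with respect to \<open>g \<mapsto> g.std_flag\<close>.
\<close>

definition flag_topology :: "'n::{finite,linorder} flag topology" where
  "flag_topology = topology (\<lambda>U. U \<subseteq> flags \<and>
     openin (top_of_set SL) {A \<in> SL. act A std_flag \<in> U})"

lemma openin_flag_topology:
  fixes U :: "'n::{finite,linorder} flag set"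
  shows "openin flag_topology U \<longleftrightarrow>
    U \<subseteq> flags \<and> openin (top_of_set SL) {A \<in> SL. act A std_flag \<in> U}"
proof -
  let ?P = "\<lambda>U :: 'n flag set. {A \<in> SL. act A std_flag \<in> U}"
  have "istopology (\<lambda>U. U \<subseteq> flags \<and> openin (top_of_set SL) (?P U))"
    unfolding istopology_def
  proof (intro conjI allI impI)
    fix S T :: "'n flag set"
    assume "S \<subseteq> flags \<and> openin (top_of_set SL) (?P S)"
      and "T \<subseteq> flags \<and> openin (top_of_set SL) (?P T)"
    moreover have "?P (S \<inter> T) = ?P S \<inter> ?P T" by blast
    ultimately show "openin (top_of_set SL) (?P (S \<inter> T))" and "S \<inter> T \<subseteq> flags"
      by (auto intro: openin_Int)
  next
    fix \<K> :: "'n flag set set"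
    assume *: "\<forall>K\<in>\<K>. K \<subseteq> flags \<and> openin (top_of_set SL) (?P K)"
    have "?P (\<Union>\<K>) = \<Union>(?P ` \<K>)" by blast
    with * show "openin (top_of_set SL) (?P (\<Union>\<K>))" by auto
    from * show "\<Union>\<K> \<subseteq> flags" by blast
  qed
  then show ?thesis unfolding flag_topology_def by (simp add: topology_inverse')
qed

definition open_orbits :: "'n::{finite,linorder} flag set set" where
  "open_orbits = {D. openin flag_topology D \<and> (\<exists>F\<in>flags. D = orbit SL_real F)}"

definition schubert :: "'n list \<Rightarrow> 'n::{finite,linorder} flag set" where
  "schubert w = flag_topology closure_of (orbit Borel (coord_flag w))"

definition bform :: "complex ^ 'n \<Rightarrow> complex ^ 'n \<Rightarrow> complex" where
  "bform v w = (\<Sum>i\<in>UNIV. v $ i * w $ i)"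

definition perp :: "(complex ^ 'n) set \<Rightarrow> (complex ^ 'n::finite) set" where
  "perp V = {w. \<forall>v\<in>V. bform v w = 0}"

definition isotropic :: "'n::finite flag \<Rightarrow> bool" where
  "isotropic F \<longleftrightarrow> (\<forall>i\<le>CARD('n). \<forall>j\<le>CARD('n).
     vec.dim (F i \<inter> perp (F j)) = min i (CARD('n) - j))"

text \<open>
  The isotropic flags in an open orbit \<open>D\<close> form the unique \<open>SO(n,\<real>)\<close>-orbit in \<open>D\<close> that is a
  complex submanifold.
\<close>

definition base_cycle :: "'n::finite flag set \<Rightarrow> 'n flag set" where
  "base_cycle D = {F \<in> D. isotropic F}"

text \<open>
  Lie algebra of a closed linear group, as the tangent space at the identity: velocities of
  curves in the group. For closed \<open>H\<close> these are the \<open>X\<close> with \<open>exp (t X) \<in> H\<close> for all real \<open>t\<close>.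
\<close>

definition lie :: "(complex ^ 'n ^ 'n) set \<Rightarrow> (complex ^ 'n ^ 'n::finite) set" where
  "lie H = {X. \<exists>\<gamma> :: real \<Rightarrow> complex ^ 'n ^ 'n.
     (\<forall>t. \<gamma> t \<in> H) \<and> \<gamma> 0 = mat 1 \<and> (\<gamma> has_vector_derivative X) (at 0)}"

definition stabilizer :: "(complex ^ 'n ^ 'n) set \<Rightarrow> 'n flag \<Rightarrow> (complex ^ 'n ^ 'n::finite) set" where
  "stabilizer H F = {A \<in> H. act A F = F}"

text \<open>
  The manifold \<open>H.F = H / H\<^sub>F\<close> has real dimension \<open>dim H - dim H\<^sub>F\<close>; \<open>dim\<close> is the dimension over
  the reals, so a complex manifold gets twice its complex dimension.
\<close>

definition orbit_dim :: "(complex ^ 'n ^ 'n) set \<Rightarrow> 'n::finite flag \<Rightarrow> nat" where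
  "orbit_dim H F = dim (lie H) - dim (lie (stabilizer H F))"

text \<open>
  Real dimension of an \<open>H\<close>-stable set consisting of finitely many \<open>H\<close>-orbits: the largest dimension
  of an orbit. This applies to \<open>Z\<close> (one orbit of \<open>SL(n,\<complex>)\<close>), to the base cycle (one orbit of
  \<open>SO(n,\<real>)\<close>) and to a Schubert variety (finitely many orbits of the Borel subgroup).
\<close>

definition strat_dim :: "(complex ^ 'n ^ 'n) set \<Rightarrow> 'n::finite flag set \<Rightarrow> nat" where
  "strat_dim H X = Max (orbit_dim H ` X)"

definition cycle_basis ::
  "complex list \<Rightarrow> 'n list \<Rightarrow> 'n list \<Rightarrow> 'n list \<Rightarrow> (complex ^ 'n::finite) list" where
  "cycle_basis ss ks mid ls =
     map2 (\<lambda>s (k, l). s *s e l + e k) ss (zip ks ls) @ map e mid @ map e (rev ls)"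

definition sign_choices :: "nat \<Rightarrow> complex list set" where
  "sign_choices m = {ss. length ss = m \<and> set ss \<subseteq> {\<i>, - \<i>}}"

end

theory Submission
  imports Defs
begin

text \<open>
  Let \<open>F\<close> be an isotropic flag in the Schubert variety. Its stabilizer \<open>\<pp>\<close> in the algebra of all
  matrices satisfies \<open>\<bb> + \<ss> + \<pp> = \<gg>\<ll>\<close>, where \<open>\<bb>\<close> consists of the upper triangular and \<open>\<ss>\<close> of the real
  skew-symmetric matrices: the tangent spaces of the orbits of \<open>B\<close> and of \<open>SO(n,\<real>)\<close> through \<open>F\<close> span
  the tangent space of \<open>Z\<close>. When the dimensions are complementary the sum of tangent spaces is
  direct. Dually, with the trace form, the strictly upper triangular part of every skew-symmetric
  matrix in the nilradical of \<open>\<pp>\<close> lies in this nilradical. For the matrices \<open>f u\<^sup>t - u f\<^sup>t\<close> with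
  \<open>f\<close> in \<open>V\<^sub>i\<close> and \<open>u\<close> in its orthogonal complement this forces, by induction on \<open>i\<close>, that
  \<open>V\<^sub>i\<close> is spanned by vectors \<open>\<plusminus>\<i> e\<^sub>l + e\<^sub>k\<close> with \<open>l < k\<close>. So \<open>F\<close> is one of the listed flags for some
  permutation \<open>v\<close>. Since ranks are semicontinuous, \<open>v\<close> lies below \<open>w\<close> in the Bruhat order, while
  the dimension condition bounds the number of inversions of \<open>w\<close> by that of \<open>v\<close>; hence \<open>v = w\<close>.

  Real diagonal matrices with entries \<open>\<plusminus>1\<close> permute the listed flags. For odd \<open>n\<close> they all lie in one
  orbit of \<open>SL(n,\<real>)\<close>. For even \<open>n\<close> changing a single sign reverses the orientation: a real matrix
  stabilizing one of these flags has determinant \<open>\<Prod>\<bar>c\<^sub>a\<bar>\<^sup>2 \<ge> 0\<close>, so exactly half of the flags lie in \<open>D\<close>.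
\<close>

section \<open>Lie algebras of linear groups\<close>

text \<open>The groups \<open>SL\<close>, \<open>Borel\<close> and their stabilizers are
  intersections of \<open>SL\<close> with algebras \<open>pres \<F>\<close>, so tangent spaces and
  orbit dimensions become linear algebra in matrix spaces. The dimension condition enters through
  the bound dim B.G + dim K.F \<le> dim Z, with F in the intersection and K the rotation group.
  Taking G = F makes the sum of tangent spaces direct; taking for G the coordinate flag of w
  compares inversions. The trace form has to be used with its real part, since the skew-symmetric
  real matrices form only a real subspace. Duality then controls real parts alone; imaginary parts
  are recovered because the algebra of an isotropic flag is stable under transposition. The obstacle
  in the induction is that taking the strictly upper triangular part refers to coordinates, while
  the nilradical refers to the flag. The two are linked by the coordinates at the indices k found so
  far: they determine every vector of the subspace already known.\<close>

lemma has_vector_derivative_nth: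
  "((\<lambda>t. f t $ i) has_vector_derivative X $ i) F" if "(f has_vector_derivative X) F"
  using bounded_linear.has_vector_derivative[OF bounded_linear_vec_nth that] .

lemma has_vector_derivative_vecI:
  fixes f :: "real \<Rightarrow> ('a::real_normed_vector) ^ 'n::finite"
  assumes "\<And>i. ((\<lambda>t. f t $ i) has_vector_derivative X $ i) F"
  shows "(f has_vector_derivative X) F"
  unfolding has_vector_derivative_def has_derivative_def
proof (intro conjI vec_tendstoI)
  show "bounded_linear (\<lambda>x. x *\<^sub>R X)" by (rule bounded_linear_scaleR_left)
  fix i
  show "((\<lambda>y. ((f y - f (Lim F (\<lambda>x. x)) - (y - Lim F (\<lambda>x. x)) *\<^sub>R X) /\<^sub>R norm (y - Lim F (\<lambda>x. x))) $ i) \<longlongrightarrow> 0 $ i) F"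
    using assms[of i] unfolding has_vector_derivative_def has_derivative_def by simp
qed

text \<open>In the Leibniz expansion a permutation other than the identity moves at least two
  points. After one factor is differentiated, an off-diagonal entry of the identity matrix remains
  and kills the term.\<close>

lemma has_vector_derivative_det:
  fixes \<gamma> :: "real \<Rightarrow> complex ^ 'n ^ 'n::finite"
  assumes d: "(\<gamma> has_vector_derivative X) (at 0)" and 0: "\<gamma> 0 = mat 1"
  shows "((\<lambda>t. det (\<gamma> t)) has_vector_derivative trace X) (at 0)"
proof -
  let ?U = "UNIV :: 'n set"
  have e: "((\<lambda>t. \<gamma> t $ i $ j) has_derivative (\<lambda>t. t *\<^sub>R (X $ i $ j))) (at 0)" for i j
    using has_vector_derivative_nth[OF has_vector_derivative_nth[OF d]]
    unfolding has_vector_derivative_def .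
  have "((\<lambda>t. det (\<gamma> t)) has_derivative
     (\<lambda>t. \<Sum>p\<in>{p. p permutes ?U}. of_int (sign p) *
        (\<Sum>i\<in>?U. t *\<^sub>R (X $ i $ p i) * (\<Prod>j\<in>?U - {i}. \<gamma> 0 $ j $ p j)))) (at 0)"
    unfolding det_def
    by (intro has_derivative_sum has_derivative_mult_right has_derivative_prod e)
  also have "(\<lambda>t::real. \<Sum>p\<in>{p. p permutes ?U}. of_int (sign p) *
        (\<Sum>i\<in>?U. t *\<^sub>R (X $ i $ p i) * (\<Prod>j\<in>?U - {i}. \<gamma> 0 $ j $ p j))) = (\<lambda>t. t *\<^sub>R trace X)"
  proof
    fix t :: real
    have z: "(\<Prod>j\<in>?U - {i}. \<gamma> 0 $ j $ p j) = (if p = id then 1 else 0)" if p: "p permutes ?U" for i p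
    proof (cases "p = id")
      case True then show ?thesis by (simp add: 0 mat_def)
    next
      case False
      have "\<exists>j. j \<noteq> i \<and> p j \<noteq> j"
      proof (rule ccontr)
        assume "\<not> ?thesis"
        then have *: "p j = j" if "j \<noteq> i" for j using that by blast
        have "p i = i"
          using * permutes_inj[OF p] by (metis injD)
        with * have "p = id" by (metis eq_id_iff)
        with False show False by blast
      qed
      then have "\<exists>j\<in>?U - {i}. \<gamma> 0 $ j $ p j = 0" 
        by (metis (mono_tags, lifting) "0" DiffI UNIV_I mat_def singletonD vec_lambda_beta)
      then show ?thesis using False by (simp add: prod_zero)
    qed
    have "(\<Sum>p\<in>{p. p permutes ?U}. of_int (sign p) *
        (\<Sum>i\<in>?U. t *\<^sub>R (X $ i $ p i) * (\<Prod>j\<in>?U - {i}. \<gamma> 0 $ j $ p j)))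
      = (\<Sum>p\<in>{p. p permutes ?U}. if p = id then \<Sum>i\<in>?U. t *\<^sub>R (X $ i $ i) else 0)"
      by (rule sum.cong) (auto simp: z sign_id)
    also have "\<dots> = t *\<^sub>R trace X"
      by (simp add: finite_permutations permutes_id trace_def scaleR_sum_right)
    finally show "(\<Sum>p\<in>{p. p permutes ?U}. of_int (sign p) *
        (\<Sum>i\<in>?U. t *\<^sub>R (X $ i $ p i) * (\<Prod>j\<in>?U - {i}. \<gamma> 0 $ j $ p j))) = t *\<^sub>R trace X" .
  qed
  finally show ?thesis unfolding has_vector_derivative_def .
qed

text \<open>Pairing the curve with any vector orthogonal to \<open>S\<close> gives the zero
  function, so its velocity is orthogonal to the complement of \<open>S\<close>.\<close>

lemma has_vector_derivative_in_subspace: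
  fixes \<gamma> :: "real \<Rightarrow> 'a::euclidean_space"
  assumes S: "subspace S" and in_S: "\<And>t. \<gamma> t \<in> S" and d: "(\<gamma> has_vector_derivative X) (at 0)"
  shows "X \<in> S"
proof -
  have "inner w X = 0" if w: "w \<in> S\<^sup>\<bottom>" for w
  proof -
    have "((\<lambda>t. inner w (\<gamma> t)) has_vector_derivative inner w X) (at 0)"
      by (rule bounded_linear.has_vector_derivative[OF bounded_linear_inner_right d])
    moreover have "(\<lambda>t. inner w (\<gamma> t)) = (\<lambda>t. 0)"
      using in_S w by (auto simp: orthogonal_comp_def orthogonal_def inner_commute[of w])
    ultimately show ?thesis
      using vector_derivative_unique_at by (metis has_vector_derivative_const)
  qed
  then have "X \<in> S\<^sup>\<bottom>\<^sup>\<bottom>" by (simp add: orthogonal_comp_def orthogonal_def)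
  then show ?thesis by (simp add: orthogonal_comp_self[OF S])
qed

definition sl :: "(complex ^ 'n ^ 'n::finite) set" where "sl = {X. trace X = 0}"

text \<open>For trace-free \<open>X\<close> the line through the identity with direction
  \<open>X\<close> has determinant 1 to first order. Dividing it by an n-th root of its determinant
  moves it into \<open>SL\<close> and keeps the velocity at 0.\<close>

lemma lie_SL_Int:
  fixes \<aa> :: "(complex ^ 'n ^ 'n::finite) set"
  assumes sub: "subspace \<aa>" and I: "mat 1 \<in> \<aa>" and cl: "\<And>c A. A \<in> \<aa> \<Longrightarrow> mat c ** A \<in> \<aa>"
  shows "lie (SL \<inter> \<aa>) = \<aa> \<inter> sl"
proof (intro set_eqI iffI)
  fix X assume "X \<in> lie (SL \<inter> \<aa>)"
  then obtain \<gamma> where g: "\<And>t. \<gamma> t \<in> SL" "\<And>t. \<gamma> t \<in> \<aa>" "\<gamma> 0 = mat 1"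
    "(\<gamma> has_vector_derivative X) (at 0)" unfolding lie_def by blast
  have "(\<lambda>t. det (\<gamma> t)) = (\<lambda>t. 1)" using g(1) by (auto simp: SL_def)
  then have "((\<lambda>t::real. 1) has_vector_derivative trace X) (at 0)"
    using has_vector_derivative_det[OF g(4,3)] by simp
  then have "trace X = 0"
    using vector_derivative_unique_at by (metis has_vector_derivative_const)
  then show "X \<in> \<aa> \<inter> sl" using has_vector_derivative_in_subspace[OF sub g(2,4)] by (simp add: sl_def)
next
  fix X assume X: "X \<in> \<aa> \<inter> sl"
  define \<beta> where "\<beta> t = mat 1 + t *\<^sub>R X" for t :: real
  \<comment> \<open>An n-th root of the inverse determinant. The logarithm must be smooth only near
    1; at other nonzero values only \<open>exp (Ln z) = z\<close> matters.\<close>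
  define c where "c t = exp (- (Ln (det (\<beta> t)) / of_nat CARD('n)))" for t
  \<comment> \<open>\<open>lie\<close> asks for curves defined for all real \<open>t\<close>.
    Singular values of \<open>\<beta> t\<close> occur only away from 0, and the identity replaces
    them.\<close>
  define \<gamma> where "\<gamma> t = (if det (\<beta> t) = 0 then mat 1 else mat (c t) ** \<beta> t)" for t
  have b\<aa>: "\<beta> t \<in> \<aa>" for t
    using X unfolding \<beta>_def by (auto intro!: subspace_add[OF sub] subspace_scale[OF sub] I)
  have b0: "\<beta> 0 = mat 1" by (simp add: \<beta>_def)
  have db: "(\<beta> has_vector_derivative X) (at 0)"
    unfolding \<beta>_def by (auto intro!: derivative_eq_intros)
  have ddet: "((\<lambda>t. det (\<beta> t)) has_vector_derivative 0) (at 0)"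
    using has_vector_derivative_det[OF db b0] X by (simp add: sl_def)
  have c0: "c 0 = 1" by (simp add: c_def b0)
  have "((\<lambda>z. exp (- (Ln z / of_nat CARD('n)))) has_field_derivative
      (- 1 / of_nat CARD('n))) (at (det (\<beta> 0)))"
    unfolding b0 by (auto intro!: derivative_eq_intros simp: exp_minus)
  from field_vector_diff_chain_at[OF ddet this]
  have dc: "(c has_vector_derivative 0) (at 0)" by (simp add: c_def[abs_def] o_def)
  have nth: "(mat (c t) ** \<beta> t) $ i $ j = c t * \<beta> t $ i $ j" for t i j
    by (simp add: matrix_matrix_mult_def mat_def if_distrib[of "\<lambda>x. x * _"] cong: if_cong)
  have "((\<lambda>t. mat (c t) ** \<beta> t) has_vector_derivative X) (at 0)"
  proof (intro has_vector_derivative_vecI)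
    fix i j
    show "((\<lambda>t. (mat (c t) ** \<beta> t) $ i $ j) has_vector_derivative X $ i $ j) (at 0)"
      unfolding nth
      using has_vector_derivative_mult[OF dc has_vector_derivative_nth[OF has_vector_derivative_nth[OF db, of i], of j]]
      by (simp add: c0)
  qed
  moreover have "eventually (\<lambda>t. \<gamma> t = mat (c t) ** \<beta> t) (at 0)"
  proof -
    have "isCont (\<lambda>t. det (\<beta> t)) 0" using ddet has_vector_derivative_continuous by blast
    then have "((\<lambda>t. det (\<beta> t)) \<longlongrightarrow> 1) (at 0)" by (simp add: isCont_def b0)
    then have "eventually (\<lambda>t. det (\<beta> t) \<noteq> 0) (at 0)"
      by (rule tendsto_imp_eventually_ne) simp
    then show ?thesis by eventually_elim (simp add: \<gamma>_def)
  qed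
  moreover have g0: "\<gamma> 0 = mat 1" by (simp add: \<gamma>_def b0 c0)
  ultimately have "(\<gamma> has_vector_derivative X) (at 0)"
    unfolding has_vector_derivative_def
    by (elim has_derivative_transform_eventually) (auto simp: b0 c0 elim: eventually_mono)
  moreover have "\<gamma> t \<in> SL \<inter> \<aa>" for t
  proof (cases "det (\<beta> t) = 0")
    case True then show ?thesis using I by (simp add: \<gamma>_def SL_def)
  next
    case False
    have "det (mat (c t) :: complex ^ 'n ^ 'n) = c t ^ CARD('n)"
      by (subst det_diagonal) (auto simp: mat_def)
    also have "\<dots> = exp (- Ln (det (\<beta> t)))"
      unfolding c_def by (simp flip: exp_of_nat_mult)
    also have "\<dots> = 1 / det (\<beta> t)" using False by (simp add: exp_minus field_simps)
    finally show ?thesis using False by (simp add: \<gamma>_def SL_def det_mul cl b\<aa>)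
  qed
  ultimately show "X \<in> lie (SL \<inter> \<aa>)" unfolding lie_def using g0 by blast
qed

text \<open>The scalar matrices, of real dimension 2, are a complement of the trace-free ones inside
  the algebra.\<close>

lemma dim_Int_sl:
  fixes \<aa> :: "(complex ^ 'n ^ 'n::finite) set"
  assumes sub: "subspace \<aa>" and I: "mat 1 \<in> \<aa>" and cl: "\<And>c A. A \<in> \<aa> \<Longrightarrow> mat c ** A \<in> \<aa>"
  shows "dim (\<aa> \<inter> sl) + 2 = dim \<aa>"
proof -
  let ?C = "range mat :: (complex ^ 'n ^ 'n) set"
  have lin: "linear (mat :: complex \<Rightarrow> complex ^ 'n ^ 'n)"
    by (intro linearI) (auto simp: vec_eq_iff mat_def)
  have inj: "inj (mat :: complex \<Rightarrow> complex ^ 'n ^ 'n)"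
    by (intro injI) (auto simp: vec_eq_iff mat_def split: if_splits)
  have C: "subspace ?C" "dim ?C = 2"
    using linear_subspace_image[OF lin subspace_UNIV] dim_image_eq[OF lin, of UNIV] inj by auto
  have tr: "trace (mat c :: complex ^ 'n ^ 'n) = of_nat CARD('n) * c" for c
    by (simp add: trace_def mat_def)
  have sl: "subspace (sl :: (complex ^ 'n ^ 'n) set)"
    by (auto simp: subspace_def sl_def trace_def sum.distrib simp flip: scaleR_sum_right)
  have s2: "subspace (\<aa> \<inter> sl)" using sub sl by (rule subspace_inter)
  have "{x + y |x y. x \<in> \<aa> \<inter> sl \<and> y \<in> ?C} = \<aa>"
  proof (intro set_eqI iffI)
    fix A assume "A \<in> {x + y |x y. x \<in> \<aa> \<inter> sl \<and> y \<in> ?C}"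
    then obtain x c where "A = x + mat c" "x \<in> \<aa>" by blast
    moreover have "mat c \<in> \<aa>" using cl[OF I, of c] by simp
    ultimately show "A \<in> \<aa>" using subspace_add[OF sub] by blast
  next
    fix A assume A: "A \<in> \<aa>"
    let ?c = "trace A / of_nat CARD('n)"
    have "mat ?c \<in> \<aa>" using cl[OF I, of ?c] by simp
    then have "A - mat ?c \<in> \<aa> \<inter> sl"
      using subspace_diff[OF sub A] by (simp add: sl_def trace_sub tr)
    then show "A \<in> {x + y |x y. x \<in> \<aa> \<inter> sl \<and> y \<in> ?C}"
      using diff_add_cancel[of A "mat ?c", symmetric] by blast
  qed
  moreover have "(\<aa> \<inter> sl) \<inter> ?C = {0}"
    using subspace_0[OF s2] subspace_0[OF C(1)]
    by (auto simp: sl_def tr)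
  ultimately show ?thesis using dim_sums_Int[OF s2 C(1)] C(2) by simp
qed

section \<open>Real skew-symmetric matrices and the Cayley transform\<close>

definition so_real :: "(complex ^ 'n ^ 'n::finite) set" where
  "so_real = {X. transpose X = - X \<and> (\<forall>i j. X $ i $ j \<in> \<real>)}"

lemma real_matrix_mult: "(A ** B) $ i $ j \<in> \<real>" if "\<And>i j. A $ i $ j \<in> \<real>" "\<And>i j. B $ i $ j \<in> \<real>"
  for A B :: "complex ^ 'n ^ 'n::finite"
  using that by (simp add: matrix_matrix_mult_def)

lemma matrix_add_rdistrib: "(A + B) ** C = A ** C + B ** C" for A :: "'a::semiring_1^'n^'m"
  by (simp add: vec_eq_iff matrix_matrix_mult_def distrib_right sum.distrib)

lemma matrix_diff_rdistrib: "(A - B) ** C = A ** C - B ** C" for A :: "'a::ring_1^'n^'m"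
  by (simp add: vec_eq_iff matrix_matrix_mult_def left_diff_distrib sum_subtractf)

lemma matrix_diff_ldistrib: "A ** (B - C) = A ** B - A ** C" for A :: "'a::ring_1^'n^'m"
  by (simp add: vec_eq_iff matrix_matrix_mult_def right_diff_distrib sum_subtractf)

lemma transpose_add: "transpose (A + B) = transpose A + transpose B"
  by (simp add: vec_eq_iff transpose_def)

lemma transpose_diff: "transpose (A - B) = transpose A - transpose B"
  by (simp add: vec_eq_iff transpose_def)

lemma matrix_mult_scaleR: "B ** (t *\<^sub>R A) = t *\<^sub>R (B ** A)" for A B :: "complex ^ 'n ^ 'n"
  by (simp add: vec_eq_iff matrix_matrix_mult_def scaleR_sum_right)

lemma scaleR_matrix_vector_mult: "(t *\<^sub>R A) *v v = t *\<^sub>R (A *v v)" for A :: "complex ^ 'n ^ 'm"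
  by (simp add: vec_eq_iff matrix_vector_mult_def scaleR_sum_right)

text \<open>As the entries of \<open>X\<close> are real, the terms for (i, j) and (j, i) cancel in
  the real inner product. Hence \<open>mat 1\<close> minus a real multiple of \<open>X\<close> is
  injective.\<close>

lemma inner_skew_real:
  fixes X :: "complex ^ 'n ^ 'n::finite"
  assumes "X \<in> so_real"
  shows "inner v (X *v v) = 0"
proof -
  obtain r where r: "X $ i $ j = complex_of_real (r i j)" for i j
    using assms unfolding so_real_def Reals_def by (auto simp: image_iff) metis
  have sk: "r j i = - r i j" for i j
  proof -
    have "transpose X $ i $ j = - X $ i $ j" using assms by (simp add: so_real_def)
    then have "complex_of_real (r j i) = complex_of_real (- r i j)" by (simp add: transpose_def r)
    then show ?thesis using of_real_eq_iff by blast
  qed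
  have "inner v (X *v v) = (\<Sum>i\<in>UNIV. \<Sum>j\<in>UNIV. r i j * inner (v $ i) (v $ j))"
    unfolding inner_vec_def matrix_vector_mult_def
    by (simp add: r inner_sum_right flip: scaleR_conv_of_real)
  also have "(\<Sum>i\<in>UNIV. \<Sum>j\<in>UNIV. r i j * inner (v $ i) (v $ j)) = 0" (is "?S = 0")
  proof -
    have "?S = (\<Sum>i\<in>UNIV. \<Sum>j\<in>UNIV. r j i * inner (v $ j) (v $ i))"
      by (rule sum.swap)
    also have "\<dots> = (\<Sum>i\<in>UNIV. \<Sum>j\<in>UNIV. - (r i j * inner (v $ i) (v $ j)))"
      by (intro sum.cong refl) (metis sk inner_commute mult_minus_left)
    also have "\<dots> = - ?S" by (simp only: sum_negf)
    finally show ?thesis by linarith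
  qed
  finally show ?thesis .
qed

text \<open>The curve is the Cayley transform, the quotient of 1 + tX/2 by 1 - tX/2, which stays in
  the rotation group for all real t.\<close>

lemma so_real_subset_lie: "(so_real :: (complex ^ 'n ^ 'n::finite) set) \<subseteq> lie SO_real"
proof
  fix X :: "complex ^ 'n ^ 'n" assume X: "X \<in> so_real"
  define P where "P t = mat 1 + (t / 2) *\<^sub>R X" for t :: real
  define M where "M t = mat 1 - (t / 2) *\<^sub>R X" for t :: real
  have inv: "invertible (M t)" for t
  proof -
    have "v = 0" if "M t *v v = 0" for v
    proof -
      have "v = (t / 2) *\<^sub>R (X *v v)"
        using that by (simp add: M_def matrix_vector_mult_diff_rdistrib scaleR_matrix_vector_mult)
      then have "inner v v = (t / 2) * inner v (X *v v)" by (metis inner_scaleR_right)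
      then show ?thesis using inner_skew_real[OF X] by simp
    qed
    then show ?thesis
      by (simp add: invertible_left_inverse matrix_left_invertible_ker)
  qed
  have tr: "transpose (P t) = M t" "transpose (M t) = P t" for t
    using X by (auto simp: P_def M_def transpose_add transpose_diff transpose_scalar so_real_def transpose_mat)
  have comm: "P t ** M t = M t ** P t" for t
    by (simp add: P_def M_def matrix_add_rdistrib matrix_diff_rdistrib matrix_diff_ldistrib matrix_add_ldistrib)
  obtain N where r: "\<And>t. N t ** M t = mat 1" "\<And>t. M t ** N t = mat 1"
    using inv unfolding invertible_def by metis
  define \<gamma> where "\<gamma> t = P t ** N t" for t
  have gM: "\<gamma> t ** M t = P t" for t by (simp add: \<gamma>_def r flip: matrix_mul_assoc)
  have detPM: "det (P t) = det (M t)" for t by (metis tr det_transpose)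
  have nz: "det (M t) \<noteq> 0" for t using inv invertible_det_nz by blast
  have det: "det (\<gamma> t) = 1" for t
  proof -
    have "det (\<gamma> t) * det (M t) = det (M t)" using gM[of t] detPM by (metis det_mul)
    then show ?thesis using nz[of t] by simp
  qed
  have orth: "transpose (\<gamma> t) ** \<gamma> t = mat 1" for t
  proof -
    \<comment> \<open>Multiplying by \<open>P t\<close> on the left and \<open>M t\<close> on the
      right clears the inverse \<open>N t\<close>; since \<open>P t\<close> and \<open>M t\<close>
      commute, the orthogonality relation becomes an identity.\<close>
    have "P t ** (transpose (\<gamma> t) ** \<gamma> t) ** M t = transpose (\<gamma> t ** M t) ** (\<gamma> t ** M t)"
      by (simp add: matrix_transpose_mul tr matrix_mul_assoc)
    also have "\<dots> = P t ** M t" by (simp add: gM tr comm)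
    finally have "P t ** (transpose (\<gamma> t) ** \<gamma> t) ** M t = P t ** M t" .
    then have eq: "P t ** (transpose (\<gamma> t) ** \<gamma> t) ** M t = P t ** M t" .
    have NP: "transpose (N t) ** P t = mat 1"
      using arg_cong[OF r(2)[of t], of transpose] by (simp add: matrix_transpose_mul tr transpose_mat)
    have "transpose (\<gamma> t) ** \<gamma> t = (transpose (N t) ** P t) ** (transpose (\<gamma> t) ** \<gamma> t) ** (M t ** N t)"
      by (simp add: NP r)
    also have "\<dots> = transpose (N t) ** (P t ** (transpose (\<gamma> t) ** \<gamma> t) ** M t) ** N t"
      by (simp add: matrix_mul_assoc)
    also have "\<dots> = (transpose (N t) ** P t) ** (M t ** N t)"
      unfolding eq by (simp add: matrix_mul_assoc)
    finally show ?thesis by (simp add: NP r)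
  qed
  have real: "\<gamma> t $ i $ j \<in> \<real>" for t i j
  proof -
    \<comment> \<open>The complex conjugate solves the same equation
      \<open>\<gamma> t ** M t = P t\<close>, whose solution is unique.\<close>
    define C where "C = (\<chi> i j. cnj (\<gamma> t $ i $ j))"
    have rP: "cnj (P t $ i $ j) = P t $ i $ j" "cnj (M t $ i $ j) = M t $ i $ j" for i j
      using X by (auto simp: P_def M_def so_real_def mat_def Reals_cnj_iff)
    have "C ** M t = P t"
    proof (intro vec_eq_iff[THEN iffD2] allI)
      fix i j
      have "(C ** M t) $ i $ j = cnj ((\<gamma> t ** M t) $ i $ j)"
        by (simp add: matrix_matrix_mult_def C_def rP)
      then show "(C ** M t) $ i $ j = P t $ i $ j" by (simp add: gM rP)
    qed
    then have "C ** (M t ** N t) = \<gamma> t ** (M t ** N t)" using gM by (simp add: matrix_mul_assoc)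
    then have "C = \<gamma> t" by (simp add: r)
    then have "C $ i $ j = \<gamma> t $ i $ j" by simp
    then have "cnj (\<gamma> t $ i $ j) = \<gamma> t $ i $ j" by (simp add: C_def)
    then show ?thesis by (simp add: Reals_cnj_iff)
  qed
  have SO: "\<gamma> t \<in> SO_real" for t using det real orth by (simp add: SO_real_def SL_real_def SL_def)
  have g0: "\<gamma> 0 = mat 1" using gM[of 0] by (simp add: P_def M_def)
  have bd: "norm (\<gamma> t $ i $ j) \<le> 1" for t i j
  proof -
    have "(\<Sum>k\<in>UNIV. (\<gamma> t $ k $ j)\<^sup>2) = 1"
      using arg_cong[OF orth[of t], of "\<lambda>A. A $ j $ j"]
      by (simp add: matrix_matrix_mult_def transpose_def mat_def power2_eq_square)
    moreover have "(\<gamma> t $ k $ j)\<^sup>2 = of_real ((norm (\<gamma> t $ k $ j))\<^sup>2)" for k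
      using real[of t k j] by (auto simp: Reals_def simp flip: of_real_power)
    ultimately have "(\<Sum>k\<in>UNIV. (norm (\<gamma> t $ k $ j))\<^sup>2) = 1"
      by (metis (no_types, lifting) of_real_eq_1_iff of_real_sum sum.cong)
    then have "(norm (\<gamma> t $ i $ j))\<^sup>2 \<le> 1"
      using member_le_sum[of i UNIV "\<lambda>k. (norm (\<gamma> t $ k $ j))\<^sup>2"] by simp
    then show ?thesis by (simp add: abs_square_le_1)
  qed
  \<comment> \<open>A rearrangement of \<open>\<gamma> t ** M t = P t\<close> in which no inverse is
    left to differentiate. With the entry bound it yields continuity at 0, and then the limit (1 +
    1) X / 2 of the difference quotient.\<close>
  have step: "\<gamma> t - mat 1 = (t / 2) *\<^sub>R ((mat 1 + \<gamma> t) ** X)" for t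
  proof -
    have "\<gamma> t - (t / 2) *\<^sub>R (\<gamma> t ** X) = mat 1 + (t / 2) *\<^sub>R X"
      using gM[of t] by (simp add: P_def M_def matrix_diff_ldistrib matrix_mult_scaleR)
    then show ?thesis by (simp add: matrix_add_rdistrib algebra_simps)
  qed
  have "((\<lambda>t. \<gamma> t $ i $ j) has_vector_derivative X $ i $ j) (at 0)" for i j
  proof -
    have bound: "norm (\<gamma> t $ i $ j - mat 1 $ i $ j) \<le> (\<bar>t\<bar> / 2) * (\<Sum>k\<in>UNIV. 2 * norm (X $ k $ j))" for t i j
    proof -
      have "norm (mat 1 $ i $ k + \<gamma> t $ i $ k) \<le> 2" for k
        using norm_triangle_ineq[of "mat 1 $ i $ k" "\<gamma> t $ i $ k"] bd[of t i k]
        by (simp add: mat_def split: if_splits)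
      then have "norm (((mat 1 + \<gamma> t) ** X) $ i $ j) \<le> (\<Sum>k\<in>UNIV. 2 * norm (X $ k $ j))"
        unfolding matrix_matrix_mult_def
        by (auto intro!: sum_norm_le mult_right_mono simp: norm_mult)
      moreover have "\<gamma> t $ i $ j - mat 1 $ i $ j = (t / 2) *\<^sub>R ((mat 1 + \<gamma> t) ** X) $ i $ j"
        using arg_cong[OF step[of t], of "\<lambda>A. A $ i $ j"] by simp
      ultimately show ?thesis by (simp add: mult_left_mono)
    qed
    have gl: "((\<lambda>t. \<gamma> t $ a $ b) \<longlongrightarrow> mat 1 $ a $ b) (at 0)" for a b
    proof -
      have "((\<lambda>t::real. (\<bar>t\<bar> / 2) * (\<Sum>k\<in>UNIV. 2 * norm (X $ k $ b))) \<longlongrightarrow> 0) (at 0)"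
        by (auto intro!: tendsto_eq_intros)
      then have "((\<lambda>t. \<gamma> t $ a $ b - mat 1 $ a $ b) \<longlongrightarrow> 0) (at 0)"
        by (rule Lim_null_comparison[rotated]) (intro always_eventually allI bound)
      then show ?thesis by (simp add: LIM_zero_iff)
    qed
    define h where "h t = (1 / 2) *\<^sub>R ((mat 1 + \<gamma> t) ** X) $ i $ j" for t
    have "((\<lambda>t. (\<Sum>k\<in>UNIV. (mat 1 $ i $ k + \<gamma> t $ i $ k) * X $ k $ j)) \<longlongrightarrow>
       (\<Sum>k\<in>UNIV. (mat 1 $ i $ k + mat 1 $ i $ k) * X $ k $ j)) (at 0)"
      by (intro tendsto_intros gl)
    then have "((\<lambda>t. ((mat 1 + \<gamma> t) ** X) $ i $ j) \<longlongrightarrow> 2 * X $ i $ j) (at 0)"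
      by (simp add: matrix_matrix_mult_def mat_def if_distrib[of "\<lambda>x. x * _"] if_distrib[of "\<lambda>x. x + x"] cong: if_cong)
    then have "(h \<longlongrightarrow> (1 / 2) *\<^sub>R (2 * X $ i $ j)) (at 0)"
      unfolding h_def by (intro tendsto_intros)
    then have "((\<lambda>t. norm (h t - X $ i $ j)) \<longlongrightarrow> 0) (at 0)"
      by (simp add: scaleR_conv_of_real tendsto_norm_zero_iff LIM_zero_iff)
    moreover have "\<gamma> t $ i $ j - \<gamma> 0 $ i $ j = t *\<^sub>R h t" for t
      using arg_cong[OF step[of t], of "\<lambda>A. A $ i $ j"] by (simp add: g0 h_def)
    then have "norm (\<gamma> (0 + t) $ i $ j - \<gamma> 0 $ i $ j - t *\<^sub>R X $ i $ j) / norm t = norm (h t - X $ i $ j)"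
      if "t \<noteq> 0" for t
      using that by (simp flip: scaleR_diff_right)
    then have "eventually (\<lambda>t. norm (h t - X $ i $ j) = norm (\<gamma> (0 + t) $ i $ j - \<gamma> 0 $ i $ j - t *\<^sub>R X $ i $ j) / norm t) (at 0)"
      by (auto simp: eventually_at_filter)
    ultimately have "((\<lambda>t. norm (\<gamma> (0 + t) $ i $ j - \<gamma> 0 $ i $ j - t *\<^sub>R X $ i $ j) / norm t) \<longlongrightarrow> 0) (at 0)"
      by (rule Lim_transform_eventually)
    then show ?thesis
      unfolding has_vector_derivative_def has_derivative_at by (simp add: bounded_linear_scaleR_left)
  qed
  then have "(\<gamma> has_vector_derivative X) (at 0)" by (intro has_vector_derivative_vecI)
  then show "X \<in> lie SO_real" unfolding lie_def using SO g0 by blast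
qed

section \<open>Stabilizers of families of subspaces and orbit dimensions\<close>

text \<open>An algebra rather than a group, so that \<open>lie_SL_Int\<close> computes the Lie
  algebras of \<open>SL\<close>, of \<open>Borel\<close> and of all their stabilizers at
  once.\<close>

definition pres :: "(complex ^ 'n) set set \<Rightarrow> (complex ^ 'n ^ 'n::finite) set" where
  "pres \<F> = {A. \<forall>V\<in>\<F>. \<forall>v\<in>V. A *v v \<in> V}"

lemma pres_Un: "pres (\<F> \<union> \<G>) = pres \<F> \<inter> pres \<G>"
  by (auto simp: pres_def)

lemma mat_mult_vec: "mat c *v v = c *s v" for v :: "complex ^ 'n::finite"
  by (simp add: vec_eq_iff matrix_vector_mult_def mat_def if_distrib[of "\<lambda>x. x * _"] cong: if_cong)

lemma mat_in_pres: "(\<And>V. V \<in> \<F> \<Longrightarrow> vec.subspace V) \<Longrightarrow> mat c \<in> pres \<F>"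
  by (auto simp: pres_def mat_mult_vec vec.subspace_scale)

lemma pres_mult: "A \<in> pres \<F> \<Longrightarrow> B \<in> pres \<F> \<Longrightarrow> A ** B \<in> pres \<F>"
  by (simp add: pres_def flip: matrix_vector_mul_assoc)

lemma subspace_pres:
  assumes "\<And>V. V \<in> \<F> \<Longrightarrow> vec.subspace V"
  shows "subspace (pres \<F>)"
proof (rule subspaceI)
  fix c and A :: "complex ^ 'a ^ 'a" assume "A \<in> pres \<F>"
  moreover have "c *\<^sub>R A = mat (of_real c) ** A"
    by (simp add: vec_eq_iff matrix_matrix_mult_def mat_def scaleR_conv_of_real[where 'a=complex] if_distrib[of "\<lambda>x. x * _"] cong: if_cong)
  ultimately show "c *\<^sub>R A \<in> pres \<F>" using assms mat_in_pres pres_mult by metis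
qed (use assms in \<open>auto simp: pres_def matrix_vector_mult_add_rdistrib vec.subspace_add vec.subspace_0\<close>)

lemma dim_lie_SL_Int_pres:
  assumes "\<And>V. V \<in> \<F> \<Longrightarrow> vec.subspace V"
  shows "dim (lie (SL \<inter> pres \<F>)) + 2 = dim (pres \<F>)"
proof -
  have *: "subspace (pres \<F>)" "mat 1 \<in> pres \<F>" "\<And>c A. A \<in> pres \<F> \<Longrightarrow> mat c ** A \<in> pres \<F>"
    using assms by (auto intro: subspace_pres mat_in_pres pres_mult)
  show ?thesis using lie_SL_Int[OF *] dim_Int_sl[OF *] by simp
qed

lemma SL_invertible: "A \<in> SL \<Longrightarrow> invertible A"
  by (simp add: SL_def invertible_det_nz)

lemma inj_invertible: "invertible A \<Longrightarrow> inj ((*v) A)" for A :: "complex ^ 'n ^ 'n::finite"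
  using matrix_left_invertible_injective[of A] by (simp add: invertible_left_inverse)

lemma vec_dim_image: "invertible A \<Longrightarrow> vec.dim ((*v) A ` S) = vec.dim S"
  for A :: "complex ^ 'n ^ 'n::finite"
  by (rule vec.dim_image_eq[OF matrix_vector_mul_linear_gen]) (rule inj_on_subset[OF inj_invertible subset_UNIV])

lemma vec_subspace_image: "vec.subspace S \<Longrightarrow> vec.subspace ((*v) A ` S)"
  for A :: "complex ^ 'n ^ 'n::finite"
  using vec.linear_subspace_image[OF matrix_vector_mul_linear_gen] .

lemma invertible_image_eq:
  fixes A :: "complex ^ 'n ^ 'n::finite"
  assumes "invertible A" "vec.subspace V" "(*v) A ` V \<subseteq> V"
  shows "(*v) A ` V = V"
  using vec.subspace_dim_equal[OF vec_subspace_image[OF assms(2)] assms(2,3)] vec_dim_image[OF assms(1), of V] by simp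

lemma flag_subspace: "F \<in> flags \<Longrightarrow> vec.subspace (F k)" by (simp add: flags_def)

lemma flag_dim: "F \<in> flags \<Longrightarrow> vec.dim (F k) = min k CARD('n)" for F :: "'n::finite flag" by (simp add: flags_def)

lemma flag_mono: "F \<in> flags \<Longrightarrow> i \<le> j \<Longrightarrow> F i \<subseteq> F j" by (simp add: flags_def monoD)

lemma flag_top:
  fixes F :: "'n::finite flag"
  assumes "F \<in> flags" "CARD('n) \<le> k"
  shows "F k = UNIV"
  using vec.subspace_dim_equal[OF flag_subspace[OF assms(1)] vec.subspace_UNIV subset_UNIV, of k] assms
  by (simp add: flag_dim vec_dim_card del: vec.dim_UNIV)

lemma flag_0: "F \<in> flags \<Longrightarrow> F 0 = {0}" for F :: "'n::finite flag"
  using flag_dim[of F 0] vec.dim_eq_0[of "F 0"] vec.subspace_0[OF flag_subspace, of F 0] by auto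

text \<open>An invertible matrix that maps a subspace into itself maps it onto itself, so fixing a
  flag is the linear condition expressed by \<open>pres\<close>.\<close>

lemma stabilizer_SL_Int:
  assumes "F \<in> flags"
  shows "stabilizer (SL \<inter> H) F = SL \<inter> (H \<inter> pres (range F))"
proof -
  have "act A F = F \<longleftrightarrow> A \<in> pres (range F)" if "A \<in> SL" for A
  proof
    assume "act A F = F"
    then show "A \<in> pres (range F)" unfolding act_def pres_def by (auto dest: fun_cong)
  next
    assume "A \<in> pres (range F)"
    then have "(*v) A ` F k \<subseteq> F k" for k by (auto simp: pres_def)
    then show "act A F = F" unfolding act_def
      using invertible_image_eq[OF SL_invertible[OF that] flag_subspace[OF assms]] by auto
  qed
  then show ?thesis by (auto simp: stabilizer_def)
qed

text \<open>The nonzero proper steps of the standard flag together with the whole space, indexed by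
  the last basis vector instead of the dimension, so that rank conditions compare indices
  directly.\<close>

definition std_sub :: "'n::{finite,linorder} \<Rightarrow> (complex ^ ('n::{finite,linorder})) set" where
  "std_sub x = {v. \<forall>y>x. v $ y = 0}"

lemma subspace_std_sub: "vec.subspace (std_sub x)"
  by (auto simp: std_sub_def vec.subspace_def)

lemma upper_triangular_pres: "pres (range std_sub) = {A. \<forall>i j. j < i \<longrightarrow> A $ i $ j = 0}"
proof (intro set_eqI iffI)
  fix A :: "complex ^ ('a::{finite,linorder}) ^ ('a::{finite,linorder})" assume A: "A \<in> pres (range std_sub)"
  have "A $ i $ j = 0" if "j < i" for i j
  proof -
    have "axis j 1 \<in> std_sub j" by (auto simp: std_sub_def axis_def)
    then have "A *v axis j 1 \<in> std_sub j" using A by (auto simp: pres_def)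
    then show ?thesis using that by (simp add: std_sub_def matrix_vector_mult_def axis_def if_distrib[of "\<lambda>x. _ * x"] cong: if_cong)
  qed
  then show "A \<in> {A. \<forall>i j. j < i \<longrightarrow> A $ i $ j = 0}" by blast
next
  fix A :: "complex ^ ('a::{finite,linorder}) ^ ('a::{finite,linorder})" assume A: "A \<in> {A. \<forall>i j. j < i \<longrightarrow> A $ i $ j = 0}"
  have "(A *v v) $ y = 0" if v: "\<forall>y>x. v $ y = 0" "y > x" for x y v
  proof -
    have "A $ y $ j * v $ j = 0" for j
    proof (cases "j < y")
      case True then show ?thesis using A by simp
    next
      case False then show ?thesis using v by (simp add: order_less_le_trans not_less)
    qed
    then show ?thesis
      unfolding matrix_vector_mult_def vec_lambda_beta by (intro sum.neutral ballI)
  qed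
  then show "A \<in> pres (range std_sub)" unfolding pres_def std_sub_def by auto
qed

lemma Borel_eq: "Borel = SL \<inter> pres (range std_sub)"
  by (auto simp: Borel_def upper_triangular_pres)

lemma orbit_dim_SL:
  fixes F :: "'n::finite flag"
  assumes "F \<in> flags"
  shows "orbit_dim SL F = dim (UNIV :: (complex ^ 'n ^ 'n) set) - dim (pres (range F))"
proof -
  have "dim (lie (SL :: (complex ^ 'n ^ 'n) set)) + 2 = dim (UNIV :: (complex ^ 'n ^ 'n) set)"
    using dim_lie_SL_Int_pres[of "{}"] by (simp add: pres_def)
  moreover have "dim (lie (stabilizer SL F)) + 2 = dim (pres (range F))"
    unfolding stabilizer_SL_Int[OF assms, of UNIV, simplified]
    by (rule dim_lie_SL_Int_pres) (use flag_subspace[OF assms] in auto)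
  ultimately show ?thesis unfolding orbit_dim_def by linarith
qed

lemma orbit_dim_Borel:
  fixes F :: "'n::{finite,linorder} flag"
  assumes "F \<in> flags"
  shows "orbit_dim Borel F = dim (pres (range (std_sub :: 'n \<Rightarrow> _))) - dim (pres (range std_sub \<union> range F))"
proof -
  have "dim (lie (Borel :: (complex ^ ('n::{finite,linorder}) ^ ('n::{finite,linorder})) set)) + 2 = dim (pres (range (std_sub :: 'n \<Rightarrow> _)))"
    unfolding Borel_eq by (rule dim_lie_SL_Int_pres) (use subspace_std_sub in auto)
  moreover have "dim (lie (stabilizer Borel F)) + 2 = dim (pres (range std_sub \<union> range F))"
    unfolding Borel_eq stabilizer_SL_Int[OF assms] pres_Un[symmetric]
    by (rule dim_lie_SL_Int_pres) (use flag_subspace[OF assms] subspace_std_sub in auto)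
  ultimately show ?thesis unfolding orbit_dim_def by linarith
qed

lemma dim_pres_image:
  fixes g :: "complex ^ 'n ^ 'n::finite"
  assumes "invertible g"
  shows "dim (pres ((`) ((*v) g) ` \<F>)) = dim (pres \<F>)"
proof -
  obtain h where h: "g ** h = mat 1" "h ** g = mat 1" using assms invertible_def by blast
  let ?c = "\<lambda>A. g ** A ** h"
  have lin: "linear ?c"
    by (intro linearI)
      (simp_all add: vec_eq_iff matrix_matrix_mult_def algebra_simps sum.distrib sum_distrib_left scaleR_sum_right)
  have inv: "h ** ?c A ** g = A" for A
    by (simp add: matrix_mul_assoc h) (simp add: h flip: matrix_mul_assoc)
  have inv': "?c (h ** A ** g) = A" for A
    by (simp add: matrix_mul_assoc h) (simp add: h flip: matrix_mul_assoc)
  have gh: "g *v (h *v v) = v" "h *v (g *v v) = v" for v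
    by (simp_all add: matrix_vector_mul_assoc h)
  have "?c ` pres \<F> = pres ((`) ((*v) g) ` \<F>)"
  proof (intro set_eqI iffI)
    fix A assume "A \<in> ?c ` pres \<F>"
    then show "A \<in> pres ((`) ((*v) g) ` \<F>)"
      by (auto simp: pres_def gh simp flip: matrix_vector_mul_assoc)
  next
    fix A assume A: "A \<in> pres ((`) ((*v) g) ` \<F>)"
    have "h ** A ** g \<in> pres \<F>"
    proof -
      have "h *v (A *v (g *v v)) \<in> V" if "V \<in> \<F>" "v \<in> V" for V v
      proof -
        have "A *v (g *v v) \<in> (*v) g ` V" using A that by (auto simp: pres_def)
        then show ?thesis using gh by auto
      qed
      then show ?thesis by (simp add: pres_def flip: matrix_vector_mul_assoc)
    qed
    then show "A \<in> ?c ` pres \<F>" using inv' by (metis imageI)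
  qed
  moreover have inj: "inj_on ?c S" for S by (rule inj_on_inverseI[of _ "\<lambda>A. h ** A ** g"]) (rule inv)
  ultimately show ?thesis
    using dim_image_eq[OF lin, of "pres \<F>"] inj by simp
qed

lemma act_range: "range (act g F) = (`) ((*v) g) ` range F"
  by (auto simp: act_def)

lemma flag_adapted_basis:
  fixes F :: "'n::finite flag"
  assumes F: "F \<in> flags"
  obtains f where "\<forall>k\<le>CARD('n). F k = vec.span (f ` {..<k})"
    and "inj_on f {..<CARD('n)}" and "vec.independent (f ` {..<CARD('n)})"
proof -
  have "\<exists>x. x \<in> F (Suc k) \<and> x \<notin> F k" if "k < CARD('n)" for k
  proof (rule ccontr)
    assume "\<not> ?thesis"
    then have "vec.dim (F (Suc k)) \<le> vec.dim (F k)" by (intro vec.dim_subset) blast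
    then show False using that by (simp add: flag_dim[OF F])
  qed
  then obtain f where f: "\<And>k. k < CARD('n) \<Longrightarrow> f k \<in> F (Suc k) \<and> f k \<notin> F k" by metis
  have sp: "k \<le> CARD('n) \<Longrightarrow> F k = vec.span (f ` {..<k})" for k
  proof (induction k)
    case 0 show ?case by (simp add: flag_0[OF F])
  next
    case (Suc k)
    then have k: "k < CARD('n)" and IH: "F k = vec.span (f ` {..<k})" by auto
    have "vec.dim (f ` {..<Suc k}) = Suc (vec.dim (f ` {..<k}))"
      using f[OF k] IH by (simp add: lessThan_Suc vec.dim_insert)
    also have "vec.dim (f ` {..<k}) = k" using IH flag_dim[OF F, of k] k by (metis min.strict_order_iff min_def less_imp_le vec.dim_span)
    finally have "vec.dim (vec.span (f ` {..<Suc k})) = vec.dim (F (Suc k))"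
      using k by (simp add: flag_dim[OF F])
    moreover have "vec.span (f ` {..<Suc k}) \<subseteq> F (Suc k)"
    proof (rule vec.span_minimal[OF _ flag_subspace[OF F]])
      show "f ` {..<Suc k} \<subseteq> F (Suc k)"
        using f k flag_mono[OF F] by (auto simp: subset_iff) (meson Suc_le_eq less_Suc_eq_le order.strict_trans1)
    qed
    ultimately show ?case
      using vec.subspace_dim_equal[OF vec.subspace_span flag_subspace[OF F], of "f ` {..<Suc k}" "Suc k"]
      by (metis order_refl)
  qed
  have d: "vec.dim (f ` {..<CARD('n)}) = CARD('n)"
    using sp[of "CARD('n)"] flag_dim[OF F, of "CARD('n)"] by (metis min.idem order_refl vec.dim_span)
  have card: "card (f ` {..<CARD('n)}) = CARD('n)"
    using vec.dim_le_card'[of "f ` {..<CARD('n)}"] card_image_le[of "{..<CARD('n)}" f] d by simp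
  then have "inj_on f {..<CARD('n)}" by (simp add: eq_card_imp_inj_on)
  moreover have "vec.independent (f ` {..<CARD('n)})"
    using card d by (intro vec.card_le_dim_spanning[of _ "vec.span (f ` {..<CARD('n)})"]) (auto simp: vec.span_superset)
  ultimately show thesis using that sp by blast
qed

lemma flags_transitive:
  fixes F G :: "'n::finite flag"
  assumes F: "F \<in> flags" and G: "G \<in> flags"
  obtains g where "invertible g" "G = act g F"
proof -
  obtain f where f: "\<forall>k\<le>CARD('n). F k = vec.span (f ` {..<k})"
     "inj_on f {..<CARD('n)}" "vec.independent (f ` {..<CARD('n)})"
    using flag_adapted_basis[OF F] by blast
  obtain h where h: "\<forall>k\<le>CARD('n). G k = vec.span (h ` {..<k})"
     and "inj_on h {..<CARD('n)}" "vec.independent (h ` {..<CARD('n)})"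
    using flag_adapted_basis[OF G] by blast
  obtain T where T: "Vector_Spaces.linear (*s) (*s) T"
      "\<And>x. x \<in> f ` {..<CARD('n)} \<Longrightarrow> T x = (h \<circ> inv_into {..<CARD('n)} f) x"
    using vec.linear_independent_extend[OF f(3), of "h \<circ> inv_into {..<CARD('n)} f"] by blast
  have Tf: "T (f k) = h k" if "k < CARD('n)" for k
    using T(2)[of "f k"] that f(2) by simp
  have im: "T ` F k = G k" if "k \<le> CARD('n)" for k
  proof -
    have "T ` F k = vec.span (T ` f ` {..<k})"
      using vec.linear_span_image[OF T(1)] f(1) that by simp
    also have "T ` f ` {..<k} = h ` {..<k}" unfolding image_image using Tf that by (intro image_cong) auto
    finally show ?thesis using h(1) that by simp
  qed
  have im2: "T ` F k = G k" for k
  proof (cases "k \<le> CARD('n)")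
    case False
    then have "F k = F (CARD('n))" "G k = G (CARD('n))" using flag_top[OF F] flag_top[OF G] by auto
    then show ?thesis using im by simp
  qed (rule im)
  have mT: "matrix T *v x = T x" for x using matrix_works[OF T(1)] .
  have "surj T" using im2[of "CARD('n)"] flag_top[OF F] flag_top[OF G] by auto
  then have "invertible (matrix T)"
    by (simp add: invertible_right_inverse matrix_right_invertible_surjective mT)
  moreover have "G = act (matrix T) F" by (auto simp: act_def mT im2)
  ultimately show thesis using that by blast
qed

lemma dim_pres_flag_eq:
  fixes F G :: "'n::finite flag"
  shows "F \<in> flags \<Longrightarrow> G \<in> flags \<Longrightarrow> dim (pres (range F)) = dim (pres (range G))"
  using flags_transitive[of F G] act_range[of _ F] dim_pres_image[of _ "range F"] by metis

text \<open>\<open>Max\<close> is taken over a finite set whatever \<open>X\<close> is, because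
  every orbit dimension is at most \<open>dim (lie H)\<close>.\<close>

lemma strat_dim_ge: "orbit_dim H F \<le> strat_dim H X" if "F \<in> X"
proof -
  have "orbit_dim H ` X \<subseteq> {..dim (lie H)}" by (auto simp: orbit_dim_def)
  then show ?thesis unfolding strat_dim_def
    using that by (intro Max_ge) (auto intro: finite_subset)
qed

lemma strat_dim_flags_le:
  fixes F :: "'n::finite flag"
  assumes "F \<in> flags"
  shows "strat_dim SL (flags :: 'n flag set) \<le> dim (UNIV :: (complex ^ 'n ^ 'n) set) - dim (pres (range F))"
proof -
  have "orbit_dim SL ` (flags :: 'n flag set) = {dim (UNIV :: (complex ^ 'n ^ 'n) set) - dim (pres (range F))}"
  proof -
    have "orbit_dim SL G = dim (UNIV :: (complex ^ 'n ^ 'n) set) - dim (pres (range F))" if "G \<in> flags" for G :: "'n flag"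
      using orbit_dim_SL[OF that] dim_pres_flag_eq[OF assms that] by presburger
    then show ?thesis using assms by (force simp: image_iff)
  qed
  then show ?thesis by (simp add: strat_dim_def)
qed

section \<open>Conormal spaces at an isotropic flag\<close>

lemma bform_commute: "bform v w = bform w v"
  by (simp add: bform_def mult.commute)

lemma bform_add: "bform v (w + x) = bform v w + bform v x" "bform (w + x) v = bform w v + bform x v"
  by (simp_all add: bform_def algebra_simps sum.distrib)

lemma bform_diff: "bform v (w - x) = bform v w - bform v x" "bform (w - x) v = bform w v - bform x v"
  by (simp_all add: bform_def algebra_simps sum_subtractf)

lemma bform_scale: "bform v (c *s w) = c * bform v w" "bform (c *s w) v = c * bform w v"
  by (simp_all add: bform_def algebra_simps sum_distrib_left)

lemma bform_0: "bform v 0 = 0" "bform 0 v = 0"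
  by (simp_all add: bform_def)

lemma bform_e: "bform (e i) v = v $ i" "bform v (e i) = v $ i"
  by (simp_all add: bform_def e_def axis_def if_distrib[of "\<lambda>x. x * _"] if_distrib[of "\<lambda>x. _ * x"] cong: if_cong)

lemma bform_transpose: "bform (A *v v) w = bform v (transpose A *v w)"
  unfolding bform_def matrix_vector_mult_def transpose_def
  by (simp add: sum_distrib_left sum_distrib_right algebra_simps) (rule sum.swap)

lemma subspace_perp: "vec.subspace (perp V)"
  by (auto simp: perp_def vec.subspace_def bform_add bform_scale bform_0)

text \<open>With n the dimension of the space, the case i = n of the definition gives the dimension
  of \<open>perp (F j)\<close>. The case i = n - j says that the (n - j)-th subspace meets it in
  that same dimension, so both subspaces agree with their intersection.\<close>

lemma isotropic_iff_perp:
  fixes F :: "'n::finite flag"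
  assumes F: "F \<in> flags"
  shows "isotropic F \<longleftrightarrow> (\<forall>j\<le>CARD('n). perp (F j) = F (CARD('n) - j))"
proof
  assume iso: "isotropic F"
  show "\<forall>j\<le>CARD('n). perp (F j) = F (CARD('n) - j)"
  proof (intro allI impI)
    fix j assume j: "j \<le> CARD('n)"
    have "vec.dim (F (CARD('n)) \<inter> perp (F j)) = CARD('n) - j"
      using iso j unfolding isotropic_def by (metis diff_le_self min.absorb2 order_refl)
    then have d1: "vec.dim (perp (F j)) = CARD('n) - j" using flag_top[OF F] by simp
    have d2: "vec.dim (F (CARD('n) - j) \<inter> perp (F j)) = CARD('n) - j"
      using iso j unfolding isotropic_def by (metis diff_le_self min.idem)
    have d3: "vec.dim (F (CARD('n) - j)) = CARD('n) - j" using flag_dim[OF F] by simp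
    have "F (CARD('n) - j) \<inter> perp (F j) = perp (F j)"
      by (rule vec.subspace_dim_equal) (auto simp: d1 d2 intro: vec.subspace_inter flag_subspace[OF F] subspace_perp)
    moreover have "F (CARD('n) - j) \<inter> perp (F j) = F (CARD('n) - j)"
      by (rule vec.subspace_dim_equal) (auto simp: d3 d2 intro: vec.subspace_inter flag_subspace[OF F] subspace_perp)
    ultimately show "perp (F j) = F (CARD('n) - j)" by simp
  qed
next
  assume *: "\<forall>j\<le>CARD('n). perp (F j) = F (CARD('n) - j)"
  have "F i \<inter> F k = F (min i k)" for i k
    using flag_mono[OF F, of i k] flag_mono[OF F, of k i] by (auto simp: min_def)
  then show "isotropic F" unfolding isotropic_def using * flag_dim[OF F] by simp
qed

text \<open>Transposition is the adjoint for \<open>bform\<close>, and an isotropic flag is its own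
  dual flag.\<close>

lemma pres_transpose:
  fixes F :: "'n::finite flag"
  assumes F: "F \<in> flags" and iso: "isotropic F" and A: "A \<in> pres (range F)"
  shows "transpose A \<in> pres (range F)"
proof -
  have "transpose A *v x \<in> F j" if x: "x \<in> F j" for j x
  proof (cases "j \<le> CARD('n)")
    case False then show ?thesis using flag_top[OF F, of j] by simp
  next
    case True
    then have p: "perp (F (CARD('n) - j)) = F j"
      using iso isotropic_iff_perp[OF F] by (metis diff_diff_cancel diff_le_self)
    have "bform y (transpose A *v x) = 0" if "y \<in> F (CARD('n) - j)" for y
    proof -
      have "A *v y \<in> F (CARD('n) - j)" using A that by (auto simp: pres_def)
      then have "bform (A *v y) x = 0" using x p by (auto simp: perp_def)
      then show ?thesis by (simp add: bform_transpose)
    qed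
    then show ?thesis unfolding p[symmetric] by (simp add: perp_def)
  qed
  then show ?thesis by (auto simp: pres_def)
qed

section \<open>The trace form and annihilators of matrix algebras\<close>

definition cnj_transpose :: "complex ^ 'n ^ 'n \<Rightarrow> complex ^ 'n ^ 'n::finite" where
  "cnj_transpose A = (\<chi> i j. cnj (A $ j $ i))"

lemma inner_cnj_transpose: "inner (cnj_transpose Y) A = Re (trace (Y ** A))"
proof -
  have "inner (cnj_transpose Y) A = (\<Sum>i\<in>UNIV. \<Sum>j\<in>UNIV. Re (Y $ j $ i * A $ i $ j))"
    by (simp add: inner_vec_def cnj_transpose_def inner_complex_def)
  also have "\<dots> = Re (trace (Y ** A))"
    unfolding trace_def matrix_matrix_mult_def by (subst sum.swap) simp
  finally show ?thesis .
qed

lemma cnj_transpose_add: "cnj_transpose A + cnj_transpose B = cnj_transpose (A + B)"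
  by (simp add: cnj_transpose_def vec_eq_iff)

lemma cnj_transpose_idem: "cnj_transpose (cnj_transpose A) = A"
  by (simp add: cnj_transpose_def vec_eq_iff)

text \<open>The real part is taken so that real subspaces such as \<open>so_real\<close> are
  allowed. For the stabilizer algebra of a flag this is the nilradical.\<close>

definition ann :: "(complex ^ 'n ^ 'n::finite) set \<Rightarrow> (complex ^ 'n ^ 'n) set" where
  "ann S = {Y. \<forall>A\<in>S. Re (trace (Y ** A)) = 0}"

lemma cnj_transpose_in_orthogonal_comp: "cnj_transpose Y \<in> S\<^sup>\<bottom> \<longleftrightarrow> Y \<in> ann S"
  by (simp add: orthogonal_comp_def orthogonal_def ann_def inner_commute flip: inner_cnj_transpose)

lemma trace_rank_one:
  fixes Y :: "complex ^ 'n ^ 'n"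
  shows "trace (Y ** (\<chi> i j. x $ i * y $ j)) = bform y (Y *v x)"
  unfolding trace_def matrix_matrix_mult_def bform_def matrix_vector_mult_def
  by (simp add: sum_distrib_left algebra_simps)

text \<open>The test matrices have rank one: x times the transpose of y, with y orthogonal to
  \<open>F j\<close>. They preserve the flag, since they kill \<open>F k\<close> for k \<le> j and
  have their image in \<open>F k\<close> for k > j.\<close>

lemma ann_pres_nilpotent:
  fixes F :: "'n::finite flag"
  assumes F: "F \<in> flags" and iso: "isotropic F" and Y: "Y \<in> ann (pres (range F))"
    and j: "j < CARD('n)" and x: "x \<in> F (Suc j)"
  shows "Y *v x \<in> F j"
proof -
  have p: "perp (F (CARD('n) - j)) = F j"
    using iso j isotropic_iff_perp[OF F] by (metis diff_diff_cancel diff_le_self less_imp_le)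
  have "bform y (Y *v x) = 0" if y: "y \<in> F (CARD('n) - j)" for y
  proof -
    have mem: "(\<chi> i j. (c *s x) $ i * y $ j) \<in> pres (range F)" for c
    proof -
      have "(\<chi> i j. (c *s x) $ i * y $ j) *v v \<in> F k" if v: "v \<in> F k" for k v
      proof -
        have eq: "(\<chi> i j. (c *s x) $ i * y $ j) *v v = (bform y v * c) *s x"
          by (simp add: vec_eq_iff matrix_vector_mult_def bform_def sum_distrib_left sum_distrib_right algebra_simps)
        show ?thesis
        proof (cases "k \<le> j")
          case True
          then have "bform y v = 0"
            using y v flag_mono[OF F True] p by (auto simp: perp_def)
          then show ?thesis unfolding eq using vec.subspace_0[OF flag_subspace[OF F]] by simp
        next
          case False
          then have "x \<in> F k" using x flag_mono[OF F, of "Suc j" k] by auto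
          then show ?thesis unfolding eq using vec.subspace_scale[OF flag_subspace[OF F]] by blast
        qed
      qed
      then show ?thesis by (auto simp: pres_def)
    qed
    have "Re (c * bform y (Y *v x)) = 0" for c
    proof -
      have "Re (trace (Y ** (\<chi> i j. (c *s x) $ i * y $ j))) = 0"
        using Y mem by (auto simp: ann_def)
      then show ?thesis unfolding trace_rank_one by (simp add: vec.scale bform_scale)
    qed
    \<comment> \<open>Multiples by 1 and by the imaginary unit recover a complex number from real
      parts.\<close>
    from this[of 1] this[of \<i>] show ?thesis by (simp add: complex_eq_iff)
  qed
  then show ?thesis unfolding p[symmetric] by (simp add: perp_def)
qed

lemma ann_pres_subset_pres:
  fixes F :: "'n::finite flag"
  assumes F: "F \<in> flags" and iso: "isotropic F" and Y: "Y \<in> ann (pres (range F))"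
  shows "Y \<in> pres (range F)"
proof -
  have "Y *v x \<in> F j" if x: "x \<in> F j" for j x
  proof (cases "CARD('n) \<le> j")
    case True then show ?thesis using flag_top[OF F] by simp
  next
    case False
    then have "Y *v x \<in> F j" using x flag_mono[OF F, of j "Suc j"] by (intro ann_pres_nilpotent[OF F iso Y]) auto
    then show ?thesis .
  qed
  then show ?thesis by (auto simp: pres_def)
qed

lemma trace_transpose: "trace (transpose A) = trace A"
  by (simp add: trace_def transpose_def)

lemma ann_pres_transpose:
  fixes F :: "'n::finite flag"
  assumes F: "F \<in> flags" and iso: "isotropic F" and Y: "Y \<in> ann (pres (range F))"
  shows "transpose Y \<in> ann (pres (range F))"
proof -
  have "trace (transpose Y ** A) = trace (Y ** transpose A)" for A
    by (metis matrix_transpose_mul trace_mul_sym trace_transpose transpose_transpose)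
  then show ?thesis using Y pres_transpose[OF F iso] by (auto simp: ann_def)
qed

lemma ann_diff: "X \<in> ann S \<Longrightarrow> Y \<in> ann S \<Longrightarrow> X - Y \<in> ann S"
  by (simp add: ann_def matrix_diff_rdistrib trace_sub)

text \<open>
  An isotropic flag is in general position with respect to its complex conjugate, so no nonzero
  matrix in the nilradical of its stabilizer is purely imaginary.
\<close>

lemma ann_pres_imaginary:
  fixes F :: "'n::finite flag"
  assumes F: "F \<in> flags" and iso: "isotropic F" and Z: "Z \<in> ann (pres (range F))"
    and im: "\<And>i j. Re (Z $ i $ j) = 0"
  shows "Z = 0"
proof -
  have "transpose Z \<in> pres (range F)"
    using ann_pres_subset_pres[OF F iso Z] pres_transpose[OF F iso] by blast
  then have "Re (trace (Z ** transpose Z)) = 0" using Z by (auto simp: ann_def)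
  moreover have "Re (trace (Z ** transpose Z)) = - (\<Sum>i\<in>UNIV. \<Sum>j\<in>UNIV. (Im (Z $ i $ j))\<^sup>2)"
    by (simp add: trace_def matrix_matrix_mult_def transpose_def im power2_eq_square sum_negf)
  ultimately have "(\<Sum>i\<in>UNIV. \<Sum>j\<in>UNIV. (Im (Z $ i $ j))\<^sup>2) = 0" by simp
  then have "Im (Z $ i $ j) = 0" for i j
    by (simp add: sum_nonneg_eq_0_iff sum_nonneg)
  then show ?thesis using im by (simp add: vec_eq_iff complex_eq_iff)
qed

lemma trace_unit:
  fixes Y :: "complex ^ 'n ^ 'n"
  shows "trace (Y ** (\<chi> i j. if i = a \<and> j = b then c else 0)) = Y $ b $ a * c"
proof -
  have eq: "(\<chi> i j. if i = a \<and> j = b then c else 0) = (\<chi> i j. (c *s e a) $ i * e b $ j)"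
    by (auto simp: vec_eq_iff axis_def e_def)
  show ?thesis unfolding eq trace_rank_one bform_e
    by (simp add: matrix_vector_mult_def e_def axis_def if_distrib[of "\<lambda>x. _ * x"] cong: if_cong)
qed

lemma ann_upper_triangular:
  assumes Y: "Y \<in> ann (pres (range std_sub))" and "j \<le> i"
  shows "Y $ i $ j = 0"
proof -
  have "Re (Y $ i $ j * c) = 0" for c
  proof -
    have "(\<chi> i' j'. if i' = j \<and> j' = i then c else 0) \<in> pres (range std_sub)"
      using assms(2) by (auto simp: upper_triangular_pres)
    then have "Re (trace (Y ** (\<chi> i' j'. if i' = j \<and> j' = i then c else 0))) = 0"
      using Y by (auto simp: ann_def)
    then show ?thesis by (simp add: trace_unit)
  qed
  from this[of 1] this[of \<i>] show ?thesis by (simp add: complex_eq_iff)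
qed

lemma ann_so_real:
  assumes Y: "Y \<in> ann so_real"
  shows "Re (Y $ i $ j) = Re (Y $ j $ i)"
proof (cases "i = j")
  case False
  have "(\<chi> a b. if a = i \<and> b = j then 1 else 0) - (\<chi> a b. if a = j \<and> b = i then 1 else 0) \<in> so_real"
    using False by (auto simp: so_real_def vec_eq_iff transpose_def)
  then have "Re (trace (Y ** ((\<chi> a b. if a = i \<and> b = j then 1 else 0) - (\<chi> a b. if a = j \<and> b = i then 1 else 0)))) = 0"
    using Y by (auto simp: ann_def)
  then show ?thesis by (simp add: matrix_diff_ldistrib trace_sub trace_unit)
qed simp

lemma subspace_so_real: "subspace so_real"
proof (rule subspaceI)
  show "0 \<in> so_real" by (simp add: so_real_def transpose_def vec_eq_iff)
qed (auto simp: so_real_def transpose_add transpose_scalar scaleR_conv_of_real[where 'a = complex])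

definition strict_upper :: "complex ^ ('n::{finite,linorder}) ^ ('n::{finite,linorder}) \<Rightarrow> complex ^ ('n::{finite,linorder}) ^ ('n::{finite,linorder})" where
  "strict_upper Y = (\<chi> i j. if i < j then Y $ i $ j else 0)"

lemma dim_orthogonal_comp: "subspace W \<Longrightarrow> dim (W\<^sup>\<bottom>) + dim W = DIM('a)" for W :: "'a::euclidean_space set"
  using dim_subspace_orthogonal_to_vectors[of W UNIV] by (simp add: orthogonal_comp_def)

text \<open>\<open>N\<close> is the sum of the conormal spaces at \<open>F\<close> of the two
  orbits. A common conormal is strictly upper triangular with symmetric real part, hence purely
  imaginary, hence zero by \<open>ann_pres_imaginary\<close>. So the sum is direct and its dimension
  follows by counting.\<close>

lemma conormal_sum:
  fixes F :: "'n::{finite,linorder} flag"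
  assumes F: "F \<in> flags" and iso: "isotropic F"
  defines "b \<equiv> pres (range (std_sub :: 'n \<Rightarrow> _))" and "p \<equiv> pres (range F)"
    and "s \<equiv> (so_real :: (complex ^ ('n::{finite,linorder}) ^ ('n::{finite,linorder})) set)"
  defines "N \<equiv> {x + y |x y. x \<in> {a + c |a c. a \<in> b \<and> c \<in> p}\<^sup>\<bottom> \<and> y \<in> {a + c |a c. a \<in> s \<and> c \<in> p}\<^sup>\<bottom>}"
  shows "subspace N" and "N \<subseteq> p\<^sup>\<bottom>"
    and "dim N + (dim b - dim (b \<inter> p)) + (dim s - dim (s \<inter> p)) + dim p = dim (p\<^sup>\<bottom>) + dim (UNIV :: (complex ^ ('n::{finite,linorder}) ^ ('n::{finite,linorder})) set)"
    and "N \<subseteq> {x + y |x y. x \<in> cnj_transpose ` (ann b \<inter> ann p) \<and> y \<in> cnj_transpose ` (ann s \<inter> ann p)}"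
proof -
  let ?V1 = "{a + c |a c. a \<in> b \<and> c \<in> p}" and ?V2 = "{a + c |a c. a \<in> s \<and> c \<in> p}"
  have sb: "subspace b" unfolding b_def by (intro subspace_pres) (auto simp: subspace_std_sub)
  have sp: "subspace p" unfolding p_def by (intro subspace_pres) (auto simp: flag_subspace[OF F])
  have ss: "subspace s" unfolding s_def by (rule subspace_so_real)
  have sV: "subspace ?V1" "subspace ?V2" using subspace_sums[OF sb sp] subspace_sums[OF ss sp] by auto
  have bV: "b \<subseteq> ?V1" "p \<subseteq> ?V1" "s \<subseteq> ?V2" "p \<subseteq> ?V2"
    using subspace_0[OF sb] subspace_0[OF sp] subspace_0[OF ss] by (force)+
  have in_ann: "A \<in> S\<^sup>\<bottom> \<longleftrightarrow> cnj_transpose A \<in> ann S" for A S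
    using cnj_transpose_in_orthogonal_comp[of "cnj_transpose A" S] by (simp add: cnj_transpose_idem)
  have V1: "cnj_transpose A \<in> ann b \<inter> ann p" if "A \<in> ?V1\<^sup>\<bottom>" for A
    using subsetD[OF orthogonal_comp_anti_mono[OF bV(1)] that] subsetD[OF orthogonal_comp_anti_mono[OF bV(2)] that]
    unfolding in_ann by (rule IntI)
  have V2: "cnj_transpose A \<in> ann s \<inter> ann p" if "A \<in> ?V2\<^sup>\<bottom>" for A
    using subsetD[OF orthogonal_comp_anti_mono[OF bV(3)] that] subsetD[OF orthogonal_comp_anti_mono[OF bV(4)] that]
    unfolding in_ann by (rule IntI)
  have zero: "?V1\<^sup>\<bottom> \<inter> ?V2\<^sup>\<bottom> = {0}"
  proof -
    have "A = 0" if A: "A \<in> ?V1\<^sup>\<bottom>" "A \<in> ?V2\<^sup>\<bottom>" for A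
    proof -
      define X where "X = cnj_transpose A"
      have X: "X \<in> ann b" "X \<in> ann p" "X \<in> ann s" using V1[OF A(1)] V2[OF A(2)] by (simp_all add: X_def)
      have "Re (X $ i $ k) = 0" for i k
        using ann_upper_triangular[OF X(1)[unfolded b_def], of i k] ann_upper_triangular[OF X(1)[unfolded b_def], of k i]
          ann_so_real[OF X(3)[unfolded s_def], of i k]
        by (cases "i \<le> k") auto
      then have "X = 0" using ann_pres_imaginary[OF F iso X(2)[unfolded p_def]] by blast
      then show ?thesis by (simp add: X_def cnj_transpose_def vec_eq_iff)
    qed
    then show ?thesis using subspace_0[OF subspace_orthogonal_comp] by blast
  qed
  show "subspace N" unfolding N_def by (rule subspace_sums[OF subspace_orthogonal_comp subspace_orthogonal_comp])
  show "N \<subseteq> p\<^sup>\<bottom>" unfolding N_def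
    using orthogonal_comp_anti_mono[OF bV(2)] orthogonal_comp_anti_mono[OF bV(4)]
      subspace_add[OF subspace_orthogonal_comp, of _ p] by blast
  have "dim N = dim (?V1\<^sup>\<bottom>) + dim (?V2\<^sup>\<bottom>)" unfolding N_def
    using dim_sums_Int[OF subspace_orthogonal_comp subspace_orthogonal_comp, of ?V1 ?V2] zero by simp
  moreover have "dim ?V1 + dim (b \<inter> p) = dim b + dim p" "dim ?V2 + dim (s \<inter> p) = dim s + dim p"
    using dim_sums_Int[OF sb sp] dim_sums_Int[OF ss sp] by auto
  moreover note dim_orthogonal_comp[OF sV(1)] dim_orthogonal_comp[OF sV(2)] dim_orthogonal_comp[OF sp]
  moreover have "dim (b \<inter> p) \<le> dim b" "dim (s \<inter> p) \<le> dim s"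
    by (intro dim_subset; blast)+
  moreover have "dim (UNIV :: (complex ^ ('n::{finite,linorder}) ^ ('n::{finite,linorder})) set) = DIM(complex ^ ('n::{finite,linorder}) ^ ('n::{finite,linorder}))" by (rule dim_UNIV)
  ultimately show "dim N + (dim b - dim (b \<inter> p)) + (dim s - dim (s \<inter> p)) + dim p = dim (p\<^sup>\<bottom>) + dim (UNIV :: (complex ^ ('n::{finite,linorder}) ^ ('n::{finite,linorder})) set)"
    by linarith
  show "N \<subseteq> {x + y |x y. x \<in> cnj_transpose ` (ann b \<inter> ann p) \<and> y \<in> cnj_transpose ` (ann s \<inter> ann p)}"
  proof
    fix A assume "A \<in> N"
    then obtain x y where xy: "A = x + y" "x \<in> ?V1\<^sup>\<bottom>" "y \<in> ?V2\<^sup>\<bottom>" unfolding N_def by blast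
    have "x \<in> cnj_transpose ` (ann b \<inter> ann p)" using V1[OF xy(2)] cnj_transpose_idem[of x] by (metis imageI)
    moreover have "y \<in> cnj_transpose ` (ann s \<inter> ann p)" using V2[OF xy(3)] cnj_transpose_idem[of y] by (metis imageI)
    ultimately show "A \<in> {x + y |x y. x \<in> cnj_transpose ` (ann b \<inter> ann p) \<and> y \<in> cnj_transpose ` (ann s \<inter> ann p)}"
      using xy(1) by blast
  qed
qed

text \<open>The numerical form of transversality: dim Z \<le> dim B.F + dim K.F, where K is the
  rotation group.\<close>

lemma codim_pres_flag_le:
  fixes F :: "'n::{finite,linorder} flag"
  assumes F: "F \<in> flags" and iso: "isotropic F"
  shows "dim (UNIV :: (complex ^ ('n::{finite,linorder}) ^ ('n::{finite,linorder})) set) - dim (pres (range F))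
    \<le> dim (pres (range (std_sub :: 'n \<Rightarrow> _))) - dim (pres (range std_sub \<union> range F))
       + (dim (so_real :: (complex ^ ('n::{finite,linorder}) ^ ('n::{finite,linorder})) set) - dim (so_real \<inter> pres (range F)))"
  using conormal_sum(3)[OF F iso] dim_subset[OF conormal_sum(2)[OF F iso]] unfolding pres_Un by linarith

text \<open>
  Equality in the previous bound means that every matrix in the nilradical of the stabilizer of
  \<open>F\<close> is the sum of a strictly upper triangular and a symmetric matrix in this nilradical.
  For a skew-symmetric matrix the first summand has to be twice the strictly upper triangular part.
\<close>

lemma strict_upper_preserves:
  fixes F :: "'n::{finite,linorder} flag"
  assumes F: "F \<in> flags" and iso: "isotropic F"
    and dims: "dim (pres (range (std_sub :: 'n \<Rightarrow> _))) - dim (pres (range std_sub \<union> range F))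
       + (dim (so_real :: (complex ^ ('n::{finite,linorder}) ^ ('n::{finite,linorder})) set) - dim (so_real \<inter> pres (range F)))
       \<le> dim (UNIV :: (complex ^ ('n::{finite,linorder}) ^ ('n::{finite,linorder})) set) - dim (pres (range F))"
    and skew: "transpose Y = - Y" and Y: "Y \<in> ann (pres (range F))"
    and j: "j < CARD('n)" and x: "x \<in> F (Suc j)"
  shows "strict_upper Y *v x \<in> F j"
proof -
  let ?b = "pres (range (std_sub :: 'n \<Rightarrow> _))" and ?p = "pres (range F)"
  let ?s = "so_real :: (complex ^ ('n::{finite,linorder}) ^ ('n::{finite,linorder})) set"
  note N = conormal_sum[OF F iso]
  have "dim ?p \<le> dim (UNIV :: (complex ^ ('n::{finite,linorder}) ^ ('n::{finite,linorder})) set)" by (intro dim_subset) simp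
  with dims N(3) have "dim (?p\<^sup>\<bottom>) \<le> dim {x + y |x y. x \<in> {a + c |a c. a \<in> ?b \<and> c \<in> ?p}\<^sup>\<bottom> \<and> y \<in> {a + c |a c. a \<in> ?s \<and> c \<in> ?p}\<^sup>\<bottom>}"
    unfolding pres_Un by linarith
  from subspace_dim_equal[OF N(1) subspace_orthogonal_comp N(2) this]
  have "cnj_transpose Y \<in> {x + y |x y. x \<in> cnj_transpose ` (ann ?b \<inter> ann ?p) \<and> y \<in> cnj_transpose ` (ann ?s \<inter> ann ?p)}"
    using N(4) Y unfolding cnj_transpose_in_orthogonal_comp[symmetric] by (elim ssubst subsetD) simp
  then obtain X S where XS: "cnj_transpose Y = cnj_transpose X + cnj_transpose S"
    and m: "X \<in> ann ?b" "X \<in> ann ?p" "S \<in> ann ?s" "S \<in> ann ?p" by blast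
  have YX: "Y = X + S" using arg_cong[OF XS, of cnj_transpose] by (simp add: cnj_transpose_add cnj_transpose_idem)
  \<comment> \<open>The annihilator of \<open>so_real\<close> controls only the real part of
    \<open>S\<close>. The difference from its transpose is therefore a purely imaginary element of
    the nilradical, which vanishes.\<close>
  have "S - transpose S = 0"
    using ann_so_real[OF m(3)]
    by (intro ann_pres_imaginary[OF F iso ann_diff[OF m(4) ann_pres_transpose[OF F iso m(4)]]])
       (simp add: transpose_def)
  then have S: "S $ i $ k = S $ k $ i" for i k by (simp add: vec_eq_iff transpose_def)
  have "X = 2 *\<^sub>R strict_upper Y"
  proof (intro vec_eq_iff[THEN iffD2] allI)
    fix i k
    show "X $ i $ k = (2 *\<^sub>R strict_upper Y) $ i $ k"
    proof (cases "i < k")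
      case False
      then show ?thesis using ann_upper_triangular[OF m(1), of k i] by (simp add: strict_upper_def)
    next
      case True
      have "X $ k $ i = 0" using ann_upper_triangular[OF m(1), of i k] True by simp
      then have "S $ k $ i = Y $ k $ i" using YX by simp
      also have "\<dots> = - Y $ i $ k" using arg_cong[OF skew, of "\<lambda>A. A $ i $ k"] by (simp add: transpose_def)
      finally have "S $ i $ k = - Y $ i $ k" unfolding S[of i k] .
      moreover have "X $ i $ k = Y $ i $ k - S $ i $ k" unfolding YX by simp
      ultimately have "X $ i $ k = 2 * Y $ i $ k" by simp
      then show ?thesis using True by (simp add: strict_upper_def scaleR_conv_of_real)
    qed
  qed
  then have "strict_upper Y *v x = (1/2) *s (X *v x)"
    by (simp add: vec_eq_iff matrix_vector_mult_def scaleR_conv_of_real sum_distrib_left)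
  then show ?thesis
    using ann_pres_nilpotent[OF F iso m(2) j x] vec.subspace_scale[OF flag_subspace[OF F]] by metis
qed

text \<open>The trace of the product with \<open>A\<close> is
  \<open>bform u (A *v f) - bform f (A *v u)\<close>. Both terms vanish because \<open>A\<close>
  preserves \<open>F i\<close> and its orthogonal complement.\<close>

lemma wedge_in_ann:
  fixes F :: "'n::finite flag"
  assumes F: "F \<in> flags" and iso: "isotropic F" and i: "i \<le> CARD('n)"
    and f: "f \<in> F i" and u: "u \<in> F (CARD('n) - i)"
  shows "(\<chi> a b. f $ a * u $ b - u $ a * f $ b) \<in> ann (pres (range F))"
proof -
  have p: "perp (F i) = F (CARD('n) - i)" using isotropic_iff_perp[OF F] iso i by blast
  have "trace ((\<chi> a b. f $ a * u $ b - u $ a * f $ b) ** A) = 0" if A: "A \<in> pres (range F)" for A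
  proof -
    have "A *v f \<in> F i" "A *v u \<in> F (CARD('n) - i)" using A f u by (auto simp: pres_def)
    then have "bform (A *v f) u = 0" "bform f (A *v u) = 0"
      using f u unfolding p[symmetric] perp_def by blast+
    then have "bform u (A *v f) = 0" "bform f (A *v u) = 0"
      by (simp_all add: bform_commute[of u])
    moreover have "(\<chi> a b. f $ a * u $ b - u $ a * f $ b) = (\<chi> a b. f $ a * u $ b) - (\<chi> a b. u $ a * f $ b)"
      by (simp add: vec_eq_iff)
    ultimately show ?thesis
      by (simp add: matrix_diff_rdistrib trace_sub trace_mul_sym[of _ A] trace_rank_one)
  qed
  then show ?thesis by (simp add: ann_def)
qed

section \<open>The shape of the flag in the case of complementary dimension\<close>

text \<open>The initial part of \<open>cycle_basis\<close>. It is separated from \<open>mid\<close>,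
  which is still unknown while the flag is being identified.\<close>

definition sign_vectors :: "complex list \<Rightarrow> 'n list \<Rightarrow> 'n list \<Rightarrow> (complex ^ 'n::finite) list" where
  "sign_vectors ss ks ls = map2 (\<lambda>s (k, l). s *s e l + e k) ss (zip ks ls)"

lemma length_sign_vectors [simp]: "length (sign_vectors ss ks ls) = min (length ss) (min (length ks) (length ls))"
  by (simp add: sign_vectors_def)

lemma nth_sign_vectors:
  "length ss = i \<Longrightarrow> length ks = i \<Longrightarrow> length ls = i \<Longrightarrow> a < i \<Longrightarrow>
    sign_vectors ss ks ls ! a = ss ! a *s e (ls ! a) + e (ks ! a)"
  by (simp add: sign_vectors_def)

lemma sign_vectors_snoc:
  "length ss = i \<Longrightarrow> length ks = i \<Longrightarrow> length ls = i \<Longrightarrow>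
    sign_vectors (ss @ [s]) (ks @ [k]) (ls @ [l]) = sign_vectors ss ks ls @ [s *s e l + e k]"
  by (simp add: sign_vectors_def)

lemma e_nth: "e i $ j = (if i = j then 1 else 0)"
  by (simp add: e_def axis_def)

text \<open>The coordinates at \<open>ks\<close> form a dual basis for the sign vectors: they read
  off coefficients, and they detect whether a vector of the span is zero.\<close>

lemma nth_sign_vectors_coord:
  assumes "length ss = i" "length ks = i" "length ls = i" "distinct (ks @ ls)" "a < i" "b < i"
  shows "sign_vectors ss ks ls ! a $ (ks ! b) = (if a = b then 1 else 0)"
proof -
  have "ls ! a \<noteq> ks ! b" using assms by (metis distinct_append disjoint_iff nth_mem)
  moreover have "ks ! a = ks ! b \<longleftrightarrow> a = b" using assms by (simp add: nth_eq_iff_index_eq)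
  ultimately show ?thesis using assms by (simp add: nth_sign_vectors e_nth)
qed

lemma span_sign_vectors_expand:
  fixes ks ls :: "'n::finite list"
  assumes len: "length ss = i" "length ks = i" "length ls = i" and dist: "distinct (ks @ ls)"
    and v: "v \<in> vec.span (set (sign_vectors ss ks ls))"
  shows "v = (\<Sum>a<i. v $ (ks ! a) *s sign_vectors ss ks ls ! a)"
  using v
proof (induction rule: vec.span_induct_alt)
  case base
  then show ?case by simp
next
  case (step c x y)
  then obtain b where b: "b < i" "x = sign_vectors ss ks ls ! b"
    using len by (auto simp: in_set_conv_nth)
  have "(\<Sum>a<i. x $ (ks ! a) *s sign_vectors ss ks ls ! a) = (\<Sum>a<i. (if a = b then x else 0))"
    using b len dist by (intro sum.cong) (auto simp: nth_sign_vectors_coord)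
  then have x: "(\<Sum>a<i. x $ (ks ! a) *s sign_vectors ss ks ls ! a) = x" using b by simp
  have "(\<Sum>a<i. (c *s x + y) $ (ks ! a) *s sign_vectors ss ks ls ! a)
     = c *s (\<Sum>a<i. x $ (ks ! a) *s sign_vectors ss ks ls ! a) + (\<Sum>a<i. y $ (ks ! a) *s sign_vectors ss ks ls ! a)"
    by (simp add: vec.scale_left_distrib sum.distrib vec.scale_sum_right)
  then show ?case using x step.IH by simp
qed

lemma span_insert_flag:
  fixes F :: "'n::finite flag"
  assumes F: "F \<in> flags" and i: "i < CARD('n)" and f: "f \<in> F (Suc i)" "f \<notin> F i"
  shows "vec.span (insert f (F i)) = F (Suc i)"
proof (rule vec.subspace_dim_equal)
  show "vec.span (insert f (F i)) \<subseteq> F (Suc i)"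
    using f flag_mono[OF F, of i "Suc i"] by (intro vec.span_minimal flag_subspace[OF F]) auto
  have "f \<notin> vec.span (F i)" unfolding vec.span_eq_iff[THEN iffD2, OF flag_subspace[OF F]] by (rule f(2))
  then show "vec.dim (F (Suc i)) \<le> vec.dim (vec.span (insert f (F i)))"
    using i by (simp add: vec.dim_insert flag_dim[OF F])
qed (auto intro: flag_subspace[OF F])

text \<open>Let l and k be the extreme indices in the support of \<open>f\<close>. An index a of the
  support strictly between them would give the hypothesis a nonzero row. Once the support is {l, k},
  \<open>bform f f = 0\<close> says that the ratio of the two coordinates squares to -1.\<close>

lemma support_two:
  fixes f :: "complex ^ 'n::{finite,linorder}"
  assumes f0: "f \<noteq> 0" and ff: "bform f f = 0"
    and H: "\<And>u l k a. \<lbrakk>f $ l \<noteq> 0; f $ k \<noteq> 0; l < a; a < k; f $ a \<noteq> 0; u = f $ l *s e k - f $ k *s e l\<rbrakk> \<Longrightarrow>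
        strict_upper (\<chi> a b. f $ a * u $ b - u $ a * f $ b) *v f = 0"
  obtains l k s where "l < k" "f $ l \<noteq> 0" "f $ k \<noteq> 0" "f = f $ k *s (s *s e l + e k)" "s \<in> {\<i>, - \<i>}"
proof -
  let ?S = "{a. f $ a \<noteq> 0}"
  define k l where "k = Max ?S" and "l = Min ?S"
  have ne: "?S \<noteq> {}" using f0 by (auto simp: vec_eq_iff)
  have k: "f $ k \<noteq> 0" and l: "f $ l \<noteq> 0" using Max_in[OF _ ne] Min_in[OF _ ne] by (auto simp: k_def l_def)
  have kmax: "a \<le> k" and lmin: "l \<le> a" if "f $ a \<noteq> 0" for a
    using that by (auto simp: k_def l_def)
  have "l \<noteq> k"
  proof
    assume "l = k"
    then have "f $ a = 0" if "a \<noteq> k" for a using kmax[of a] lmin[of a] that by fastforce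
    then have "bform f f = (\<Sum>a\<in>UNIV. if a = k then f $ k * f $ k else 0)"
      unfolding bform_def by (intro sum.cong) auto
    then show False using ff k by simp
  qed
  then have lk: "l < k" using kmax[OF l] by simp
  have mid: "f $ a = 0" if a: "l < a" "a < k" for a
  proof (rule ccontr)
    assume fa: "f $ a \<noteq> 0"
    define u where "u = f $ l *s e k - f $ k *s e l"
    have ua: "u $ a = 0" using a by (auto simp: u_def e_nth)
    have "0 = (strict_upper (\<chi> a b. f $ a * u $ b - u $ a * f $ b) *v f) $ a"
      using H[OF l k a fa u_def] by simp
    \<comment> \<open>The strictly upper part keeps the columns after a. Since u lives on {l, k} and
      vanishes at a, only column k contributes.\<close>
    also have "\<dots> = (\<Sum>d\<in>UNIV. if d = k then f $ a * f $ l * f $ k else 0)"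
      unfolding matrix_vector_mult_def vec_lambda_beta
    proof (rule sum.cong)
      fix d
      show "strict_upper (\<chi> a b. f $ a * u $ b - u $ a * f $ b) $ a $ d * f $ d = (if d = k then f $ a * f $ l * f $ k else 0)"
      proof (cases "d = k \<or> d = l")
        case True
        then show ?thesis using a lk by (auto simp: strict_upper_def ua u_def e_nth)
      next
        case False
        then have "u $ d = 0" by (auto simp: u_def e_nth)
        then show ?thesis using False by (simp add: strict_upper_def ua)
      qed
    qed simp
    finally show False using fa l k by simp
  qed
  have sup: "f $ a = 0" if "a \<noteq> l" "a \<noteq> k" for a
    using kmax[of a] lmin[of a] mid[of a] that by fastforce
  have feq: "f = f $ k *s ((f $ l / f $ k) *s e l + e k)"
    using sup lk k by (auto simp: vec_eq_iff e_nth)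
  have "bform f f = (\<Sum>a\<in>UNIV. (if a = l then f $ l * f $ l else 0) + (if a = k then f $ k * f $ k else 0))"
    unfolding bform_def using sup lk by (intro sum.cong) auto
  then have "f $ l * f $ l + f $ k * f $ k = 0" using ff by (simp add: sum.distrib)
  then have "(f $ l / f $ k)\<^sup>2 = \<i>\<^sup>2"
    using k by (simp add: power2_eq_square field_simps eq_neg_iff_add_eq_0)
  then have "f $ l / f $ k \<in> {\<i>, - \<i>}" unfolding power2_eq_iff by blast
  then show thesis using that[OF lk l k feq] by blast
qed

text \<open>Up to the middle dimension the subspaces are totally isotropic. A new vector can be
  chosen to vanish at all earlier k, and isotropy then makes it vanish at all earlier l. The
  hypothesis \<open>H\<close> puts a vector with zero coordinates at the earlier k into the previous
  subspace, so that vector is zero and \<open>support_two\<close> applies.\<close>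

lemma isotropic_flag_structure:
  fixes F :: "'n::{finite,linorder} flag"
  assumes F: "F \<in> flags" and iso: "isotropic F"
    and H: "\<And>i j f u x. \<lbrakk>i \<le> CARD('n); f \<in> F i; u \<in> F (CARD('n) - i); j < CARD('n); x \<in> F (Suc j)\<rbrakk> \<Longrightarrow>
        strict_upper (\<chi> a b. f $ a * u $ b - u $ a * f $ b) *v x \<in> F j"
    and "i \<le> CARD('n) div 2"
  shows "\<exists>ss ks ls. length ss = i \<and> length ks = i \<and> length ls = i \<and> set ss \<subseteq> {\<i>, - \<i>} \<and> distinct (ks @ ls)
    \<and> (\<forall>a<i. ls ! a < ks ! a) \<and> (\<forall>j\<le>i. F j = flag_of (sign_vectors ss ks ls) j)"
  using \<open>i \<le> CARD('n) div 2\<close>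
proof (induction i)
  case 0
  then show ?case by (auto simp: flag_of_def flag_0[OF F])
next
  case (Suc i)
  then obtain ss ks ls where len: "length ss = i" "length ks = i" "length ls = i"
    and ss: "set ss \<subseteq> {\<i>, - \<i>}" and dist: "distinct (ks @ ls)" and lt: "\<forall>a<i. ls ! a < ks ! a"
    and Fj: "\<forall>j\<le>i. F j = flag_of (sign_vectors ss ks ls) j" by auto
  let ?g = "sign_vectors ss ks ls"
  have i: "i < CARD('n)" "Suc i \<le> CARD('n) - Suc i" using Suc.prems by auto
  have Fi: "F i = vec.span (set ?g)" using Fj len by (simp add: flag_of_def)
  have perp: "perp (F (Suc i)) = F (CARD('n) - Suc i)" using isotropic_iff_perp[OF F] iso i by auto
  have perp0: "bform v w = 0" if "v \<in> F (Suc i)" "w \<in> F (Suc i)" for v w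
    using that perp flag_mono[OF F i(2)] by (auto simp: perp_def)
  obtain f0 where f0: "f0 \<in> F (Suc i)" "f0 \<notin> F i"
  proof -
    have "\<not> F (Suc i) \<subseteq> F i"
      using vec.dim_subset[of "F (Suc i)" "F i"] i by (auto simp: flag_dim[OF F])
    then show thesis using that by blast
  qed
  \<comment> \<open>The combination of earlier sign vectors with the same coordinates at
    \<open>ks\<close> as \<open>f0\<close>; subtracting it clears these coordinates.\<close>
  define p where "p = (\<Sum>a<i. f0 $ (ks ! a) *s ?g ! a)"
  define f where "f = f0 - p"
  have gF: "?g ! a \<in> F i" if "a < i" for a using that len unfolding Fi by (auto intro!: vec.span_base nth_mem)
  have pF: "p \<in> F i" unfolding p_def
    by (intro vec.subspace_sum[OF flag_subspace[OF F]] vec.subspace_scale[OF flag_subspace[OF F]] gF) auto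
  have sub: "F i \<subseteq> F (Suc i)" using flag_mono[OF F] by auto
  have fF: "f \<in> F (Suc i)" using f0 pF sub vec.subspace_diff[OF flag_subspace[OF F]] unfolding f_def by blast
  have fn: "f \<notin> F i"
  proof
    assume "f \<in> F i"
    then have "f + p \<in> F i" using pF vec.subspace_add[OF flag_subspace[OF F]] by blast
    then show False using f0 by (simp add: f_def)
  qed
  have fk: "f $ (ks ! b) = 0" if "b < i" for b
  proof -
    have "p $ (ks ! b) = (\<Sum>a<i. f0 $ (ks ! a) * ?g ! a $ (ks ! b))"
      by (simp add: p_def)
    also have "\<dots> = (\<Sum>a<i. if a = b then f0 $ (ks ! b) else 0)"
      using nth_sign_vectors_coord[OF len dist _ that] by (intro sum.cong) auto
    finally have "p $ (ks ! b) = (\<Sum>a<i. if a = b then f0 $ (ks ! b) else 0)" .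
    then show ?thesis using that by (simp add: f_def)
  qed
  have fl: "f $ (ls ! b) = 0" if b: "b < i" for b
  proof -
    \<comment> \<open>Orthogonality to the b-th sign vector reads s f_l + f_k = 0, and f_k is
      already zero.\<close>
    have "0 = bform (?g ! b) f" using perp0 gF[OF b] sub fF by auto
    also have "\<dots> = ss ! b * f $ (ls ! b)"
      using fk[OF b] len b by (simp add: nth_sign_vectors bform_add bform_scale bform_e)
    finally have "ss ! b * f $ (ls ! b) = 0" by simp
    moreover have "ss ! b \<in> {\<i>, - \<i>}" using ss b len nth_mem[of b ss] by blast
    ultimately show ?thesis by auto
  qed
  have fsupp: "f $ a = 0" if "a \<in> set ks \<union> set ls" for a
    using that fk fl len by (auto simp: in_set_conv_nth)
  have span: "F (Suc i) = vec.span (insert f (set ?g))"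
  proof -
    have "F (Suc i) = vec.span (insert f (vec.span (set ?g)))" using span_insert_flag[OF F i(1) fF fn] Fi by simp
    then show ?thesis by (simp add: vec.span_insert vec.span_span)
  qed
  obtain l k s where lk: "l < k" "f $ l \<noteq> 0" "f $ k \<noteq> 0" "f = f $ k *s (s *s e l + e k)" "s \<in> {\<i>, - \<i>}"
  proof (rule support_two[of f])
    show "f \<noteq> 0" using fn vec.subspace_0[OF flag_subspace[OF F]] by blast
    show "bform f f = 0" using perp0 fF by blast
    fix u l k a assume lk: "f $ l \<noteq> 0" "f $ k \<noteq> 0" and u: "u = f $ l *s e k - f $ k *s e l"
    have usupp: "u $ a = 0" if "a \<in> set ks \<union> set ls" for a
      using fsupp[OF that] lk by (auto simp: u e_nth)
    \<comment> \<open>\<open>u\<close> is orthogonal to \<open>f\<close> by its choice and to the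
      earlier sign vectors by its support, so it lies in the complement required by
      \<open>H\<close>.\<close>
    have "F (Suc i) \<subseteq> {v. bform v u = 0}"
      unfolding span
    proof (rule vec.span_minimal)
      have "bform (?g ! b) u = 0" if "b < i" for b
        using usupp[of "ks ! b"] usupp[of "ls ! b"] that len by (simp add: nth_sign_vectors bform_add bform_scale bform_e)
      moreover have "bform f u = 0" by (simp add: u bform_diff bform_scale bform_e)
      ultimately show "insert f (set ?g) \<subseteq> {v. bform v u = 0}" using len by (auto simp: in_set_conv_nth)
      show "vec.subspace {v. bform v u = 0}" by (auto simp: vec.subspace_def bform_add bform_scale bform_0)
    qed
    then have uF: "u \<in> F (CARD('n) - Suc i)" unfolding perp[symmetric] perp_def by blast
    let ?w = "strict_upper (\<chi> a b. f $ a * u $ b - u $ a * f $ b) *v f"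
    have "?w \<in> F i" using H[OF _ fF uF i(1) fF] i by simp
    moreover have "?w $ a = 0" if "a \<in> set ks \<union> set ls" for a
      unfolding matrix_vector_mult_def strict_upper_def using fsupp[OF that] usupp[OF that]
      by (auto intro!: sum.neutral)
    then have "?w $ (ks ! a) = 0" if "a < i" for a using that len by simp
    ultimately show "?w = 0"
      using span_sign_vectors_expand[OF len dist, of ?w] unfolding Fi by simp
  qed (use that in blast)
  let ?h = "s *s e l + e k"
  have new: "l \<notin> set ks \<union> set ls" "k \<notin> set ks \<union> set ls" using fsupp lk by blast+
  have hF: "?h \<in> F (Suc i)" "?h \<notin> F i"
  proof -
    have "?h = (1 / f $ k) *s f" by (subst lk(4)) (use lk(3) in \<open>simp add: vec.scale_scale\<close>)
    then show "?h \<in> F (Suc i)" using fF vec.subspace_scale[OF flag_subspace[OF F]] by metis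
    show "?h \<notin> F i"
    proof
      assume "?h \<in> F i"
      then have "f $ k *s ?h \<in> F i" using vec.subspace_scale[OF flag_subspace[OF F]] by blast
      then show False using lk(4) fn by simp
    qed
  qed
  have "F (Suc i) = vec.span (insert ?h (set ?g))"
  proof -
    have "F (Suc i) = vec.span (insert ?h (vec.span (set ?g)))" using span_insert_flag[OF F i(1) hF] Fi by simp
    then show ?thesis by (simp add: vec.span_insert vec.span_span)
  qed
  then have "F j = flag_of (sign_vectors (ss @ [s]) (ks @ [k]) (ls @ [l])) j" if "j \<le> Suc i" for j
    using Fj that len by (cases "j = Suc i") (auto simp: sign_vectors_snoc flag_of_def)
  moreover have "\<forall>a<Suc i. (ls @ [l]) ! a < (ks @ [k]) ! a" using lt lk(1) len by (auto simp: nth_append less_Suc_eq)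
  ultimately show ?case using len ss dist new lk(1,5)
    by (intro exI[of _ "ss @ [s]"] exI[of _ "ks @ [k]"] exI[of _ "ls @ [l]"]) auto
qed

section \<open>Permutations and the rank inequalities\<close>

text \<open>The rank function behind the Bruhat order. For a permutation it is the dimension of the
  intersection of the k-th coordinate subspace with \<open>std_sub x\<close>.\<close>

definition rk :: "'a::linorder list \<Rightarrow> nat \<Rightarrow> 'a \<Rightarrow> nat" where
  "rk w k x = card {p. p < k \<and> p < length w \<and> w ! p \<le> x}"

text \<open>Non-inversions, with the diagonal p = q included: they index the free entries of a
  matrix that preserves both the standard flag and the coordinate flag.\<close>

definition ordered_pairs :: "'a::linorder list \<Rightarrow> (nat \<times> nat) set" where
  "ordered_pairs w = {(p, q). p \<le> q \<and> q < length w \<and> w ! p \<le> w ! q}"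

lemma finite_ordered_pairs: "finite (ordered_pairs w)"
  by (rule finite_subset[of _ "{..<length w} \<times> {..<length w}"]) (auto simp: ordered_pairs_def)

text \<open>Transposing the two positions sends ordered pairs of the new list to ordered pairs of
  \<open>v\<close>. Pairs whose positions would come out in the wrong order are left in place. The
  resulting injection misses \<open>(a, b)\<close>.\<close>

lemma card_ordered_pairs_swap:
  fixes v :: "'a::linorder list"
  assumes ab: "a < b" "b < length v" "v ! a < v ! b"
  shows "card (ordered_pairs (v[a := v ! b, b := v ! a])) < card (ordered_pairs v)"
proof -
  define v' where "v' = v[a := v ! b, b := v ! a]"
  define \<tau> where "\<tau> p = (if p = a then b else if p = b then a else p)" for p
  have \<tau>\<tau>: "\<tau> (\<tau> p) = p" for p by (auto simp: \<tau>_def)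
  have v': "v' ! p = v ! \<tau> p" if "p < length v" for p
    using that ab by (auto simp: v'_def \<tau>_def nth_list_update)
  have len: "length v' = length v" by (simp add: v'_def)
  have \<tau>len: "\<tau> p < length v" if "p < length v" for p using that ab by (auto simp: \<tau>_def)
  define h where "h = (\<lambda>(p, q). if \<tau> p \<le> \<tau> q then (\<tau> p, \<tau> q) else (p, q))"
  have "h ` ordered_pairs v' \<subseteq> ordered_pairs v - {(a, b)}"
  proof
    fix z assume "z \<in> h ` ordered_pairs v'"
    then obtain p q where pq: "p \<le> q" "q < length v" "v ! \<tau> p \<le> v ! \<tau> q" and z: "z = h (p, q)"
      by (auto simp: ordered_pairs_def len v')
    show "z \<in> ordered_pairs v - {(a, b)}"
    proof (cases "\<tau> p \<le> \<tau> q")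
      case True
      moreover have "(\<tau> p, \<tau> q) \<noteq> (a, b)"
      proof
        assume "(\<tau> p, \<tau> q) = (a, b)"
        then have "p = b" "q = a" using \<tau>\<tau>[of p] \<tau>\<tau>[of q] by (auto simp: \<tau>_def)
        then show False using pq ab by simp
      qed
      ultimately show ?thesis using pq z \<tau>len by (auto simp: h_def ordered_pairs_def)
    next
      case False
      then have zz: "z = (p, q)" by (simp add: z h_def)
      have "v ! p \<le> v ! q \<and> (p, q) \<noteq> (a, b)"
        using False pq ab unfolding \<tau>_def by (auto split: if_splits)
      then show ?thesis using pq by (simp add: zz ordered_pairs_def)
    qed
  qed
  moreover have "inj_on h (ordered_pairs v')"
  proof (rule inj_onI)
    fix x y assume xy: "x \<in> ordered_pairs v'" "y \<in> ordered_pairs v'" "h x = h y"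
    obtain p q p' q' where [simp]: "x = (p, q)" "y = (p', q')" by fastforce
    have le: "p \<le> q" "p' \<le> q'" using xy by (auto simp: ordered_pairs_def)
    have hxy: "h (p, q) = h (p', q')" using xy(3) by simp
    show "x = y"
    proof (cases "\<tau> p \<le> \<tau> q")
      case T: True
      show ?thesis
      proof (cases "\<tau> p' \<le> \<tau> q'")
        case True
        then have "\<tau> p = \<tau> p'" "\<tau> q = \<tau> q'" using hxy T by (auto simp: h_def)
        then show ?thesis by (metis \<tau>\<tau> \<open>x = (p, q)\<close> \<open>y = (p', q')\<close>)
      next
        case False
        then have "p' = \<tau> p" "q' = \<tau> q" using hxy T by (auto simp: h_def)
        then have "\<not> p \<le> q" using False \<tau>\<tau> by metis
        then show ?thesis using le by simp
      qed
    next
      case T: False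
      show ?thesis
      proof (cases "\<tau> p' \<le> \<tau> q'")
        case True
        then have "p = \<tau> p'" "q = \<tau> q'" using hxy T by (auto simp: h_def)
        then have "\<not> p' \<le> q'" using T \<tau>\<tau> by metis
        then show ?thesis using le by simp
      next
        case False
        then show ?thesis using hxy T by (auto simp: h_def)
      qed
    qed
  qed
  ultimately have "card (ordered_pairs v') \<le> card (ordered_pairs v - {(a, b)})"
    using card_inj_on_le finite_ordered_pairs by (metis finite_Diff)
  also have "\<dots> < card (ordered_pairs v)"
    using ab by (intro card_Diff1_less finite_ordered_pairs) (auto simp: ordered_pairs_def)
  finally show ?thesis by (simp add: v'_def)
qed

text \<open>If a and b lie on the same side of k, the transposition matches the counted positions.
  Otherwise only position a is counted, and its entry rises from \<open>v ! a\<close> to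
  \<open>v ! b\<close>.\<close>

lemma rk_swap:
  fixes v :: "'a::linorder list"
  assumes ab: "a < b" "b < length v" "v ! a < v ! b"
  shows "rk v k x = rk (v[a := v ! b, b := v ! a]) k x + (if a < k \<and> k \<le> b \<and> v ! a \<le> x \<and> x < v ! b then 1 else 0)"
proof -
  define v' where "v' = v[a := v ! b, b := v ! a]"
  define \<tau> where "\<tau> p = (if p = a then b else if p = b then a else p)" for p
  have v': "v' ! p = v ! \<tau> p" if "p < length v" for p
    using that ab by (auto simp: v'_def \<tau>_def nth_list_update)
  have len: "length v' = length v" by (simp add: v'_def)
  let ?S = "\<lambda>v. {p. p < k \<and> p < length v \<and> v ! p \<le> x}"
  have fin: "finite (?S v)" for v :: "'a list" by simp
  show ?thesis
  proof (cases "a < k \<and> k \<le> b")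
    case True
    have "?S v - {a} = ?S v' - {a}" using True by (auto simp: len v' \<tau>_def)
    then have "card (?S v - {a}) = card (?S v' - {a})" by simp
    moreover have "a \<in> ?S v \<longleftrightarrow> v ! a \<le> x" "a \<in> ?S v' \<longleftrightarrow> v ! b \<le> x" using True ab by (auto simp: len v' \<tau>_def)
    moreover have c: "card A = card (A - {a}) + (if P then 1 else 0)" if "finite A" "a \<in> A \<longleftrightarrow> P" for A :: "nat set" and P
      using card.remove[of A a] that by auto
    ultimately have "card (?S v) + (if v ! b \<le> x then 1 else 0) = card (?S v') + (if v ! a \<le> x then 1 else 0)"
      using c[OF fin, of v "v ! a \<le> x"] c[OF fin, of v' "v ! b \<le> x"] by linarith
    then show ?thesis using True ab unfolding rk_def v'_def[symmetric] by (auto split: if_splits)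
  next
    case False
    have "bij_betw \<tau> (?S v) (?S v')"
      using ab False by (intro bij_betwI[where g = \<tau>]) (auto simp: len v' \<tau>_def)
    then have "card (?S v) = card (?S v')" by (rule bij_betw_same_card)
    then show ?thesis using False unfolding rk_def v'_def[symmetric] by auto
  qed
qed

text \<open>
  Moving \<open>v\<close> towards \<open>w\<close> by exchanging the entry at the first place of disagreement with the next
  entry that is larger but not larger than the wanted one keeps the rank inequalities.
\<close>

lemma bruhat_step:
  fixes v w :: "'a::linorder list"
  assumes dv: "distinct v" and dw: "distinct w" and s: "set v = set w" and ne: "v \<noteq> w"
    and r: "\<And>k x. rk w k x \<le> rk v k x"
  obtains a b where "a < b" "b < length v" "v ! a < v ! b"
    "\<And>k x. rk w k x \<le> rk (v[a := v ! b, b := v ! a]) k x"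
proof -
  have len: "length v = length w" using dv dw s by (metis distinct_card)
  have ex: "\<exists>a. a < length v \<and> v ! a \<noteq> w ! a" using ne len nth_equalityI by blast
  define a where "a = (LEAST a. a < length v \<and> v ! a \<noteq> w ! a)"
  have a: "a < length v" "v ! a \<noteq> w ! a" using LeastI_ex[OF ex] by (auto simp: a_def)
  have before: "v ! p = w ! p" if "p < a" for p using not_less_Least[of p] that a unfolding a_def[symmetric]
    by (metis (mono_tags, lifting) a_def not_less_Least order.strict_trans)
  have va: "v ! a < w ! a"
  proof (rule ccontr)
    assume "\<not> ?thesis"
    then have gt: "w ! a < v ! a" using a by simp
    have "{p. p < Suc a \<and> p < length v \<and> v ! p \<le> w ! a} \<subseteq> {p. p < Suc a \<and> p < length w \<and> w ! p \<le> w ! a} - {a}"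
      using gt before len by (auto simp: less_Suc_eq)
    then have "rk v (Suc a) (w ! a) \<le> card ({p. p < Suc a \<and> p < length w \<and> w ! p \<le> w ! a} - {a})"
      unfolding rk_def by (intro card_mono) auto
    also have "\<dots> < rk w (Suc a) (w ! a)"
      unfolding rk_def using a len by (intro card_Diff1_less) auto
    finally show False using r[of "Suc a" "w ! a"] by simp
  qed
  have "w ! a \<in> set v" using a len s by simp
  then obtain c where c: "c < length v" "v ! c = w ! a" by (auto simp: in_set_conv_nth)
  have "a < c"
  proof (rule ccontr)
    assume "\<not> a < c"
    then consider "c = a" | "c < a" by linarith
    then show False
    proof cases
      case 1 then show ?thesis using c a by simp
    next
      case 2
      then have "w ! c = w ! a" using before c by simp
      then show ?thesis using 2 dw a len by (simp add: nth_eq_iff_index_eq)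
    qed
  qed
  then have ex: "\<exists>b. a < b \<and> b < length v \<and> v ! a < v ! b \<and> v ! b \<le> w ! a" using c va by auto
  define b where "b = (LEAST b. a < b \<and> b < length v \<and> v ! a < v ! b \<and> v ! b \<le> w ! a)"
  have b: "a < b" "b < length v" "v ! a < v ! b" "v ! b \<le> w ! a" using LeastI_ex[OF ex] by (auto simp: b_def)
  have mid: "\<not> (v ! a < v ! p \<and> v ! p \<le> w ! a)" if "a < p" "p < b" for p
    using not_less_Least[of p] that b(2) unfolding b_def[symmetric]
    by (metis (mono_tags, lifting) b_def not_less_Least order.strict_trans)
  have *: "rk w k x < rk v k x" if kx: "a < k" "k \<le> b" "v ! a \<le> x" "x < v ! b" for k x
  proof -
    \<comment> \<open>Both counts are compared at the level \<open>w ! a\<close>. Going from x to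
      \<open>w ! a\<close>, the count for \<open>v\<close> gains at most the positions in
      \<open>?d\<close>, by the minimality of b. The count for \<open>w\<close> gains these
      positions, which precede a, and also a itself.\<close>
    let ?d = "{p. p < a \<and> x < v ! p \<and> v ! p \<le> w ! a}"
    let ?S = "\<lambda>v x. {p. p < k \<and> p < length v \<and> v ! p \<le> x}"
    have "?S v (w ! a) \<subseteq> ?S v x \<union> ?d"
    proof
      fix p assume p: "p \<in> ?S v (w ! a)"
      show "p \<in> ?S v x \<union> ?d"
      proof (cases "v ! p \<le> x")
        case True then show ?thesis using p by simp
      next
        case False
        then have "p \<noteq> a" using kx by auto
        moreover have "\<not> a < p" using mid[of p] p kx False by auto
        ultimately show ?thesis using p False by auto
      qed
    qed
    then have "rk v k (w ! a) \<le> card (?S v x \<union> ?d)" unfolding rk_def by (intro card_mono) auto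
    also have "\<dots> \<le> rk v k x + card ?d" unfolding rk_def by (rule card_Un_le)
    finally have 1: "rk v k (w ! a) \<le> rk v k x + card ?d" .
    have "insert a (?S w x \<union> ?d) \<subseteq> ?S w (w ! a)"
      using kx b a len before by auto
    then have "card (insert a (?S w x \<union> ?d)) \<le> rk w k (w ! a)" unfolding rk_def by (intro card_mono) auto
    moreover have "card (insert a (?S w x \<union> ?d)) = Suc (rk w k x + card ?d)"
    proof -
      have "a \<notin> ?S w x \<union> ?d" using kx b by auto
      moreover have "?S w x \<inter> ?d = {}" using before by auto
      ultimately show ?thesis unfolding rk_def by (simp add: card_Un_disjoint)
    qed
    ultimately show ?thesis using 1 r[of k "w ! a"] by linarith
  qed
  have "rk w k x \<le> rk (v[a := v ! b, b := v ! a]) k x" for k x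
  proof (cases "a < k \<and> k \<le> b \<and> v ! a \<le> x \<and> x < v ! b")
    case True
    then have "rk w k x < rk v k x" using * by blast
    then show ?thesis using rk_swap[OF b(1-3), of k x] True by simp
  next
    case False
    then show ?thesis using rk_swap[OF b(1-3), of k x] r[of k x] by (simp only: if_False)
  qed
  then show thesis using that b by blast
qed

text \<open>Each \<open>bruhat_step\<close> keeps the rank inequalities and loses ordered pairs, so
  the process ends, and it can end only at \<open>w\<close>.\<close>

lemma bruhat_card_ordered_pairs:
  fixes v w :: "'a::linorder list"
  assumes "distinct v" and "distinct w" and "set v = set w" and "v \<noteq> w"
    and "\<And>k x. rk w k x \<le> rk v k x"
  shows "card (ordered_pairs w) < card (ordered_pairs v)"
  using assms
proof (induction "card (ordered_pairs v)" arbitrary: v rule: less_induct)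
  case less
  obtain a b where ab: "a < b" "b < length v" "v ! a < v ! b"
    "\<And>k x. rk w k x \<le> rk (v[a := v ! b, b := v ! a]) k x"
    using bruhat_step[OF less.prems] by blast
  let ?v = "v[a := v ! b, b := v ! a]"
  have lt: "card (ordered_pairs ?v) < card (ordered_pairs v)" by (rule card_ordered_pairs_swap[OF ab(1-3)])
  show ?case
  proof (cases "?v = w")
    case True then show ?thesis using lt by simp
  next
    case False
    have "distinct ?v" "set ?v = set w"
      using ab less.prems by (auto simp: distinct_swap set_swap)
    then have "card (ordered_pairs w) < card (ordered_pairs ?v)"
      using less.hyps[OF lt _ less.prems(2) _ False ab(4)] by blast
    then show ?thesis using lt by simp
  qed
qed

section \<open>Coordinate flags and their relative position to the standard flag\<close>

lemma dim_matrix_pattern: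
  fixes S :: "('n::finite \<times> 'n) set"
  shows "dim {A :: complex ^ 'n ^ 'n. \<forall>i j. (i, j) \<notin> S \<longrightarrow> A $ i $ j = 0} = 2 * card S"
proof -
  let ?b = "\<lambda>((i, j), c). axis i (axis j c) :: complex ^ 'n ^ 'n"
  let ?d = "?b ` (S \<times> Basis)"
  have ax: "axis i (axis j c) = (axis i' (axis j' c') :: complex ^ 'n ^ 'n) \<longleftrightarrow> i = i' \<and> j = j' \<and> c = c'"
    if "c \<noteq> 0" "c' \<noteq> 0" for i j c i' j' c'
    using that by (auto simp: axis_eq_axis)
  have inj: "inj_on ?b (S \<times> Basis)"
    by (auto intro!: inj_onI simp: ax nonzero_Basis)
  have mem: "?b ((i, j), c) \<in> ?d \<longleftrightarrow> (i, j) \<in> S" if "c \<in> Basis" for i j c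
  proof
    assume "?b ((i, j), c) \<in> ?d"
    then obtain i' j' c' where "(i', j') \<in> S" "c' \<in> Basis" "axis i (axis j c) = (axis i' (axis j' c') :: complex ^ 'n ^ 'n)" by auto
    then show "(i, j) \<in> S" using that nonzero_Basis ax by metis
  qed (use that in force)
  have sub: "?d \<subseteq> Basis" by (auto simp: axis_in_Basis_iff)
  have "dim {A :: complex ^ 'n ^ 'n. \<forall>z\<in>Basis. z \<notin> ?d \<longrightarrow> A \<bullet> z = 0} = card ?d"
    by (rule dim_substandard[OF sub])
  moreover have "{A :: complex ^ 'n ^ 'n. \<forall>z\<in>Basis. z \<notin> ?d \<longrightarrow> A \<bullet> z = 0} = {A. \<forall>i j. (i, j) \<notin> S \<longrightarrow> A $ i $ j = 0}"
  proof (intro Collect_cong iffI allI ballI impI)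
    fix A :: "complex ^ 'n ^ 'n" and i j
    assume *: "\<forall>z\<in>Basis. z \<notin> ?d \<longrightarrow> A \<bullet> z = 0" "(i, j) \<notin> S"
    have "A $ i $ j \<bullet> c = 0" if c: "c \<in> Basis" for c
    proof -
      have "axis i (axis j c) \<in> (Basis :: (complex ^ 'n ^ 'n) set)" using c by (simp add: axis_in_Basis_iff)
      moreover have "axis i (axis j c) \<notin> ?d" using mem[OF c, of i j] *(2) by simp
      ultimately have "A \<bullet> axis i (axis j c) = 0" using *(1) by blast
      then show ?thesis by (simp add: inner_axis)
    qed
    then show "A $ i $ j = 0" by (metis euclidean_all_zero_iff)
  next
    fix A z :: "complex ^ 'n ^ 'n"
    assume *: "\<forall>i j. (i, j) \<notin> S \<longrightarrow> A $ i $ j = 0" "z \<in> Basis" "z \<notin> ?d"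
    obtain i j c where z: "z = axis i (axis j c)" "c \<in> Basis" using *(2) by (auto simp: Basis_vec_def)
    then have "(i, j) \<notin> S" using *(3) mem by auto
    then show "A \<bullet> z = 0" using * z by (simp add: inner_axis)
  qed
  moreover have "card ?d = card S * 2"
    using card_image[OF inj] by (simp add: card_cartesian_product)
  ultimately show ?thesis by (simp add: mult.commute)
qed

lemma span_e: "vec.span (e ` S) = {v. \<forall>i. i \<notin> S \<longrightarrow> v $ i = 0}" for S :: "'n::finite set"
proof
  show "vec.span (e ` S) \<subseteq> {v. \<forall>i. i \<notin> S \<longrightarrow> v $ i = 0}"
    by (rule vec.span_minimal) (auto simp: e_nth vec.subspace_def)
  show "{v. \<forall>i. i \<notin> S \<longrightarrow> v $ i = 0} \<subseteq> vec.span (e ` S)"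
  proof
    fix v :: "complex ^ 'n" assume v: "v \<in> {v. \<forall>i. i \<notin> S \<longrightarrow> v $ i = 0}"
    have "v = (\<Sum>i\<in>S. v $ i *s e i)"
      using v by (simp add: vec_eq_iff e_nth if_distrib[of "\<lambda>x. _ * x"] cong: if_cong)
    also have "\<dots> \<in> vec.span (e ` S)"
      by (intro vec.span_sum vec.span_scale vec.span_base) auto
    finally show "v \<in> vec.span (e ` S)" .
  qed
qed

lemma coord_flag_eq: "coord_flag w k = {v. \<forall>i. i \<notin> set (take k w) \<longrightarrow> v $ i = 0}"
  unfolding coord_flag_def flag_of_def by (simp add: take_map span_e)

lemma take_set_nth: "set (take k w) = (!) w ` {p. p < k \<and> p < length w}"
proof -
  have "take (min k (length w)) w = take k w" by (simp add: min_def)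
  moreover have "{p. p < k \<and> p < length w} = {0..<min k (length w)}" by auto
  ultimately show ?thesis using nth_image[of "min k (length w)" w] by simp
qed

lemma dim_coord_flag_Int_std_sub:
  fixes w :: "'n::{finite,linorder} list"
  assumes "distinct w"
  shows "vec.dim (coord_flag w k \<inter> std_sub x) = rk w k x"
proof -
  have "coord_flag w k \<inter> std_sub x = {v. \<forall>i. i \<notin> (!) w ` {p. p < k \<and> p < length w \<and> w ! p \<le> x} \<longrightarrow> v $ i = 0}"
    unfolding coord_flag_eq std_sub_def take_set_nth by (auto simp: image_iff not_le) (metis not_le)+
  also have "vec.dim \<dots> = card ((!) w ` {p. p < k \<and> p < length w \<and> w ! p \<le> x})" by (rule dim_substandard_cart)
  also have "\<dots> = rk w k x" unfolding rk_def
    using assms by (intro card_image) (auto simp: inj_on_def nth_eq_iff_index_eq)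
  finally show ?thesis .
qed

lemma coord_flag_flags:
  fixes w :: "'n::finite list"
  assumes "distinct w" "set w = UNIV"
  shows "coord_flag w \<in> flags"
proof -
  have len: "length w = CARD('n)" using assms by (metis distinct_card)
  have "vec.dim (coord_flag w k) = min k CARD('n)" for k
    unfolding coord_flag_eq dim_substandard_cart using assms len by (simp add: distinct_card)
  moreover have "vec.subspace (coord_flag w k)" for k
    unfolding coord_flag_def flag_of_def by simp
  moreover have "mono (coord_flag w)"
    unfolding coord_flag_def flag_of_def
    by (intro monoI vec.span_mono set_take_subset_set_take)
  ultimately show ?thesis by (simp add: flags_def)
qed

lemma pres_coord_flag:
  fixes w :: "'n::finite list"
  assumes "distinct w" "set w = UNIV"
  shows "A \<in> pres (range (coord_flag w)) \<longleftrightarrow> (\<forall>p q. q < p \<and> p < length w \<longrightarrow> A $ (w ! p) $ (w ! q) = 0)"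
proof
  assume A: "A \<in> pres (range (coord_flag w))"
  show "\<forall>p q. q < p \<and> p < length w \<longrightarrow> A $ (w ! p) $ (w ! q) = 0"
  proof (intro allI impI)
    fix p q assume pq: "q < p \<and> p < length w"
    have "e (w ! q) \<in> coord_flag w (Suc q)" using pq by (auto simp: coord_flag_eq e_nth take_set_nth)
    then have "A *v e (w ! q) \<in> coord_flag w (Suc q)" using A by (auto simp: pres_def)
    moreover have "w ! p \<notin> set (take (Suc q) w)"
      using pq assms(1) by (auto simp: take_set_nth nth_eq_iff_index_eq)
    ultimately have "(A *v e (w ! q)) $ (w ! p) = 0" by (simp add: coord_flag_eq)
    then show "A $ (w ! p) $ (w ! q) = 0"
      by (simp add: matrix_vector_mult_def e_nth if_distrib[of "\<lambda>x. _ * x"] cong: if_cong)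
  qed
next
  assume A: "\<forall>p q. q < p \<and> p < length w \<longrightarrow> A $ (w ! p) $ (w ! q) = 0"
  have "A *v v \<in> coord_flag w k" if v: "v \<in> coord_flag w k" for k v
  proof -
    have "(A *v v) $ i = 0" if i: "i \<notin> set (take k w)" for i
    proof -
      have "A $ i $ j * v $ j = 0" for j
      proof (cases "j \<in> set (take k w)")
        case False then show ?thesis using v by (simp add: coord_flag_eq)
      next
        case True
        obtain p where p: "p < length w" "w ! p = i" using assms(2) by (metis UNIV_I in_set_conv_nth)
        obtain q where q: "q < k" "q < length w" "w ! q = j" using True by (auto simp: take_set_nth)
        have "k \<le> p" using i p by (force simp: take_set_nth)
        then show ?thesis using A p q by auto
      qed
      then show ?thesis unfolding matrix_vector_mult_def vec_lambda_beta by (intro sum.neutral ballI)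
    qed
    then show ?thesis by (simp add: coord_flag_eq)
  qed
  then show "A \<in> pres (range (coord_flag w))" by (auto simp: pres_def)
qed

text \<open>The entry at \<open>(w ! p, w ! q)\<close> is free exactly when both flags allow it:
  \<open>w ! p \<le> w ! q\<close> for the standard flag and \<open>p \<le> q\<close> for the
  coordinate flag. The factor 2 is the real dimension of one complex entry.\<close>

lemma dim_pres_coord_flag:
  fixes w :: "'n::{finite,linorder} list"
  assumes w: "distinct w" "set w = UNIV"
  shows "dim (pres (range std_sub \<union> range (coord_flag w))) = 2 * card (ordered_pairs w)"
proof -
  let ?f = "\<lambda>(p, q). (w ! p, w ! q)"
  have inj: "inj_on ?f (ordered_pairs w)"
    using w(1) by (auto simp: inj_on_def ordered_pairs_def nth_eq_iff_index_eq)
  have "A \<in> pres (range std_sub \<union> range (coord_flag w)) \<longleftrightarrow> (\<forall>i j. (i, j) \<notin> ?f ` ordered_pairs w \<longrightarrow> A $ i $ j = 0)" for A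
  proof -
    have "(\<forall>i j. j < i \<longrightarrow> A $ i $ j = 0) \<and> (\<forall>p q. q < p \<and> p < length w \<longrightarrow> A $ (w ! p) $ (w ! q) = 0)
      \<longleftrightarrow> (\<forall>i j. (i, j) \<notin> ?f ` ordered_pairs w \<longrightarrow> A $ i $ j = 0)" (is "?L \<longleftrightarrow> ?R")
    proof
      assume L: ?L
      show ?R
      proof (intro allI impI)
        fix i j assume ij: "(i, j) \<notin> ?f ` ordered_pairs w"
        obtain p where p: "p < length w" "w ! p = i" using w(2) by (metis UNIV_I in_set_conv_nth)
        obtain q where q: "q < length w" "w ! q = j" using w(2) by (metis UNIV_I in_set_conv_nth)
        have "\<not> (p \<le> q \<and> i \<le> j)" using ij p q by (force simp: ordered_pairs_def)
        then consider "q < p" | "j < i" by (meson not_le)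
        then show "A $ i $ j = 0" using L p q by cases auto
      qed
    next
      assume R: ?R
      show ?L
      proof (intro conjI allI impI)
        fix i j :: 'n assume "j < i"
        then have "(i, j) \<notin> ?f ` ordered_pairs w" by (auto simp: ordered_pairs_def)
        then show "A $ i $ j = 0" using R by blast
      next
        fix p q assume pq: "q < p \<and> p < length w"
        then have "(w ! p, w ! q) \<notin> ?f ` ordered_pairs w"
          using w(1) by (auto simp: ordered_pairs_def nth_eq_iff_index_eq)
        then show "A $ (w ! p) $ (w ! q) = 0" using R by blast
      qed
    qed
    then show ?thesis unfolding pres_Un using pres_coord_flag[OF w, of A] by (simp add: upper_triangular_pres)
  qed
  then have "pres (range std_sub \<union> range (coord_flag w)) = {A. \<forall>i j. (i, j) \<notin> ?f ` ordered_pairs w \<longrightarrow> A $ i $ j = 0}"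
    by blast
  then show ?thesis by (simp only: dim_matrix_pattern card_image[OF inj])
qed

section \<open>Schubert varieties\<close>

lemma vec_subspace_imp_subspace:
  fixes K :: "(complex ^ 'n::finite) set"
  assumes "vec.subspace K"
  shows "subspace K"
proof (rule subspaceI)
  show "c *\<^sub>R x \<in> K" if "x \<in> K" for c x
  proof -
    have "c *\<^sub>R x = of_real c *s x" by (simp add: vec_eq_iff scaleR_conv_of_real[where 'a = complex])
    then show ?thesis using vec.subspace_scale[OF assms that] by metis
  qed
qed (use assms in \<open>auto simp: vec.subspace_0 vec.subspace_add\<close>)

text \<open>The real orthogonal complement of a complex subspace is again complex: a scalar moves to
  the other argument of \<open>inner\<close> as its conjugate, and \<open>K\<close> absorbs
  it.\<close>

lemma orthogonal_complement_in:
  fixes K W :: "(complex ^ 'n::finite) set"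
  assumes K: "vec.subspace K" and W: "vec.subspace W" and KW: "K \<subseteq> W"
  obtains W' where "vec.subspace W'" "W' \<subseteq> W" "W' \<inter> K = {0}" "vec.dim W \<le> vec.dim W' + vec.dim K"
proof -
  define W' where "W' = {v \<in> W. \<forall>y\<in>K. inner v y = 0}"
  have Kc: "c *s y \<in> K" if "y \<in> K" for c y using vec.subspace_scale[OF K that] .
  note sK = vec_subspace_imp_subspace[OF K]
  have sub: "vec.subspace W'"
  proof (rule vec.subspaceI)
    show "0 \<in> W'" using vec.subspace_0[OF W] by (simp add: W'_def)
    show "x + y \<in> W'" if "x \<in> W'" "y \<in> W'" for x y
      using that vec.subspace_add[OF W] by (simp add: W'_def inner_add_left)
    show "c *s x \<in> W'" if x: "x \<in> W'" for c x
    proof -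
      have "inner (c *s x) y = 0" if "y \<in> K" for y
      proof -
        have "inner (c *s x) y = inner x (cnj c *s y)"
          by (simp add: inner_vec_def inner_complex_def algebra_simps)
        then show ?thesis using x Kc[OF that] by (simp add: W'_def)
      qed
      then show ?thesis using x vec.subspace_scale[OF W] by (simp add: W'_def)
    qed
  qed
  have zero: "W' \<inter> K = {0}"
    using vec.subspace_0[OF sub] vec.subspace_0[OF K] by (auto simp: W'_def)
  have "W \<subseteq> {x + y |x y. x \<in> W' \<and> y \<in> K}"
  proof
    fix v assume v: "v \<in> W"
    obtain y z where yz: "y \<in> span K" "\<And>w. w \<in> span K \<Longrightarrow> orthogonal z w" "v = y + z"
      by (rule orthogonal_subspace_decomp_exists[of K v]) (rule that; simp)
    have y: "y \<in> K" using yz(1) sK by (metis span_eq_iff)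
    then have "z \<in> W" using v yz(3) KW vec.subspace_diff[OF W, of v y] by auto
    then have "z \<in> W'" using yz(2) by (auto simp: W'_def orthogonal_def span_base)
    then show "v \<in> {x + y |x y. x \<in> W' \<and> y \<in> K}" using y yz(3) add.commute[of y z] by blast
  qed
  then have "vec.dim W \<le> vec.dim {x + y |x y. x \<in> W' \<and> y \<in> K}" by (rule vec.dim_subset)
  also have "\<dots> = vec.dim W' + vec.dim K"
    using vec.dim_sums_Int[OF sub K] zero by simp
  finally show thesis using that[OF sub _ zero] by (auto simp: W'_def)
qed

lemma norm_matrix_vector_mult_le:
  fixes M :: "complex ^ 'n ^ 'n::finite"
  shows "norm (M *v v) \<le> real (CARD('n) * CARD('n)) * norm M * norm v"
proof -
  have "norm (M *v v) \<le> (\<Sum>i\<in>UNIV. norm ((M *v v) $ i))" 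
    unfolding norm_vec_def by (rule L2_set_le_sum) simp
  also have "\<dots> \<le> (\<Sum>i\<in>(UNIV :: 'n set). \<Sum>j\<in>(UNIV :: 'n set). norm M * norm v)"
  proof (intro sum_mono)
    fix i :: 'n
    have "norm ((M *v v) $ i) \<le> (\<Sum>j\<in>UNIV. norm (M $ i $ j * v $ j))"
      unfolding matrix_vector_mult_def vec_lambda_beta by (rule norm_sum)
    also have "\<dots> \<le> (\<Sum>j\<in>(UNIV :: 'n set). norm M * norm v)"
    proof (intro sum_mono)
      fix j :: 'n
      have "norm (M $ i $ j) \<le> norm M"
        using Finite_Cartesian_Product.norm_nth_le[of "M $ i" j] Finite_Cartesian_Product.norm_nth_le[of M i] by linarith
      then show "norm (M $ i $ j * v $ j) \<le> norm M * norm v"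
        unfolding norm_mult by (intro mult_mono Finite_Cartesian_Product.norm_nth_le) auto
    qed
    finally show "norm ((M *v v) $ i) \<le> (\<Sum>j\<in>(UNIV :: 'n set). norm M * norm v)" .
  qed
  finally show ?thesis by simp
qed

text \<open>On a complement of the kernel of a linear map the map is bounded below. Nearby maps
  remain injective there, so their kernels cannot be larger.\<close>

lemma dim_Int_std_sub_upper_semicontinuous:
  fixes A :: "complex ^ ('n::{finite,linorder}) ^ ('n::{finite,linorder})"
  assumes A: "A \<in> SL" and W: "vec.subspace W" and lt: "vec.dim ((*v) A ` W \<inter> std_sub x) < r"
  shows "\<exists>\<epsilon>>0. \<forall>A'\<in>SL. dist A' A < \<epsilon> \<longrightarrow> vec.dim ((*v) A' ` W \<inter> std_sub x) < r"
proof -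
  let ?K = "\<lambda>A. {v \<in> W. A *v v \<in> std_sub x}"
  have sK: "vec.subspace (?K A)" for A :: "complex ^ ('n::{finite,linorder}) ^ ('n::{finite,linorder})"
    using W subspace_std_sub[of x] by (auto simp: vec.subspace_def matrix_vector_right_distrib vec.scale)
  have dK: "vec.dim ((*v) A ` W \<inter> std_sub x) = vec.dim (?K A)" if "A \<in> SL" for A
  proof -
    have "(*v) A ` W \<inter> std_sub x = (*v) A ` ?K A" by auto
    then show ?thesis using vec_dim_image[OF SL_invertible[OF that]] by simp
  qed
  obtain W' where W': "vec.subspace W'" "W' \<subseteq> W" "W' \<inter> ?K A = {0}" "vec.dim W \<le> vec.dim W' + vec.dim (?K A)"
    by (rule orthogonal_complement_in[OF sK W, of A]) auto
  \<comment> \<open>Forgets the coordinates up to x, so that its kernel is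
    \<open>std_sub x\<close>.\<close>
  define P where "P v = (\<chi> i. if i \<le> x then 0 else v $ i)" for v :: "complex ^ ('n::{finite,linorder})"
  have P0: "P v = 0 \<longleftrightarrow> v \<in> std_sub x" for v
    by (auto simp: P_def std_sub_def vec_eq_iff not_le)
  have Pdiff: "P (v - u) = P v - P u" for v u by (simp add: P_def vec_eq_iff)
  have Pn: "norm (P v) \<le> norm v" for v
    unfolding norm_vec_def by (intro L2_set_mono) (auto simp: P_def)
  have lin: "linear (\<lambda>v. P (A *v v))"
    by (intro linearI) (auto simp: P_def vec_eq_iff matrix_vector_mult_def scaleR_sum_right distrib_left sum.distrib)
  note sW' = vec_subspace_imp_subspace[OF W'(1)]
  have "\<exists>e>0. \<forall>v\<in>W'. norm (P (A *v v)) \<ge> e * norm v"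
  proof (rule injective_imp_isometric)
    show "closed W'" by (rule closed_subspace[OF sW'])
    show "subspace W'" by (rule sW')
    show "bounded_linear (\<lambda>v. P (A *v v))" using lin by (simp add: linear_conv_bounded_linear)
    show "\<forall>v\<in>W'. P (A *v v) = 0 \<longrightarrow> v = 0" using W' by (auto simp: P0)
  qed
  then obtain e where e: "e > 0" "\<And>v. v \<in> W' \<Longrightarrow> norm (P (A *v v)) \<ge> e * norm v" by blast
  define N where "N = real (CARD('n) * CARD('n))"
  have N: "N > 0" by (simp add: N_def)
  \<comment> \<open>The radius \<open>e / N\<close> makes the perturbation smaller than the lower
    bound \<open>e\<close> on \<open>W'\<close>; \<open>N\<close> is the constant of
    \<open>norm_matrix_vector_mult_le\<close>.\<close>
  have "vec.dim ((*v) A' ` W \<inter> std_sub x) < r" if A': "A' \<in> SL" "dist A' A < e / N" for A'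
  proof -
    have "v = 0" if v: "v \<in> W'" "v \<in> ?K A'" for v
    proof (rule ccontr)
      assume v0: "v \<noteq> 0"
      have "P (A' *v v) = 0" using v by (simp add: P0)
      then have "P (A *v v) = - P ((A' - A) *v v)"
        by (simp add: matrix_vector_mult_diff_rdistrib Pdiff)
      then have "e * norm v \<le> norm (P ((A' - A) *v v))" using e(2)[OF v(1)] by simp
      also have "\<dots> \<le> norm ((A' - A) *v v)" by (rule Pn)
      also have "\<dots> \<le> N * norm (A' - A) * norm v" unfolding N_def by (rule norm_matrix_vector_mult_le)
      also have "\<dots> < e * norm v"
        using A'(2) N v0 by (intro mult_strict_right_mono) (auto simp: dist_norm field_simps)
      finally show False by simp
    qed
    then have "W' \<inter> ?K A' = {0}" using vec.subspace_0[OF W'(1)] vec.subspace_0[OF sK, of A'] by blast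
    then have "vec.dim W' + vec.dim (?K A') = vec.dim {x + y |x y. x \<in> W' \<and> y \<in> ?K A'}"
      using vec.dim_sums_Int[OF W'(1) sK, of A'] by simp
    also have "\<dots> \<le> vec.dim W"
      using W'(2) vec.subspace_add[OF W] by (intro vec.dim_subset) blast
    finally have "vec.dim (?K A') \<le> vec.dim (?K A)" using W'(4) by linarith
    then show ?thesis using lt dK[OF A] dK[OF A'(1)] by linarith
  qed
  moreover have "e / N > 0" using e(1) N by simp
  ultimately show ?thesis by blast
qed

lemma act_flags:
  fixes F :: "'n::finite flag"
  assumes "invertible A" "F \<in> flags"
  shows "act A F \<in> flags"
  using assms unfolding flags_def act_def
  by (auto simp: vec_dim_image vec_subspace_image monotone_def) (metis imageI in_mono)

lemma std_flag_flags: "(std_flag :: 'n::{finite,linorder} flag) \<in> flags"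
  unfolding std_flag_def by (rule coord_flag_flags) auto

lemma topspace_flag_topology: "topspace (flag_topology :: 'n::{finite,linorder} flag topology) = flags"
proof
  show "topspace (flag_topology :: 'n flag topology) \<subseteq> flags"
    using openin_topspace openin_flag_topology by blast
  have "{A \<in> SL. act A std_flag \<in> (flags :: 'n flag set)} = SL"
    using act_flags[OF SL_invertible std_flag_flags] by blast
  then have "openin flag_topology (flags :: 'n flag set)" by (simp add: openin_flag_topology)
  then show "(flags :: 'n flag set) \<subseteq> topspace flag_topology" by (rule openin_subset)
qed

lemma orbit_Borel_flags:
  fixes w :: "'n::{finite,linorder} list"
  assumes "distinct w" "set w = UNIV"
  shows "orbit Borel (coord_flag w) \<subseteq> flags"
  using act_flags[OF SL_invertible coord_flag_flags[OF assms]] by (auto simp: orbit_def Borel_eq)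

lemma orbit_subset_schubert:
  fixes w :: "'n::{finite,linorder} list"
  assumes "distinct w" "set w = UNIV"
  shows "orbit Borel (coord_flag w) \<subseteq> schubert w"
  unfolding schubert_def using orbit_Borel_flags[OF assms]
  by (intro closure_of_subset) (simp add: topspace_flag_topology)

lemma Borel_image_std_sub:
  assumes "A \<in> Borel"
  shows "(*v) A ` std_sub x = std_sub x"
proof (rule invertible_image_eq[OF SL_invertible subspace_std_sub])
  show "A \<in> SL" "(*v) A ` std_sub x \<subseteq> std_sub x" using assms by (auto simp: Borel_eq pres_def)
qed

lemma dim_Borel_act_Int_std_sub:
  fixes F :: "'n::{finite,linorder} flag"
  assumes A: "A \<in> Borel"
  shows "vec.dim (act A F k \<inter> std_sub x) = vec.dim (F k \<inter> std_sub x)"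
proof -
  have inv: "invertible A" using A by (simp add: Borel_eq SL_invertible)
  have "act A F k \<inter> std_sub x = (*v) A ` F k \<inter> (*v) A ` std_sub x"
    using Borel_image_std_sub[OF A] by (simp add: act_def)
  also have "\<dots> = (*v) A ` (F k \<inter> std_sub x)"
    using inj_invertible[OF inv] by (simp add: image_Int)
  finally show ?thesis using vec_dim_image[OF inv] by simp
qed

lemma dim_pres_Borel_act:
  fixes F :: "'n::{finite,linorder} flag"
  assumes A: "A \<in> Borel"
  shows "dim (pres (range std_sub \<union> range (act A F))) = dim (pres (range std_sub \<union> range F))"
proof -
  have inv: "invertible A" using A by (simp add: Borel_eq SL_invertible)
  have "(`) ((*v) A) ` (range std_sub \<union> range F) = range std_sub \<union> range (act A F)"
    unfolding image_Un act_range[symmetric] using Borel_image_std_sub[OF A] by (auto simp: image_image)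
  then show ?thesis using dim_pres_image[OF inv, of "range std_sub \<union> range F"] by simp
qed

text \<open>The dimensions are constant on the Borel orbit, with values given by \<open>rk\<close>.
  Flags with a smaller dimension form an open set, which would have to meet the orbit if it
  contained a point of the closure.\<close>

lemma schubert_rk_le:
  fixes w :: "'n::{finite,linorder} list"
  assumes w: "distinct w" "set w = UNIV" and F: "F \<in> schubert w"
  shows "F \<in> flags" "rk w k x \<le> vec.dim (F k \<inter> std_sub x)"
proof -
  show fl: "F \<in> flags" using F closure_of_subset_topspace[of flag_topology] by (auto simp: schubert_def topspace_flag_topology)
  show "rk w k x \<le> vec.dim (F k \<inter> std_sub x)"
  proof (rule ccontr)
    assume "\<not> ?thesis"
    then have lt: "vec.dim (F k \<inter> std_sub x) < rk w k x" by simp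
    let ?U = "{G \<in> flags. vec.dim (G k \<inter> std_sub x) < rk w k x}"
    have "openin flag_topology ?U"
      unfolding openin_flag_topology openin_euclidean_subtopology_iff
    proof (intro conjI ballI)
      fix A :: "complex ^ ('n::{finite,linorder}) ^ ('n::{finite,linorder})" assume "A \<in> {A \<in> SL. act A std_flag \<in> ?U}"
      then have A: "A \<in> SL" "vec.dim ((*v) A ` std_flag k \<inter> std_sub x) < rk w k x" by (auto simp: act_def)
      note dim_Int_std_sub_upper_semicontinuous[OF A(1) flag_subspace[OF std_flag_flags] A(2)]
      moreover have "A' \<in> {A \<in> SL. act A std_flag \<in> ?U} \<longleftrightarrow> vec.dim ((*v) A' ` std_flag k \<inter> std_sub x) < rk w k x"
        if "A' \<in> SL" for A'
        using act_flags[OF SL_invertible[OF that] std_flag_flags] that by (simp add: act_def)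
      ultimately show "\<exists>\<epsilon>>0. \<forall>A'\<in>SL. dist A' A < \<epsilon> \<longrightarrow> A' \<in> {A \<in> SL. act A std_flag \<in> ?U}"
        by simp
    qed auto
    then have op: "F \<in> ?U \<and> openin flag_topology ?U" using fl lt by simp
    have all: "\<forall>T. F \<in> T \<and> openin flag_topology T \<longrightarrow> (\<exists>y. y \<in> orbit Borel (coord_flag w) \<and> y \<in> T)"
      using F unfolding schubert_def in_closure_of by (rule conjunct2)
    from mp[OF spec[OF all, of ?U] op] obtain G where G: "G \<in> orbit Borel (coord_flag w)" "G \<in> ?U"
      by (elim exE conjE)
    then obtain A where "A \<in> Borel" "G = act A (coord_flag w)" by (auto simp: orbit_def)
    then show False using G(2) dim_Borel_act_Int_std_sub[of A "coord_flag w" k x] dim_coord_flag_Int_std_sub[OF w(1), of k x] by simp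
  qed
qed

section \<open>The flags of the theorem\<close>

lemma cycle_basis_eq: "cycle_basis ss ks mid ls = sign_vectors ss ks ls @ map e (mid @ rev ls)"
  by (simp add: cycle_basis_def sign_vectors_def)

lemma matrix_mult_e: "(M *v e j) $ i = M $ i $ j"
  for M :: "complex ^ 'n ^ 'n::finite"
  by (simp add: matrix_vector_mult_def e_nth if_distrib[of "\<lambda>x. _ * x"] cong: if_cong)

text \<open>Triangularity is relative to a numbering \<open>pos\<close>, because two orders occur:
  that of the index type, and one running through pairs of indices from \<open>ks\<close> and
  \<open>ls\<close>.\<close>

lemma det_triangular:
  fixes A :: "'a::comm_ring_1 ^ 'n ^ 'n::finite" and pos :: "'n \<Rightarrow> nat"
  assumes inj: "inj pos" and 0: "\<And>i j. pos j < pos i \<Longrightarrow> A $ i $ j = 0"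
  shows "det A = (\<Prod>i\<in>UNIV. A $ i $ i)"
proof -
  have *: "of_int (sign p) * (\<Prod>i\<in>UNIV. A $ i $ p i) = (if p = id then (\<Prod>i\<in>UNIV. A $ i $ i) else 0)"
    if p: "p permutes UNIV" for p :: "'n \<Rightarrow> 'n"
  proof (cases "p = id")
    case True then show ?thesis by (simp add: sign_id)
  next
    case False
    have "\<exists>i. pos (p i) < pos i"
    proof (rule ccontr)
      assume "\<not> ?thesis"
      then have le: "pos i \<le> pos (p i)" for i by (simp add: not_less)
      \<comment> \<open>A permutation preserves the total of \<open>pos\<close>, so if it nowhere
        lowers \<open>pos\<close> it changes no value.\<close>
      have "(\<Sum>i\<in>UNIV. pos (p i)) = (\<Sum>i\<in>UNIV. pos i)"
        using sum.permute[OF p, of pos] by (simp add: o_def)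
      then have "pos i = pos (p i)" for i
        using sum_mono_inv[of pos UNIV "\<lambda>i. pos (p i)" i] le by simp
      then have "p = id" using inj by (auto simp: fun_eq_iff inj_def)
      then show False using False by simp
    qed
    then have "(\<Prod>i\<in>UNIV. A $ i $ p i) = 0" using 0 by (intro prod_zero) auto
    then show ?thesis using False by simp
  qed
  have "det A = (\<Sum>p\<in>{p :: 'n \<Rightarrow> 'n. p permutes UNIV}. if p = id then (\<Prod>i\<in>UNIV. A $ i $ i) else 0)"
    unfolding det_def by (rule sum.cong) (simp_all add: *)
  then show ?thesis by (simp add: finite_permutations permutes_id)
qed

lemma flag_of_act:
  fixes A :: "complex ^ 'n ^ 'n::finite"
  shows "act A (flag_of vs) = flag_of (map ((*v) A) vs)"
proof
  fix k
  show "act A (flag_of vs) k = flag_of (map ((*v) A) vs) k"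
    unfolding act_def flag_of_def
    by (simp add: take_map vec.linear_span_image[OF matrix_vector_mul_linear_gen])
qed

lemma flags_eqI:
  fixes F G :: "'n::finite flag"
  assumes "F \<in> flags" "G \<in> flags" "\<And>k. F k \<subseteq> G k"
  shows "F = G"
proof
  fix k
  show "F k = G k"
    using assms by (intro vec.subspace_dim_equal flag_subspace) (auto simp: flag_dim)
qed

lemma vec_dim_le_Suc_kernel:
  fixes S :: "(complex ^ 'n::finite) set"
  assumes S: "vec.subspace S"
  shows "vec.dim S \<le> Suc (vec.dim (S \<inter> {v. bform f v = 0}))"
proof (cases "\<exists>x\<in>S. bform f x \<noteq> 0")
  case False
  then have "S \<inter> {v. bform f v = 0} = S" by auto
  then show ?thesis by simp
next
  case True
  then obtain x where x: "x \<in> S" "bform f x \<noteq> 0" by blast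
  let ?K = "S \<inter> {v. bform f v = 0}"
  have "S \<subseteq> vec.span (insert x ?K)"
  proof
    fix v assume v: "v \<in> S"
    let ?c = "bform f v / bform f x"
    have "v - ?c *s x \<in> ?K"
      using v x vec.subspace_diff[OF S] vec.subspace_scale[OF S] by (simp add: bform_diff bform_scale)
    then have "v - ?c *s x \<in> vec.span (insert x ?K)" by (intro vec.span_base) auto
    then have "?c *s x + (v - ?c *s x) \<in> vec.span (insert x ?K)"
      by (intro vec.span_add vec.span_scale) (auto intro: vec.span_base)
    then show "v \<in> vec.span (insert x ?K)" by simp
  qed
  then have "vec.dim S \<le> vec.dim (insert x ?K)" by (metis vec.dim_span vec.dim_subset)
  also have "\<dots> \<le> Suc (vec.dim ?K)" by (simp add: vec.dim_insert)
  finally show ?thesis .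
qed

text \<open>Downward induction from the whole space, where nondegeneracy of \<open>bform\<close>
  gives 0. Removing one vector from the flag subspace drops one linear condition, which costs at
  most one dimension.\<close>

lemma dim_perp_flag_le:
  fixes F :: "'n::finite flag"
  assumes F: "F \<in> flags" and "j \<le> CARD('n)"
  shows "vec.dim (perp (F j)) \<le> CARD('n) - j"
  using \<open>j \<le> CARD('n)\<close>
proof (induction rule: inc_induct)
  case base
  have "perp (F CARD('n)) \<subseteq> {0}"
  proof
    fix v assume "v \<in> perp (F CARD('n))"
    then have "bform (e i) v = 0" for i using flag_top[OF F, of "CARD('n)"] by (auto simp: perp_def)
    then show "v \<in> {0}" by (simp add: bform_e vec_eq_iff)
  qed
  then have "vec.dim (perp (F CARD('n))) \<le> vec.dim {0 :: complex ^ 'n}" by (rule vec.dim_subset)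
  then show ?case by simp
next
  case (step j)
  obtain f where f: "f \<in> F (Suc j)" "f \<notin> F j"
  proof -
    have "\<not> F (Suc j) \<subseteq> F j"
      using vec.dim_subset[of "F (Suc j)" "F j"] step.hyps by (auto simp: flag_dim[OF F])
    then show thesis using that by blast
  qed
  have "perp (F j) \<inter> {v. bform f v = 0} \<subseteq> perp (F (Suc j))"
  proof
    fix v assume v: "v \<in> perp (F j) \<inter> {v. bform f v = 0}"
    have "vec.span (insert f (F j)) \<subseteq> {x. bform x v = 0}"
      using v by (intro vec.span_minimal) (auto simp: perp_def vec.subspace_def bform_add bform_scale bform_0)
    then show "v \<in> perp (F (Suc j))" using span_insert_flag[OF F _ f] step.hyps by (auto simp: perp_def)
  qed
  then have "vec.dim (perp (F j) \<inter> {v. bform f v = 0}) \<le> vec.dim (perp (F (Suc j)))" by (rule vec.dim_subset)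
  then show ?case using vec_dim_le_Suc_kernel[OF subspace_perp, of "F j" f] step by linarith
qed

text \<open>The length of \<open>mid\<close> is left implicit: the other lengths force it to be n -
  2m, hence 0 or 1.\<close>

locale cycle_data =
  fixes ks mid ls :: "'n::{finite,linorder} list" and m :: nat
  assumes m: "m = CARD('n) div 2"
    and perm: "distinct (ks @ mid @ rev ls)" "set (ks @ mid @ rev ls) = UNIV"
    and len: "length ks = m" "length ls = m"
begin

abbreviation "w \<equiv> ks @ mid @ rev ls"

abbreviation cyc :: "complex list \<Rightarrow> 'n flag" where
  "cyc ss \<equiv> flag_of (cycle_basis ss ks mid ls)"

lemma length_w: "length w = CARD('n)" using perm by (metis distinct_card)

lemma w_ks: "p < m \<Longrightarrow> w ! p = ks ! p" using len by (simp add: nth_append)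

lemma w_ls: "p < m \<Longrightarrow> w ! (CARD('n) - 1 - p) = ls ! p"
proof -
  assume p: "p < m"
  have l: "length mid + m + m = CARD('n)" using length_w len by simp
  then have "CARD('n) - 1 - p = length ks + (length mid + (m - 1 - p))" using p len by linarith
  then have "w ! (CARD('n) - 1 - p) = rev ls ! (m - 1 - p)" by (simp only: nth_append_length_plus)
  then show ?thesis using p len by (simp add: rev_nth)
qed

lemma dist: "distinct (ks @ ls)" "distinct ks" "distinct ls"
  using perm by auto

lemma sign_choices_nth: "ss \<in> sign_choices m \<Longrightarrow> a < m \<Longrightarrow> ss ! a = \<i> \<or> ss ! a = - \<i>"
  using nth_mem[of a ss] by (auto simp: sign_choices_def subset_iff)

lemma sign_choices_length: "ss \<in> sign_choices m \<Longrightarrow> length ss = m"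
  by (simp add: sign_choices_def)

lemma cycle_basis_nth_ge: "length ss = m \<Longrightarrow> m \<le> q \<Longrightarrow> q < CARD('n) \<Longrightarrow> cycle_basis ss ks mid ls ! q = e (w ! q)"
  using len length_w by (simp add: cycle_basis_eq nth_append)

lemma cycle_basis_nth_less: "length ss = m \<Longrightarrow> q < m \<Longrightarrow> cycle_basis ss ks mid ls ! q = ss ! q *s e (ls ! q) + e (ks ! q)"
  using len by (simp add: cycle_basis_eq nth_append nth_sign_vectors)

lemma length_cycle_basis: "length ss = m \<Longrightarrow> length (cycle_basis ss ks mid ls) = CARD('n)"
  using len length_w by (simp add: cycle_basis_eq)

lemma cyc_eq_sign_vectors: "length ss = m \<Longrightarrow> j \<le> m \<Longrightarrow> cyc ss j = flag_of (sign_vectors ss ks ls) j"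
  using len by (simp add: cycle_basis_eq flag_of_def)

text \<open>The witness is the unipotent matrix that adds \<open>ss ! a\<close> times
  \<open>e (ls ! a)\<close> to \<open>e (ks ! a)\<close> and fixes the other basis vectors. It is
  upper triangular because l precedes k in every pair.\<close>

lemma cyc_in_orbit:
  assumes lt: "\<forall>a<m. ls ! a < ks ! a" and ss: "length ss = m"
  shows "\<exists>b\<in>Borel. cyc ss = act b (coord_flag w)"
proof -
  define b :: "complex ^ ('n::{finite,linorder}) ^ ('n::{finite,linorder})" where
    "b = (\<chi> i j. (if i = j then 1 else 0) + (\<Sum>a<m. if i = ls ! a \<and> j = ks ! a then ss ! a else 0))"
  have upper: "b $ i $ j = 0" if "j < i" for i j
  proof -
    have "(\<Sum>a<m. if i = ls ! a \<and> j = ks ! a then ss ! a else 0) = 0"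
      using lt that by (intro sum.neutral ballI) (metis lessThan_iff less_asym)
    then show ?thesis using that by (simp add: b_def)
  qed
  have diag: "b $ i $ i = 1" for i
  proof -
    have "(\<Sum>a<m. if i = ls ! a \<and> i = ks ! a then ss ! a else 0) = 0"
      using lt by (intro sum.neutral ballI) (metis lessThan_iff less_irrefl)
    then show ?thesis by (simp add: b_def)
  qed
  have "det b = (\<Prod>i\<in>UNIV. b $ i $ i)"
  proof (rule det_triangular)
    \<comment> \<open>The number of smaller indices serves as numbering of the index type in
      \<open>det_triangular\<close>.\<close>
    have mono: "card {j. j < i} < card {j. j < k}" if "i < k" for i k :: 'n
      using that by (intro psubset_card_mono) auto
    show "inj (\<lambda>i :: 'n. card {j. j < i})"
      by (rule injI) (metis mono less_irrefl neqE)
    show "b $ i $ j = 0" if "card {k. k < j} < card {k. k < i}" for i j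
      using that mono[of i j] upper[of j i] by (metis less_asym neqE)
  qed
  then have "det b = 1" by (simp add: diag)
  then have B: "b \<in> Borel" using upper by (simp add: Borel_def SL_def)
  have other: "b *v e j = e j" if "j \<notin> set ks" for j
  proof -
    have "j \<noteq> ks ! a" if "a < m" for a using that len \<open>j \<notin> set ks\<close> by auto
    then show ?thesis by (simp add: vec_eq_iff matrix_mult_e) (simp add: b_def e_nth)
  qed
  have kcol: "b *v e (ks ! a) = ss ! a *s e (ls ! a) + e (ks ! a)" if a: "a < m" for a
  proof -
    have "(\<Sum>c<m. if i = ls ! c \<and> ks ! a = ks ! c then ss ! c else 0) = (\<Sum>c<m. if c = a then (if i = ls ! a then ss ! a else 0) else 0)" for i
      using dist(2) len a by (intro sum.cong) (auto simp: nth_eq_iff_index_eq)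
    then show ?thesis using a by (simp add: vec_eq_iff matrix_mult_e) (simp add: b_def e_nth)
  qed
  have "map ((*v) b) (map e w) = cycle_basis ss ks mid ls"
  proof (rule nth_equalityI)
    show "length (map ((*v) b) (map e w)) = length (cycle_basis ss ks mid ls)"
      using length_cycle_basis[OF ss] length_w by simp
    fix q assume "q < length (map ((*v) b) (map e w))"
    then have q: "q < CARD('n)" using length_w by simp
    have "map ((*v) b) (map e w) ! q = b *v e (w ! q)"
      using q by (simp only: nth_map length_map length_w)
    also have "\<dots> = cycle_basis ss ks mid ls ! q"
    proof (cases "q < m")
      case True
      then show ?thesis using kcol[OF True] w_ks[OF True] cycle_basis_nth_less[OF ss True] by (simp only:)
    next
      case False
      have "w ! q \<notin> set ks"
      proof
        assume "w ! q \<in> set ks"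
        then obtain a where "a < m" "w ! q = w ! a" using len w_ks by (metis in_set_conv_nth)
        then show False using False perm(1) q length_w nth_eq_iff_index_eq[OF perm(1), of q a] by auto
      qed
      then show ?thesis using other cycle_basis_nth_ge[OF ss _ q] False by (simp only: not_less)
    qed
    finally show "map ((*v) b) (map e w) ! q = cycle_basis ss ks mid ls ! q" .
  qed
  then have "cyc ss = act b (coord_flag w)" by (simp add: coord_flag_def flag_of_act)
  then show ?thesis using B by blast
qed

lemma cyc_flags:
  assumes "\<forall>a<m. ls ! a < ks ! a" and "length ss = m"
  shows "cyc ss \<in> flags"
  using cyc_in_orbit[OF assms] act_flags[OF SL_invertible coord_flag_flags[OF perm]] by (auto simp: Borel_eq)

text \<open>A vector at position p < m lives on the indices that \<open>w\<close> has at positions p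
  and n - 1 - p, counted from 0. Among the admissible q only q = p meets this support, and there the
  square of the sign cancels 1.\<close>

lemma bform_cycle_basis:
  assumes ss: "ss \<in> sign_choices m" and pq: "p + q + 1 < CARD('n)"
  shows "bform (cycle_basis ss ks mid ls ! p) (cycle_basis ss ks mid ls ! q) = 0"
proof -
  note l = sign_choices_length[OF ss]
  have main: "bform (cycle_basis ss ks mid ls ! p) (cycle_basis ss ks mid ls ! q) = 0"
    if p: "p < m" and pq: "p + q + 1 < CARD('n)" for p q
  proof -
    have *: "bform (cycle_basis ss ks mid ls ! p) x = ss ! p * x $ (ls ! p) + x $ (ks ! p)" for x
      using p by (simp add: cycle_basis_nth_less[OF l] bform_add bform_scale bform_e)
    show ?thesis
    proof (cases "q < m")
      case False
      have "w ! q \<noteq> w ! p" "w ! q \<noteq> w ! (CARD('n) - 1 - p)"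
        using nth_eq_iff_index_eq[OF perm(1), of q p] nth_eq_iff_index_eq[OF perm(1), of q "CARD('n) - 1 - p"]
          p pq False length_w by auto
      then show ?thesis unfolding * using False pq cycle_basis_nth_ge[OF l, of q] w_ks[OF p] w_ls[OF p]
        by (simp add: e_nth)
    next
      case True
      have d: "ls ! q \<noteq> ks ! p" "ks ! q \<noteq> ls ! p"
        using dist(1) len p True by (metis distinct_append disjoint_iff nth_mem)+
      have i: "ls ! q = ls ! p \<longleftrightarrow> q = p" "ks ! q = ks ! p \<longleftrightarrow> q = p"
        using dist len p True by (auto simp: nth_eq_iff_index_eq)
      show ?thesis unfolding * using True d i sign_choices_nth[OF ss p]
        by (auto simp: cycle_basis_nth_less[OF l] e_nth)
    qed
  qed
  show ?thesis
  proof (cases "p < m")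
    case True then show ?thesis using main pq by blast
  next
    case False
    then have "q < m" using pq m by linarith
    then show ?thesis using main[of q p] pq by (simp add: bform_commute add.commute)
  qed
qed

text \<open>Orthogonality of the basis vectors gives one inclusion, and the dimension bound for
  \<open>perp\<close> turns it into equality.\<close>

lemma cyc_isotropic:
  assumes lt: "\<forall>a<m. ls ! a < ks ! a" and ss: "ss \<in> sign_choices m"
  shows "isotropic (cyc ss)"
proof -
  note l = sign_choices_length[OF ss]
  note F = cyc_flags[OF lt l]
  have "perp (cyc ss j) = cyc ss (CARD('n) - j)" if j: "j \<le> CARD('n)" for j
  proof -
    let ?C = "cycle_basis ss ks mid ls"
    have pair: "bform x y = 0" if x: "x \<in> set (take j ?C)" and y: "y \<in> set (take (CARD('n) - j) ?C)" for x y
    proof -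
      obtain p where "p < j" "x = ?C ! p" using x by (auto simp: in_set_conv_nth)
      moreover obtain q where "q < CARD('n) - j" "y = ?C ! q" using y by (auto simp: in_set_conv_nth)
      ultimately show ?thesis using bform_cycle_basis[OF ss, of p q] j by simp
    qed
    have "cyc ss (CARD('n) - j) \<subseteq> perp (cyc ss j)"
      unfolding flag_of_def
    proof (rule vec.span_minimal[OF _ subspace_perp], rule)
      fix y assume y: "y \<in> set (take (CARD('n) - j) ?C)"
      have "vec.span (set (take j ?C)) \<subseteq> {x. bform x y = 0}"
        using pair[OF _ y] by (intro vec.span_minimal) (auto simp: vec.subspace_def bform_add bform_scale bform_0)
      then show "y \<in> perp (vec.span (set (take j ?C)))" by (auto simp: perp_def)
    qed
    then show ?thesis
      using vec.subspace_dim_equal[OF flag_subspace[OF F] subspace_perp, of "CARD('n) - j" "cyc ss j"]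
        dim_perp_flag_le[OF F j] by (simp add: flag_dim[OF F])
  qed
  then show ?thesis using isotropic_iff_perp[OF F] by blast
qed

text \<open>An isotropic flag is determined by its lower half, since the remaining subspaces are
  orthogonal complements of the first ones.\<close>

lemma isotropic_flag_eq_cyc:
  fixes F :: "'n flag"
  assumes lt: "\<forall>a<m. ls ! a < ks ! a" and ss: "ss \<in> sign_choices m"
    and F: "F \<in> flags" "isotropic F" and eq: "\<forall>j\<le>m. F j = flag_of (sign_vectors ss ks ls) j"
  shows "F = cyc ss"
proof
  note l = sign_choices_length[OF ss]
  note G = cyc_flags[OF lt l]
  have le: "F j = cyc ss j" if "j \<le> m" for j using that eq cyc_eq_sign_vectors[OF l] by simp
  fix j
  consider "j \<le> m" | "CARD('n) < j" | "m < j" "j \<le> CARD('n)" by linarith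
  then show "F j = cyc ss j"
  proof cases
    case 1 then show ?thesis by (rule le)
  next
    case 2 then show ?thesis using flag_top[OF F(1), of j] flag_top[OF G, of j] by simp
  next
    case 3
    then have n: "CARD('n) - j \<le> m" "CARD('n) - j \<le> CARD('n)" "CARD('n) - (CARD('n) - j) = j" using m by linarith+
    have "F j = perp (F (CARD('n) - j))" using isotropic_iff_perp[OF F(1)] F(2) n by metis
    also have "\<dots> = perp (cyc ss (CARD('n) - j))" using le n by simp
    also have "\<dots> = cyc ss j" using isotropic_iff_perp[OF G] cyc_isotropic[OF lt ss] n by metis
    finally show ?thesis .
  qed
qed

text \<open>The m-th subspace already determines the signs: its vector with coordinates 1 at
  \<open>ks ! a\<close> and 0 at the other entries of \<open>ks\<close> is unique.\<close>

lemma cyc_inj: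
  assumes ss: "ss \<in> sign_choices m" "ss' \<in> sign_choices m" and eq: "cyc ss = cyc ss'"
  shows "ss = ss'"
proof (rule nth_equalityI)
  note l = sign_choices_length[OF ss(1)] sign_choices_length[OF ss(2)]
  show "length ss = length ss'" using l by simp
  fix a assume "a < length ss"
  then have a: "a < m" using l by simp
  let ?g = "sign_vectors ss ks ls" and ?g' = "sign_vectors ss' ks ls"
  have "?g ! a \<in> flag_of ?g m" unfolding flag_of_def using a l len by (auto intro!: vec.span_base)
  then have mem: "?g ! a \<in> vec.span (set ?g')"
  proof -
    have "flag_of ?g m = flag_of ?g' m"
      using cyc_eq_sign_vectors[OF l(1) order_refl] cyc_eq_sign_vectors[OF l(2) order_refl] fun_cong[OF eq, of m] by simp
    then show ?thesis using \<open>?g ! a \<in> flag_of ?g m\<close> l len by (simp add: flag_of_def)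
  qed
  have "?g ! a = (\<Sum>b<m. ?g ! a $ (ks ! b) *s ?g' ! b)"
    by (rule span_sign_vectors_expand[OF l(2) len dist(1) mem])
  also have "\<dots> = (\<Sum>b<m. if b = a then ?g' ! a else 0)"
    using nth_sign_vectors_coord[OF l(1) len dist(1) a] by (intro sum.cong) auto
  finally have "?g ! a = ?g' ! a" using a by simp
  then have "?g ! a $ (ls ! a) = ?g' ! a $ (ls ! a)" by simp
  moreover have "ks ! a \<noteq> ls ! a" using dist(1) len a by (metis distinct_append disjoint_iff nth_mem)
  ultimately show "ss ! a = ss' ! a" using a by (simp add: nth_sign_vectors[OF l(1) len] nth_sign_vectors[OF l(2) len] e_nth)
qed

end

section \<open>Sign changes and orientation\<close>

lemma SL_real_mult:
  fixes A B :: "complex ^ 'n ^ 'n::finite"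
  assumes "A \<in> SL_real" "B \<in> SL_real"
  shows "A ** B \<in> SL_real"
  using assms by (simp add: SL_real_def SL_def det_mul real_matrix_mult)

lemma act_act: "act A (act B F) = act (A ** B) F"
  by (simp add: act_def image_image matrix_vector_mul_assoc)

lemma act_mat_1: "act (mat 1) F = F"
  by (simp add: act_def)

lemma SL_real_inverse:
  fixes A :: "complex ^ 'n ^ 'n::finite"
  assumes "A \<in> SL_real"
  obtains N where "N \<in> SL_real" "N ** A = mat 1"
proof -
  obtain N where N: "A ** N = mat 1" "N ** A = mat 1"
    using assms SL_invertible unfolding SL_real_def invertible_def by blast
  define C where "C = (\<chi> i j. cnj (N $ i $ j))"
  have "C ** A = mat 1"
  proof (intro vec_eq_iff[THEN iffD2] allI)
    fix i j
    have "cnj (A $ i $ j) = A $ i $ j" for i j using assms by (simp add: SL_real_def Reals_cnj_iff)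
    then have "(C ** A) $ i $ j = cnj ((N ** A) $ i $ j)"
      by (simp add: matrix_matrix_mult_def C_def)
    then show "(C ** A) $ i $ j = mat 1 $ i $ j" by (simp add: N mat_def)
  qed
  then have "C = C ** (A ** N)" by (simp add: N)
  also have "\<dots> = N" using \<open>C ** A = mat 1\<close> by (simp add: matrix_mul_assoc)
  finally have CN: "C = N" .
  have real: "N $ i $ j \<in> \<real>" for i j
    using arg_cong[OF CN, of "\<lambda>M. M $ i $ j"] by (simp add: C_def Reals_cnj_iff)
  have "det N * det A = 1" using arg_cong[OF N(2), of det] by (simp add: det_mul)
  then have "det N = 1" using assms by (simp add: SL_real_def SL_def)
  then show thesis using that[of N] N real by (simp add: SL_real_def SL_def)
qed

definition diag :: "('n \<Rightarrow> complex) \<Rightarrow> complex ^ 'n ^ 'n::finite" where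
  "diag \<epsilon> = (\<chi> i j. if i = j then \<epsilon> i else 0)"

lemma diag_e: "diag \<epsilon> *v e j = \<epsilon> j *s e j"
  by (simp add: vec_eq_iff matrix_mult_e) (simp add: diag_def e_nth)

lemma det_diag: "det (diag \<epsilon>) = (\<Prod>i\<in>UNIV. \<epsilon> i)"
  by (subst det_diagonal) (simp_all add: diag_def)

definition real_matrix :: "complex ^ 'n ^ 'n \<Rightarrow> bool" where
  "real_matrix A \<longleftrightarrow> (\<forall>i j. A $ i $ j \<in> \<real>)"

definition cnj_vec :: "complex ^ 'n \<Rightarrow> complex ^ 'n" where
  "cnj_vec v = (\<chi> i. cnj (v $ i))"

lemma cnj_vec_real_matrix: "real_matrix A \<Longrightarrow> A *v cnj_vec v = cnj_vec (A *v v)"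
  by (simp add: vec_eq_iff cnj_vec_def matrix_vector_mult_def real_matrix_def Reals_cnj_iff)

lemma cnj_vec_sum: "cnj_vec (sum f S) = (\<Sum>x\<in>S. cnj_vec (f x))"
  by (simp add: vec_eq_iff cnj_vec_def)

lemma cnj_vec_scale: "cnj_vec (c *s v) = cnj c *s cnj_vec v"
  by (simp add: vec_eq_iff cnj_vec_def)

context cycle_data
begin

lemma act_diag_cyc:
  assumes lt: "\<forall>a<m. ls ! a < ks ! a"
    and ss: "ss \<in> sign_choices m" "ss' \<in> sign_choices m"
    and nz: "\<And>i. \<epsilon> i \<noteq> 0" and k: "\<And>i. i \<in> set ks \<Longrightarrow> \<epsilon> i = 1"
    and l: "\<And>a. a < m \<Longrightarrow> ss' ! a = \<epsilon> (ls ! a) * ss ! a"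
  shows "act (diag \<epsilon>) (cyc ss) = cyc ss'"
proof (rule flags_eqI)
  note len' = sign_choices_length[OF ss(1)] sign_choices_length[OF ss(2)]
  have "det (diag \<epsilon>) \<noteq> 0" using nz by (simp add: det_diag)
  then show "act (diag \<epsilon>) (cyc ss) \<in> flags"
    by (intro act_flags cyc_flags[OF lt len'(1)]) (simp add: invertible_det_nz)
  show "cyc ss' \<in> flags" by (rule cyc_flags[OF lt len'(2)])
  fix j
  have mult: "\<exists>c. diag \<epsilon> *v (cycle_basis ss ks mid ls ! p) = c *s (cycle_basis ss' ks mid ls ! p)" if p: "p < CARD('n)" for p
  proof (cases "p < m")
    case True
    have "diag \<epsilon> *v (cycle_basis ss ks mid ls ! p) = 1 *s (cycle_basis ss' ks mid ls ! p)"
      using True k[of "ks ! p"] l[OF True] len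
      by (simp add: cycle_basis_nth_less[OF len'(1)] cycle_basis_nth_less[OF len'(2)] diag_e matrix_vector_right_distrib vec.scale mult.commute)
    then show ?thesis by blast
  next
    case False
    then have "diag \<epsilon> *v (cycle_basis ss ks mid ls ! p) = \<epsilon> (w ! p) *s (cycle_basis ss' ks mid ls ! p)"
      using p by (simp add: cycle_basis_nth_ge[OF len'(1)] cycle_basis_nth_ge[OF len'(2)] diag_e del: nth_append)
    then show ?thesis by blast
  qed
  have "(*v) (diag \<epsilon>) ` set (take j (cycle_basis ss ks mid ls)) \<subseteq> vec.span (set (take j (cycle_basis ss' ks mid ls)))"
  proof
    fix y assume "y \<in> (*v) (diag \<epsilon>) ` set (take j (cycle_basis ss ks mid ls))"
    then obtain p where p: "p < j" "p < CARD('n)" "y = diag \<epsilon> *v (cycle_basis ss ks mid ls ! p)"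
      using length_cycle_basis[OF len'(1)] by (auto simp: in_set_conv_nth)
    then obtain c where "y = c *s (cycle_basis ss' ks mid ls ! p)" using mult by blast
    moreover have "cycle_basis ss' ks mid ls ! p \<in> set (take j (cycle_basis ss' ks mid ls))"
      unfolding in_set_conv_nth using p length_cycle_basis[OF len'(2)] by (intro exI[of _ p]) simp
    ultimately show "y \<in> vec.span (set (take j (cycle_basis ss' ks mid ls)))"
      by (simp add: vec.span_scale vec.span_base)
  qed
  then have "vec.span ((*v) (diag \<epsilon>) ` set (take j (cycle_basis ss ks mid ls))) \<subseteq> vec.span (set (take j (cycle_basis ss' ks mid ls)))"
    by (rule vec.span_minimal) simp
  then show "act (diag \<epsilon>) (cyc ss) j \<subseteq> cyc ss' j"
    unfolding act_def flag_of_def vec.linear_span_image[OF matrix_vector_mul_linear_gen] .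
qed

text \<open>The entry -1 at l turns one sign into the other. The entry \<open>c\<close> on the
  middle basis vector leaves the flag unchanged and is free to correct the determinant for odd
  n.\<close>

definition sign_change :: "complex list \<Rightarrow> complex list \<Rightarrow> complex \<Rightarrow> 'n \<Rightarrow> complex" where
  "sign_change ss ss' c i =
     (if i \<in> set mid then c else if \<exists>a<m. i = ls ! a \<and> ss ! a \<noteq> ss' ! a then - 1 else 1)"

definition parity :: "complex list \<Rightarrow> complex list \<Rightarrow> complex" where
  "parity ss ss' = (\<Prod>a<m. if ss ! a = ss' ! a then 1 else - 1)"

lemma parity_cases: "parity ss ss' = 1 \<or> parity ss ss' = - 1"
proof -
  have "(\<Prod>a\<in>S. if ss ! a = ss' ! a then 1 else - 1) \<in> {1, - 1 :: complex}" if "finite S" for S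
    using that by (induction S) auto
  from this[of "{..<m}"] show ?thesis by (simp add: parity_def)
qed

lemma sign_change_ls: "a < m \<Longrightarrow> sign_change ss ss' c (ls ! a) = (if ss ! a = ss' ! a then 1 else - 1)"
proof -
  assume a: "a < m"
  have "ls ! a \<notin> set mid" using perm(1) a len nth_mem[of a ls] by auto
  moreover have "ls ! a = ls ! b \<longleftrightarrow> a = b" if "b < m" for b
    using dist(3) len a that by (simp add: nth_eq_iff_index_eq)
  ultimately show ?thesis using a by (auto simp: sign_change_def)
qed

lemma sign_change_ks: "i \<in> set ks \<Longrightarrow> sign_change ss ss' c i = 1"
proof -
  assume i: "i \<in> set ks"
  have "i \<notin> set mid" "i \<notin> set ls" using perm(1) i by auto
  then show ?thesis using len by (auto simp: sign_change_def)
qed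

lemma prod_sign_change: "(\<Prod>i\<in>UNIV. sign_change ss ss' c i) = c ^ length mid * parity ss ss'"
proof -
  let ?f = "sign_change ss ss' c"
  have "(\<Prod>i\<in>UNIV. ?f i) = (\<Prod>i\<in>set ks \<union> (set mid \<union> set ls). ?f i)"
    using perm(2) by (intro prod.cong) auto
  also have "\<dots> = (\<Prod>i\<in>set ks. ?f i) * ((\<Prod>i\<in>set mid. ?f i) * (\<Prod>i\<in>set ls. ?f i))"
  proof -
    have "set ks \<inter> (set mid \<union> set ls) = {}" "set mid \<inter> set ls = {}" using perm(1) by auto
    then show ?thesis by (simp add: prod.union_disjoint)
  qed
  also have "(\<Prod>i\<in>set ks. ?f i) = 1" by (intro prod.neutral) (simp add: sign_change_ks)
  also have "(\<Prod>i\<in>set mid. ?f i) = (\<Prod>i\<in>set mid. c)" by (intro prod.cong) (auto simp: sign_change_def)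
  also have "\<dots> = c ^ length mid" using perm(1) by (simp add: distinct_card)
  also have "(\<Prod>i\<in>set ls. ?f i) = (\<Prod>a<m. ?f (ls ! a))"
    using prod.reindex_bij_betw[OF bij_betw_nth[OF dist(3) refl refl], of ?f] len by simp
  also have "\<dots> = parity ss ss'" unfolding parity_def by (intro prod.cong) (auto simp: sign_change_ls)
  finally show ?thesis by simp
qed

lemma act_sign_change:
  assumes lt: "\<forall>a<m. ls ! a < ks ! a"
    and ss: "ss \<in> sign_choices m" "ss' \<in> sign_choices m" and c: "c \<noteq> 0"
  shows "act (diag (sign_change ss ss' c)) (cyc ss) = cyc ss'"
proof (rule act_diag_cyc[OF lt ss])
  show "sign_change ss ss' c i \<noteq> 0" for i using c by (simp add: sign_change_def)
  show "ss' ! a = sign_change ss ss' c (ls ! a) * ss ! a" if "a < m" for a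
    using sign_choices_nth[OF ss(1) that] sign_choices_nth[OF ss(2) that] that by (auto simp: sign_change_ls)
qed (rule sign_change_ks)

lemma sign_change_SL_real:
  assumes "c \<in> \<real>" "c ^ length mid * parity ss ss' = 1"
  shows "diag (sign_change ss ss' c) \<in> SL_real"
  using assms by (simp add: SL_real_def SL_def det_diag prod_sign_change) (simp add: diag_def sign_change_def)

text \<open>
  For even \<open>n\<close> the vectors of \<open>sign_vectors\<close> together with their conjugates form a basis, in which
  a real matrix fixing the flag is triangular with diagonal entries in complex conjugate pairs.
\<close>

lemma det_real_stabilizer_nonneg:
  assumes even: "mid = []" and ss: "ss \<in> sign_choices m"
    and B: "real_matrix B" "\<And>j x. x \<in> cyc ss j \<Longrightarrow> B *v x \<in> cyc ss j"
  shows "\<exists>r\<ge>0. det B = of_real r"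
proof -
  note l = sign_choices_length[OF ss]
  let ?f = "\<lambda>a. sign_vectors ss ks ls ! a"
  \<comment> \<open>The matrix of \<open>B\<close> on the sign vectors, read off with the
    coordinates at \<open>ks\<close>; it is upper triangular since \<open>B\<close> preserves the
    flag.\<close>
  define c where "c b a = (B *v ?f a) $ (ks ! b)" for b a
  have Bf: "B *v ?f a = (\<Sum>b<m. c b a *s ?f b)" and c0: "b < m \<Longrightarrow> a < b \<Longrightarrow> c b a = 0" if a: "a < m" for a b
  proof -
    let ?g = "sign_vectors ss ks ls"
    have "?f a \<in> cyc ss (Suc a)"
      using a l len by (subst cyc_eq_sign_vectors) (auto simp: flag_of_def take_Suc_conv_app_nth intro!: vec.span_base)
    then have "B *v ?f a \<in> cyc ss (Suc a)" by (rule B(2))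
    then have mem: "B *v ?f a \<in> vec.span (set (take (Suc a) ?g))"
      using a cyc_eq_sign_vectors[OF l, of "Suc a"] by (simp add: flag_of_def)
    then have mem2: "B *v ?f a \<in> vec.span (set ?g)" using vec.span_mono[OF set_take_subset] by blast
    show "B *v ?f a = (\<Sum>b<m. c b a *s ?f b)"
      unfolding c_def by (rule span_sign_vectors_expand[OF l len dist(1) mem2])
    assume b: "b < m" "a < b"
    have "vec.span (set (take (Suc a) ?g)) \<subseteq> {v. v $ (ks ! b) = 0}"
    proof (rule vec.span_minimal)
      show "set (take (Suc a) ?g) \<subseteq> {v. v $ (ks ! b) = 0}"
        using b nth_sign_vectors_coord[OF l len dist(1) _ b(1)] by (auto simp: in_set_conv_nth l len)
    qed (auto simp: vec.subspace_def)
    then show "c b a = 0" using mem by (auto simp: c_def)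
  qed
  have Bcf: "B *v cnj_vec (?f a) = (\<Sum>b<m. cnj (c b a) *s cnj_vec (?f b))" if "a < m" for a
    using Bf[OF that] cnj_vec_real_matrix[OF B(1), of "?f a"] by (simp add: cnj_vec_sum cnj_vec_scale)
  define \<kappa> where "\<kappa> = inv_into {..<m} ((!) ks)"
  define \<mu> where "\<mu> = inv_into {..<m} ((!) ls)"
  have \<kappa>: "\<kappa> (ks ! a) = a" and \<mu>: "\<mu> (ls ! a) = a" if "a < m" for a
    using that dist len inj_on_nth[of ks "{..<m}"] inj_on_nth[of ls "{..<m}"]
    by (auto simp: \<kappa>_def \<mu>_def intro!: inv_into_f_f)
  have cases: "(\<exists>a<m. i = ks ! a) \<or> (\<exists>a<m. i = ls ! a)" for i
  proof -
    have "i \<in> set ks \<or> i \<in> set ls" using perm(2) even by auto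
    then show ?thesis using len by (metis in_set_conv_nth)
  qed
  have lk: "ls ! a \<notin> set ks" if "a < m" for a using dist(1) that len by auto
  have kin: "ks ! a \<in> set ks" if "a < m" for a using that len by simp
  \<comment> \<open>\<open>P\<close> has the sign vectors as columns at \<open>ks\<close> and their
    conjugates as columns at \<open>ls\<close>. The matrix \<open>C\<close> is \<open>B\<close>
    expressed in this basis.\<close>
  define P where "P = (\<chi> i j. (if j \<in> set ks then ?f (\<kappa> j) else cnj_vec (?f (\<mu> j))) $ i)"
  define C where "C = (\<chi> i j. (if j \<in> set ks then (\<Sum>b<m. c b (\<kappa> j) *s e (ks ! b))
                               else (\<Sum>b<m. cnj (c b (\<mu> j)) *s e (ls ! b))) $ i)"
  have Pk: "P *v e (ks ! a) = ?f a" and Pl: "P *v e (ls ! a) = cnj_vec (?f a)" if "a < m" for a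
    unfolding vec_eq_iff matrix_mult_e P_def using that \<kappa> \<mu> lk kin by auto
  have Ck: "C *v e (ks ! a) = (\<Sum>b<m. c b a *s e (ks ! b))" and Cl: "C *v e (ls ! a) = (\<Sum>b<m. cnj (c b a) *s e (ls ! b))" if "a < m" for a
    unfolding vec_eq_iff matrix_mult_e C_def using that \<kappa> \<mu> lk kin by auto
  have lin: "M *v (\<Sum>b<m. g b *s h b) = (\<Sum>b<m. g b *s (M *v h b))" for M :: "complex ^ ('n::{finite,linorder}) ^ ('n::{finite,linorder})" and g h
    by (simp add: vec.sum vec.scale)
  have "(P ** C) *v e i = (B ** P) *v e i" for i
  proof -
    consider a where "a < m" "i = ks ! a" | a where "a < m" "i = ls ! a" using cases[of i] by blast
    then show ?thesis
    proof cases
      case 1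
      then show ?thesis by (simp add: Ck lin Pk Bf flip: matrix_vector_mul_assoc)
    next
      case 2
      then show ?thesis by (simp add: Cl lin Pl Bcf flip: matrix_vector_mul_assoc)
    qed
  qed
  then have PC: "P ** C = B ** P"
    by (metis (no_types, lifting) matrix_mult_e vec_eq_iff)
  have "surj ((*v) P)"
  proof -
    have "e i \<in> range ((*v) P)" for i
    proof -
      \<comment> \<open>The signs are purely imaginary, so half the sum of a sign vector and its
        conjugate is \<open>e (ks ! a)\<close>, and their difference is twice the sign times
        \<open>e (ls ! a)\<close>.\<close>
      have *: "e (ks ! a) = P *v ((1/2) *s (e (ks ! a) + e (ls ! a)))" "e (ls ! a) = P *v ((1 / (2 * ss ! a)) *s (e (ks ! a) - e (ls ! a)))" if a: "a < m" for a
        using a sign_choices_nth[OF ss a] lk[OF a] kin[OF a]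
        by (auto simp: vec.scale vec.add vec.diff Pk Pl nth_sign_vectors[OF l len] vec_eq_iff cnj_vec_def e_nth dest: sym)
      show ?thesis using cases[of i] * by (metis rangeI)
    qed
    then have "vec.span (range e) \<subseteq> range ((*v) P)"
      by (intro vec.span_minimal vec_subspace_image) auto
    then show ?thesis unfolding span_e by blast
  qed
  then have "invertible P" by (simp add: invertible_right_inverse matrix_right_invertible_surjective)
  then have "det P \<noteq> 0" by (simp add: invertible_det_nz)
  moreover have "det P * det C = det B * det P" using arg_cong[OF PC, of det] by (simp add: det_mul)
  ultimately have BC: "det B = det C" by simp
  have Ckk: "C $ (ks ! b) $ (ks ! a) = c b a" and Clk: "C $ (ls ! b) $ (ks ! a) = 0"
    and Cll: "C $ (ls ! b) $ (ls ! a) = cnj (c b a)" and Ckl: "C $ (ks ! b) $ (ls ! a) = 0" if ab: "a < m" "b < m" for a b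
  proof -
    have k: "ks ! d = ks ! b \<longleftrightarrow> d = b" "ls ! d = ls ! b \<longleftrightarrow> d = b" "ls ! d \<noteq> ks ! b" "ks ! d \<noteq> ls ! b" if "d < m" for d
    proof -
      show "ks ! d = ks ! b \<longleftrightarrow> d = b" "ls ! d = ls ! b \<longleftrightarrow> d = b"
        using dist(2,3) len that ab by (auto simp: nth_eq_iff_index_eq)
      show "ls ! d \<noteq> ks ! b" using lk[OF that] kin[OF ab(2)] by metis
      show "ks ! d \<noteq> ls ! b" using lk[OF ab(2)] kin[OF that] by metis
    qed
    have "C $ (ks ! b) $ (ks ! a) = (\<Sum>d<m. if d = b then c d a else 0)"
      unfolding matrix_mult_e[symmetric] Ck[OF ab(1)] sum_component by (rule sum.cong) (auto simp: e_nth k)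
    then show "C $ (ks ! b) $ (ks ! a) = c b a" using ab by simp
    have "C $ (ls ! b) $ (ls ! a) = (\<Sum>d<m. if d = b then cnj (c d a) else 0)"
      unfolding matrix_mult_e[symmetric] Cl[OF ab(1)] sum_component by (rule sum.cong) (auto simp: e_nth k)
    then show "C $ (ls ! b) $ (ls ! a) = cnj (c b a)" using ab by simp
    show "C $ (ls ! b) $ (ks ! a) = 0"
      unfolding matrix_mult_e[symmetric] Ck[OF ab(1)] sum_component by (rule sum.neutral) (auto simp: e_nth k)
    show "C $ (ks ! b) $ (ls ! a) = 0"
      unfolding matrix_mult_e[symmetric] Cl[OF ab(1)] sum_component by (rule sum.neutral) (auto simp: e_nth k)
  qed
  \<comment> \<open>\<open>C\<close> consists of two upper triangular blocks without cross terms.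
    Even numbers for \<open>ks\<close> and odd numbers for \<open>ls\<close> order both blocks
    compatibly.\<close>
  define pos where "pos i = (if i \<in> set ks then 2 * \<kappa> i else 2 * \<mu> i + 1)" for i
  have pk: "pos (ks ! a) = 2 * a" and pl: "pos (ls ! a) = 2 * a + 1" if "a < m" for a
    using that \<kappa> \<mu> lk kin by (auto simp: pos_def)
  have "det C = (\<Prod>i\<in>UNIV. C $ i $ i)"
  proof (rule det_triangular)
    show "inj pos"
    proof (rule injI)
      fix i j assume eq: "pos i = pos j"
      show "i = j"
        using cases[of i] cases[of j] eq by (auto simp: pk pl) presburger+
    qed
    show "C $ i $ j = 0" if "pos j < pos i" for i j
      using cases[of i] cases[of j] that c0 by (auto simp: pk pl Ckk Cll Clk Ckl)
  qed
  also have "\<dots> = (\<Prod>i\<in>set ks \<union> set ls. C $ i $ i)"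
    using perm(2) even by (intro prod.cong) auto
  also have "\<dots> = (\<Prod>i\<in>set ks. C $ i $ i) * (\<Prod>i\<in>set ls. C $ i $ i)"
    using dist(1) by (intro prod.union_disjoint) auto
  also have "(\<Prod>i\<in>set ks. C $ i $ i) = (\<Prod>a<m. C $ (ks ! a) $ (ks ! a))"
    using prod.reindex_bij_betw[OF bij_betw_nth[OF dist(2) refl refl], of "\<lambda>i. C $ i $ i"] len by simp
  also have "\<dots> = (\<Prod>a<m. c a a)" by (intro prod.cong) (auto simp: Ckk)
  also have "(\<Prod>i\<in>set ls. C $ i $ i) = (\<Prod>a<m. C $ (ls ! a) $ (ls ! a))"
    using prod.reindex_bij_betw[OF bij_betw_nth[OF dist(3) refl refl], of "\<lambda>i. C $ i $ i"] len by simp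
  also have "\<dots> = cnj (\<Prod>a<m. c a a)" unfolding cnj_prod by (intro prod.cong) (auto simp: Cll)
  finally have "det B = of_real ((norm (\<Prod>a<m. c a a))\<^sup>2)"
    unfolding BC complex_norm_square .
  then show ?thesis using zero_le_power2 by blast
qed

end

section \<open>From the dimension condition to the shape of the intersection points\<close>

lemma lie_stabilizer_SO_subset:
  fixes F :: "'n::finite flag"
  assumes F: "F \<in> flags"
  shows "lie (stabilizer SO_real F) \<subseteq> so_real \<inter> pres (range F)"
proof
  fix X :: "complex ^ 'n ^ 'n" assume "X \<in> lie (stabilizer SO_real F)"
  then obtain \<gamma> where g: "\<And>t. \<gamma> t \<in> stabilizer SO_real F" "\<gamma> 0 = mat 1"
    "(\<gamma> has_vector_derivative X) (at 0)" unfolding lie_def by blast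
  have real: "\<gamma> t $ i $ j \<in> \<real>" and orth: "transpose (\<gamma> t) ** \<gamma> t = mat 1" for t i j
    using g(1)[of t] by (auto simp: stabilizer_def SO_real_def SL_real_def)
  have "stabilizer SO_real F \<subseteq> stabilizer SL F" by (auto simp: stabilizer_def SO_real_def SL_real_def)
  then have pres: "\<gamma> t \<in> pres (range F)" for t using g(1)[of t] stabilizer_SL_Int[OF F, of UNIV] by auto
  have "X \<in> pres (range F)"
    by (rule has_vector_derivative_in_subspace[OF subspace_pres pres g(3)]) (use flag_subspace[OF F] in auto)
  moreover have "X $ i $ j \<in> \<real>" for i j
    by (rule has_vector_derivative_in_subspace[OF _ real has_vector_derivative_nth[OF has_vector_derivative_nth[OF g(3)]]])
      (auto simp: subspace_def scaleR_conv_of_real)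
  moreover have "transpose X = - X"
  proof (intro vec_eq_iff[THEN iffD2] allI)
    fix i j
    have d: "((\<lambda>t. \<gamma> t $ a $ b) has_vector_derivative X $ a $ b) (at 0)" for a b
      by (rule has_vector_derivative_nth[OF has_vector_derivative_nth[OF g(3)]])
    have "((\<lambda>t. \<Sum>k\<in>UNIV. \<gamma> t $ k $ i * \<gamma> t $ k $ j) has_vector_derivative
       (\<Sum>k\<in>UNIV. \<gamma> 0 $ k $ i * X $ k $ j + X $ k $ i * \<gamma> 0 $ k $ j)) (at 0)"
      by (intro has_vector_derivative_sum has_vector_derivative_mult d)
    moreover have "(\<lambda>t. \<Sum>k\<in>UNIV. \<gamma> t $ k $ i * \<gamma> t $ k $ j) = (\<lambda>t. mat 1 $ i $ j)"
    proof
      fix t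
      show "(\<Sum>k\<in>UNIV. \<gamma> t $ k $ i * \<gamma> t $ k $ j) = mat 1 $ i $ j"
        using arg_cong[OF orth[of t], of "\<lambda>A. A $ i $ j"] by (simp add: matrix_matrix_mult_def transpose_def)
    qed
    ultimately have "((\<lambda>t. mat 1 $ i $ j) has_vector_derivative
       (\<Sum>k\<in>UNIV. \<gamma> 0 $ k $ i * X $ k $ j + X $ k $ i * \<gamma> 0 $ k $ j)) (at 0)" by (simp only:)
    then have "(\<Sum>k\<in>UNIV. \<gamma> 0 $ k $ i * X $ k $ j + X $ k $ i * \<gamma> 0 $ k $ j) = 0"
      using vector_derivative_unique_at[OF _ has_vector_derivative_const] by blast
    moreover have "(\<Sum>k\<in>UNIV. \<gamma> 0 $ k $ i * X $ k $ j + X $ k $ i * \<gamma> 0 $ k $ j) = X $ i $ j + X $ j $ i"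
      by (simp add: g(2) mat_def sum.distrib if_distrib[of "\<lambda>x. x * _"] if_distrib[of "\<lambda>x. _ * x"] cong: if_cong)
    ultimately show "transpose X $ i $ j = (- X) $ i $ j"
      by (simp add: transpose_def eq_neg_iff_add_eq_0 add.commute)
  qed
  ultimately show "X \<in> so_real \<inter> pres (range F)" by (simp add: so_real_def)
qed

text \<open>The Lie algebra of the group is bounded from below and that of the stabilizer from
  above, which are the directions a lower bound for the difference requires.\<close>

lemma orbit_dim_SO_ge:
  fixes F :: "'n::finite flag"
  assumes "F \<in> flags"
  shows "dim (so_real :: (complex ^ 'n ^ 'n) set) - dim (so_real \<inter> pres (range F)) \<le> orbit_dim SO_real F"
proof -
  have "dim (so_real :: (complex ^ 'n ^ 'n) set) \<le> dim (lie (SO_real :: (complex ^ 'n ^ 'n) set))"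
    by (rule dim_subset[OF so_real_subset_lie])
  moreover have "dim (lie (stabilizer SO_real F)) \<le> dim (so_real \<inter> pres (range F))"
    by (rule dim_subset[OF lie_stabilizer_SO_subset[OF assms]])
  ultimately show ?thesis unfolding orbit_dim_def by linarith
qed

lemma coord_flag_in_schubert:
  fixes w :: "'n::{finite,linorder} list"
  assumes "distinct w" "set w = UNIV"
  shows "coord_flag w \<in> schubert w"
proof -
  have "mat 1 \<in> (Borel :: (complex ^ ('n::{finite,linorder}) ^ ('n::{finite,linorder})) set)"
    by (simp add: Borel_def SL_def) (simp add: mat_def)
  then have "coord_flag w \<in> orbit Borel (coord_flag w)"
    unfolding orbit_def using act_mat_1[of "coord_flag w"] by (metis imageI)
  then show ?thesis using orbit_subset_schubert[OF assms] by blast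
qed

lemma schubert_Int_base_cycle_flag:
  fixes ks mid ls :: "'n::{finite,linorder} list"
  assumes cd: "cycle_data ks mid ls m"
    and F: "F \<in> schubert (ks @ mid @ rev ls) \<inter> base_cycle D"
    and dims: "strat_dim Borel (schubert (ks @ mid @ rev ls)) + strat_dim SO_real (base_cycle D)
           = strat_dim SL (flags :: 'n flag set)"
  shows "(\<forall>a<m. ls ! a < ks ! a) \<and> (\<exists>ss\<in>sign_choices m. F = flag_of (cycle_basis ss ks mid ls))"
proof -
  interpret w: cycle_data ks mid ls m by (rule cd)
  let ?w = "ks @ mid @ rev ls"
  let ?b = "pres (range (std_sub :: 'n \<Rightarrow> _))" and ?p = "pres (range F)"
  let ?U = "UNIV :: (complex ^ ('n::{finite,linorder}) ^ ('n::{finite,linorder})) set"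
  have fl: "F \<in> flags" using schubert_rk_le(1)[OF w.perm] F by blast
  have iso: "isotropic F" using F by (simp add: base_cycle_def)
  have rw: "rk ?w k x \<le> vec.dim (F k \<inter> std_sub x)" for k x using schubert_rk_le(2)[OF w.perm] F by blast
  note i1 = strat_dim_ge[of F "schubert ?w" Borel] and i2 = strat_dim_ge[of F "base_cycle D" SO_real]
    and i3 = strat_dim_flags_le[OF fl] and i4 = orbit_dim_SO_ge[OF fl]
    and iw = strat_dim_ge[OF coord_flag_in_schubert[OF w.perm], of Borel]
  \<comment> \<open>The dimension hypothesis as a bound for any flag whose Borel orbit is no larger
    than the Schubert variety. It is used for \<open>F\<close> itself and for the coordinate flag of
    \<open>w\<close>.\<close>
  have up: "orbit_dim Borel G + (dim (so_real :: (complex ^ ('n::{finite,linorder}) ^ ('n::{finite,linorder})) set) - dim (so_real \<inter> ?p)) \<le> dim ?U - dim ?p"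
    if "orbit_dim Borel G \<le> strat_dim Borel (schubert ?w)" for G :: "'n flag"
    using that i2 i3 i4 dims F by simp
  note upF = up[OF i1] and upw = up[OF iw]
  have H: "strict_upper (\<chi> a b. f $ a * u $ b - u $ a * f $ b) *v x \<in> F j"
    if "i \<le> CARD('n)" "f \<in> F i" "u \<in> F (CARD('n) - i)" "j < CARD('n)" "x \<in> F (Suc j)" for i j f u x
  proof (rule strict_upper_preserves[OF fl iso _ _ wedge_in_ann[OF fl iso that(1-3)] that(4,5)])
    show "dim ?b - dim (pres (range std_sub \<union> range F)) +
      (dim (so_real :: (complex ^ ('n::{finite,linorder}) ^ ('n::{finite,linorder})) set) - dim (so_real \<inter> ?p)) \<le> dim ?U - dim ?p"
      using upF F orbit_dim_Borel[OF fl] by simp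
    show "transpose (\<chi> a b. f $ a * u $ b - u $ a * f $ b) = - (\<chi> a b. f $ a * u $ b - u $ a * f $ b)"
      by (simp add: transpose_def vec_eq_iff)
  qed
  have "\<exists>ss ks ls. length ss = m \<and> length ks = m \<and> length ls = m \<and> set ss \<subseteq> {\<i>, - \<i>} \<and> distinct (ks @ ls)
    \<and> (\<forall>a<m. ls ! a < ks ! a) \<and> (\<forall>j\<le>m. F j = flag_of (sign_vectors ss ks ls) j)"
  proof (rule isotropic_flag_structure[OF fl iso])
    show "m \<le> CARD('n) div 2" using w.m by simp
  qed (rule H)
  then obtain ss ks' ls' where l: "length ss = m" "length ks' = m" "length ls' = m" and ss: "set ss \<subseteq> {\<i>, - \<i>}"
    and d: "distinct (ks' @ ls')" and lt: "\<forall>a<m. ls' ! a < ks' ! a"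
    and Fj: "\<forall>j\<le>m. F j = flag_of (sign_vectors ss ks' ls') j" by (elim exE conjE) (rule that)
  have ssm: "ss \<in> sign_choices m" using l ss by (simp add: sign_choices_def)
  \<comment> \<open>The remaining indices may be listed in any order, there being at most
    one.\<close>
  obtain mid' where mid': "set mid' = UNIV - set ks' - set ls'" "distinct mid'"
    using finite_distinct_list[of "UNIV - set ks' - set ls'"] by auto
  let ?v = "ks' @ mid' @ rev ls'"
  interpret v: cycle_data ks' mid' ls' m
    by unfold_locales (use w.m l d mid' in auto)
  have Fv: "F = flag_of (cycle_basis ss ks' mid' ls')" by (rule v.isotropic_flag_eq_cyc[OF lt ssm fl iso Fj])
  obtain g where g: "g \<in> Borel" "F = act g (coord_flag ?v)" using v.cyc_in_orbit[OF lt l(1)] Fv by blast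
  have rv: "vec.dim (F k \<inter> std_sub x) = rk ?v k x" for k x
    unfolding g(2) dim_Borel_act_Int_std_sub[OF g(1)] by (rule dim_coord_flag_Int_std_sub[OF v.perm(1)])
  \<comment> \<open>If they differ, the rank inequalities give \<open>w\<close> fewer ordered pairs,
    hence a Borel orbit larger than that of \<open>F\<close>. The orbits through \<open>F\<close>
    already add up to at least dim Z, so the bound for the coordinate flag of \<open>w\<close>
    fails.\<close>
  have "?v = ?w"
  proof (rule ccontr)
    assume "?v \<noteq> ?w"
    then have lt: "card (ordered_pairs ?w) < card (ordered_pairs ?v)"
      using rw unfolding rv by (intro bruhat_card_ordered_pairs) (use v.perm w.perm in auto)
    have "dim (pres (range std_sub \<union> range F)) = 2 * card (ordered_pairs ?v)"
      unfolding g(2) dim_pres_Borel_act[OF g(1)] by (rule dim_pres_coord_flag[OF v.perm])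
    moreover have "dim (pres (range std_sub \<union> range F)) \<le> dim ?b" by (rule dim_subset) (simp add: pres_Un)
    moreover have "orbit_dim Borel (coord_flag ?w) = dim ?b - 2 * card (ordered_pairs ?w)"
      unfolding orbit_dim_Borel[OF coord_flag_flags[OF w.perm]] dim_pres_coord_flag[OF w.perm] ..
    moreover note upw codim_pres_flag_le[OF fl iso]
    ultimately show False using lt by linarith
  qed
  then have "ks' = ks" "mid' = mid" "ls' = ls"
    using l w.len by (simp_all add: append_eq_append_conv)
  then show ?thesis using lt ssm Fv by blast
qed

section \<open>Which sign choices give flags in the open orbit\<close>

lemma orbit_SL_real_closed:
  fixes R :: "complex ^ 'n ^ 'n::finite"
  assumes "R \<in> SL_real" "F \<in> orbit SL_real F0"
  shows "act R F \<in> orbit SL_real F0"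
proof -
  obtain A where A: "A \<in> SL_real" "F = act A F0" using assms(2) by (auto simp: orbit_def)
  then have "act R F = act (R ** A) F0" "R ** A \<in> SL_real" using SL_real_mult assms(1) by (auto simp: act_act)
  then show ?thesis unfolding orbit_def by (metis imageI)
qed

context cycle_data
begin

abbreviation flip :: "complex list \<Rightarrow> complex list" where
  "flip ss \<equiv> ss[0 := - ss ! 0]"

lemma flip_sign_choices: "ss \<in> sign_choices m \<Longrightarrow> flip ss \<in> sign_choices m"
  using sign_choices_nth[of ss 0] set_update_subset_insert[of ss 0 "- ss ! 0"]
  by (cases "m = 0") (auto simp: sign_choices_def)

lemma flip_flip: "flip (flip ss) = ss"
  by (cases ss) auto

lemma parity_flip:
  assumes ss: "ss \<in> sign_choices m" "ss' \<in> sign_choices m" and m0: "0 < m"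
  shows "parity (flip ss) ss' = - parity ss ss'"
proof -
  note l = sign_choices_length[OF ss(1)]
  have S: "{..<m} = insert 0 {1..<m}" using m0 by auto
  have "(\<Prod>a=1..<m. if flip ss ! a = ss' ! a then 1 else - 1) = (\<Prod>a=1..<m. if ss ! a = ss' ! a then 1 else - 1 :: complex)"
    by (intro prod.cong) auto
  then show ?thesis
    using sign_choices_nth[OF ss(1) m0] sign_choices_nth[OF ss(2) m0] m0 l
    unfolding parity_def S by auto
qed

text \<open>If both flags lay in one orbit, an element of \<open>SL_real\<close> would carry one to
  the other. Composed with the diagonal matrix of determinant -1 that carries it back, it would be a
  real stabilizing matrix of determinant -1.\<close>

lemma flip_not_in_orbit:
  assumes lt: "\<forall>a<m. ls ! a < ks ! a" and even: "mid = []" and m0: "0 < m"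
    and ss: "ss \<in> sign_choices m" and D: "cyc ss \<in> orbit SL_real F0" "cyc (flip ss) \<in> orbit SL_real F0"
  shows False
proof -
  note fs = flip_sign_choices[OF ss]
  obtain A1 A2 where A: "A1 \<in> SL_real" "cyc ss = act A1 F0" "A2 \<in> SL_real" "cyc (flip ss) = act A2 F0"
    using D by (auto simp: orbit_def)
  obtain N where N: "N \<in> SL_real" "N ** A1 = mat 1" using SL_real_inverse[OF A(1)] by blast
  have F0: "F0 = act N (cyc ss)" unfolding A(2) by (simp add: act_act N act_mat_1)
  define R where "R = diag (sign_change (flip ss) ss 1)"
  define B where "B = R ** (A2 ** N)"
  have "parity ss ss = 1" by (simp add: parity_def)
  then have detR: "det R = - 1"
    using parity_flip[OF ss ss m0] even unfolding R_def det_diag prod_sign_change by simp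
  have R: "act R (cyc (flip ss)) = cyc ss" unfolding R_def by (rule act_sign_change[OF lt fs ss]) simp
  have AN: "A2 ** N \<in> SL_real" using SL_real_mult A N by blast
  have "act B (cyc ss) = cyc ss"
    using R A(4) F0 by (simp add: B_def flip: act_act)
  then have "B *v x \<in> cyc ss j" if "x \<in> cyc ss j" for x j
    using that unfolding act_def by (metis imageI)
  moreover have "real_matrix B"
  proof -
    have "R $ i $ j \<in> \<real>" for i j by (simp add: R_def diag_def sign_change_def)
    then show ?thesis using AN real_matrix_mult[of R "A2 ** N"] by (simp add: B_def real_matrix_def SL_real_def)
  qed
  ultimately obtain r where r: "r \<ge> 0" "det B = of_real r"
    using det_real_stabilizer_nonneg[OF even ss] by blast
  have "det B = - 1" using AN by (simp add: B_def det_mul detR SL_real_def SL_def)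
  then have "r = - 1" using r(2) by (metis of_real_1 of_real_eq_iff of_real_minus)
  then show False using r(1) by simp
qed

lemma cyc_in_orbit_SL_real:
  assumes lt: "\<forall>a<m. ls ! a < ks ! a" and ss: "ss \<in> sign_choices m" "ss' \<in> sign_choices m"
    and D: "cyc ss \<in> orbit SL_real F0" and par: "length mid = 1 \<or> parity ss ss' = 1"
  shows "cyc ss' \<in> orbit SL_real F0"
proof -
  \<comment> \<open>Chosen to give the sign change determinant 1: with one middle vector
    \<open>c\<close> can equal the parity, otherwise the parity itself is 1.\<close>
  define c where "c = (if length mid = 1 then parity ss ss' else 1)"
  have "c \<in> \<real>" "c \<noteq> 0" "c ^ length mid * parity ss ss' = 1"
    using par parity_cases[of ss ss'] by (auto simp: c_def)
  then show ?thesis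
    using orbit_SL_real_closed[OF sign_change_SL_real D] act_sign_change[OF lt ss, of c] by metis
qed

lemma card_sign_choices: "finite (sign_choices m)" "card (sign_choices m) = 2 ^ m"
proof -
  have eq: "sign_choices m = {ss. set ss \<subseteq> {\<i>, - \<i>} \<and> length ss = m}" by (auto simp: sign_choices_def)
  show "finite (sign_choices m)" unfolding eq by (rule finite_lists_length_eq) simp
  have "card {\<i>, - \<i>} = 2" by (simp add: complex_eq_iff)
  then show "card (sign_choices m) = 2 ^ m"
    unfolding eq by (simp only: card_lists_length_eq finite.intros)
qed

lemma card_cyc_image: "T \<subseteq> sign_choices m \<Longrightarrow> card (cyc ` T) = card T"
  using cyc_inj by (intro card_image inj_onI) blast

text \<open>Flipping the first sign is an involution that exchanges the sign choices inside the
  orbit with those outside.\<close>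

lemma card_half:
  assumes lt: "\<forall>a<m. ls ! a < ks ! a" and even: "mid = []" and m0: "0 < m"
    and ss0: "ss0 \<in> sign_choices m" "cyc ss0 \<in> orbit SL_real F0"
  shows "card {ss \<in> sign_choices m. cyc ss \<in> orbit SL_real F0} = 2 ^ (m - 1)"
proof -
  let ?T = "{ss \<in> sign_choices m. cyc ss \<in> orbit SL_real F0}"
  have iff: "cyc (flip ss) \<in> orbit SL_real F0 \<longleftrightarrow> cyc ss \<notin> orbit SL_real F0" if ss: "ss \<in> sign_choices m" for ss
  proof -
    \<comment> \<open>One of \<open>ss\<close> and \<open>flip ss\<close> differs from
      \<open>ss0\<close> in an even number of signs, and that one is reached from \<open>ss0\<close>
      with determinant 1.\<close>
    have "cyc ss \<in> orbit SL_real F0 \<or> cyc (flip ss) \<in> orbit SL_real F0"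
    proof (cases "parity ss ss0 = 1")
      case True
      have "parity ss0 ss = parity ss ss0" unfolding parity_def by (intro prod.cong) auto
      then show ?thesis using cyc_in_orbit_SL_real[OF lt ss0(1) ss ss0(2)] True by simp
    next
      case False
      then have "parity (flip ss) ss0 = 1" using parity_flip[OF ss ss0(1) m0] parity_cases[of ss ss0] by auto
      moreover have "parity ss0 (flip ss) = parity (flip ss) ss0" unfolding parity_def by (intro prod.cong) auto
      ultimately show ?thesis using cyc_in_orbit_SL_real[OF lt ss0(1) flip_sign_choices[OF ss] ss0(2)] by simp
    qed
    then show ?thesis using flip_not_in_orbit[OF lt even m0 ss] by blast
  qed
  have "bij_betw flip ?T (sign_choices m - ?T)"
    by (rule bij_betwI[where g = flip]) (use iff flip_sign_choices flip_flip in auto)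
  then have "card (sign_choices m - ?T) = card ?T" using bij_betw_same_card by fastforce
  moreover have "card (sign_choices m - ?T) = card (sign_choices m) - card ?T"
    using card_sign_choices(1) by (intro card_Diff_subset) auto
  moreover have "card ?T \<le> card (sign_choices m)" using card_sign_choices(1) by (intro card_mono) auto
  moreover have "(2::nat) ^ m = 2 * 2 ^ (m - 1)" using m0 by (cases m) auto
  ultimately show ?thesis using card_sign_choices(2) by linarith
qed

end

theorem theorem10:
  fixes D :: "'n::{finite,linorder} flag set"
    and w ks mid ls :: "'n list"
    and m :: nat
  defines "m \<equiv> CARD('n) div 2"
  assumes "CARD('n) \<ge> 2"
    and "D \<in> open_orbits"
    and "w \<in> permutations_of_set UNIV"
    and "strat_dim Borel (schubert w) + strat_dim SO_real (base_cycle D)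
           = strat_dim SL (flags :: 'n flag set)"
    and "schubert w \<inter> base_cycle D \<noteq> {}"
    and "w = ks @ mid @ rev ls"
    and "length ks = m" and "length ls = m"
  shows "(odd CARD('n) \<longrightarrow>
            card (schubert w \<inter> base_cycle D) = 2 ^ m \<and>
            schubert w \<inter> base_cycle D
              = {flag_of (cycle_basis ss ks mid ls) | ss. ss \<in> sign_choices m}) \<and>
         (even CARD('n) \<longrightarrow>
            card (schubert w \<inter> base_cycle D) = 2 ^ (m - 1) \<and>
            schubert w \<inter> base_cycle D
              = {flag_of (cycle_basis ss ks mid ls) | ss. ss \<in> sign_choices m} \<inter> D)"
proof -
  have perm: "distinct (ks @ mid @ rev ls)" "set (ks @ mid @ rev ls) = UNIV"
    using permutations_of_setD[OF \<open>w \<in> permutations_of_set UNIV\<close>] \<open>w = ks @ mid @ rev ls\<close> by auto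
  have cd: "cycle_data ks mid ls m"
    by unfold_locales (use perm \<open>length ks = m\<close> \<open>length ls = m\<close> in \<open>auto simp: m_def\<close>)
  interpret cycle_data ks mid ls m by (rule cd)
  obtain F0 where D: "D = orbit SL_real F0" using \<open>D \<in> open_orbits\<close> by (auto simp: open_orbits_def)
  let ?X = "schubert w \<inter> base_cycle D"
  note flag = schubert_Int_base_cycle_flag[OF cd _ assms(5)[unfolded \<open>w = ks @ mid @ rev ls\<close>], folded \<open>w = ks @ mid @ rev ls\<close>]
  obtain F where F: "F \<in> ?X" using \<open>?X \<noteq> {}\<close> by blast
  then obtain ss0 where ss0: "ss0 \<in> sign_choices m" "F = cyc ss0" and lt: "\<forall>a<m. ls ! a < ks ! a"
    using flag[OF F] by blast
  have D0: "cyc ss0 \<in> orbit SL_real F0" using F ss0 D by (auto simp: base_cycle_def)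
  \<comment> \<open>Converse inclusion: one intersection point already supplies the inequalities
    between l and k, and these place every listed flag in the Borel orbit and make it
    isotropic.\<close>
  have "cyc ss \<in> ?X" if ss: "ss \<in> sign_choices m" "cyc ss \<in> D" for ss
  proof -
    have "cyc ss \<in> orbit Borel (coord_flag w)"
      using cyc_in_orbit[OF lt sign_choices_length[OF ss(1)]] \<open>w = ks @ mid @ rev ls\<close> by (auto simp: orbit_def)
    then show ?thesis
      using orbit_subset_schubert[OF perm] cyc_isotropic[OF lt ss(1)] ss(2) \<open>w = ks @ mid @ rev ls\<close>
      by (auto simp: base_cycle_def)
  qed
  then have X: "?X = cyc ` {ss \<in> sign_choices m. cyc ss \<in> D}"
    using flag by (fastforce simp: base_cycle_def)
  have lenmid: "length mid + 2 * m = CARD('n)" using length_w len by simp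
  show ?thesis
  proof (intro conjI impI)
    assume "odd CARD('n)"
    then have "length mid = 1" using lenmid m by presburger
    then have "{ss \<in> sign_choices m. cyc ss \<in> D} = sign_choices m"
      using cyc_in_orbit_SL_real[OF lt ss0(1) _ D0] unfolding D by blast
    then have X: "?X = cyc ` sign_choices m" using X by simp
    show "card ?X = 2 ^ m" unfolding X by (simp add: card_cyc_image card_sign_choices)
    show "?X = {cyc ss | ss. ss \<in> sign_choices m}" unfolding X by blast
  next
    assume "even CARD('n)"
    then have "length mid = 0" using lenmid m by presburger
    then have mid: "mid = []" by simp
    have m0: "0 < m" using \<open>CARD('n) \<ge> 2\<close> m by simp
    show "card ?X = 2 ^ (m - 1)"
      unfolding X using card_half[OF lt mid m0 ss0(1) D0] unfolding D[symmetric]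
      by (subst card_cyc_image) auto
    show "?X = {cyc ss | ss. ss \<in> sign_choices m} \<inter> D" unfolding X by blast
  qed
qed

end
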